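(* Let $q,c\in\mathbb{C}$ with $0<|q|<1$, let $g$ be a non-constant meromorphic function on $\mathbb{C}$ of zero order, let $l>2$ be an integer, and let $a_1,a_2,\dots,a_l$ be distinct points in $\mathbb{C}\cup\{\infty\}$. Then there is a set $E_1$ of logarithmic density $1$ such that, for all $r\in E_1$, $$(l-2)T(r,g)\le\sum_{i=1}^{l}N(r,g=a_i)-N_{q,c}(r)+o(T(r,g))\le\sum_{i=1}^{l}\hat{N}_{q,c}(r,g=a_i)+o(T(r,g)),$$ where $$N_{q,c}(r)=2N(r,g)-N(r,\mathcal{D}_{q,c}g)+N\left(r,\frac{1}{\mathcal{D}_{q,c}g}\right).$$
   Context: For $q\in\mathbb{C}\setminus\{0,1\}$, $c\in\mathbb{C}$ and $g$ meromorphic on $\mathbb{C}$, the Hahn difference operator is $\mathcal{D}_{q,c}g(z)=\frac{g(qz+c)-g(z)}{(q-1)z+c}$. $T(r,\cdot)$ is the Nevanlinna characteristic function, $N(r,f)$ is the integrated counting function of poles of $f$ (with multiplicity), and $N(r,g=a)$ is the integrated counting function of $a$-points of $g$ (with multiplicity), i.e. $N(r,\frac1{g-a})$ for $a\in\mathbb{C}$ and $N(r,g)$ for $a=\infty$. The order of $g$ is $\rho(g)=\limsup_{r\to\infty}\frac{\log^{+}T(r,g)}{\log r}$. For $a\in\mathbb{C}$, $\hat n_{q,c}(r,g=a)$ is the sum, over all points $z_0$ with $|z_0|\le r$ and $g(z_0)=a$, of the integers $n-m$, where $n$ is the multiplicity of $z_0$ as a zero of $g-a$, $m=\min\{n,m'\}$,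 and $m'$ is the multiplicity of $z_0$ as a zero of $\mathcal{D}_{q,c}g$ ($m'=0$ if it is not a zero). Similarly, $\hat n_{q,c}(r,g=\infty)=\hat n_{q,c}(r,g)$ is the sum, over all poles $z_0$ of $g$ with $|z_0|\le r$, of $n-m$, where $n$ is the multiplicity of the pole, $m=\min\{n,m'\}$, and $m'$ is the multiplicity of $z_0$ as a zero of $\mathcal{D}_{q,c}\left(\frac1g\right)=-\frac{\mathcal{D}_{q,c}g(z)}{g(qz+c)g(z)}$. For $a\in\mathbb{C}\cup\{\infty\}$, $$\hat N_{q,c}(r,g=a)=\int_0^r\frac{\hat n_{q,c}(t,g=a)-\hat n_{q,c}(0,g=a)}{t}\,dt+\hat n_{q,c}(0,g=a)\log r.$$ A set $E\subset[1,\infty)$ has logarithmic density $1$ if $\lim_{r\to\infty}\frac{1}{\log r}\int_{E\cap[1,r]}\frac{dt}{t}=1$; $o(T(r,g))$ is understood as $r\to\infty$ in $E_1$. *)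

theory Defs
  imports "HOL-Complex_Analysis.Complex_Analysis" "HOL-Library.Landau_Symbols"
begin

(* All multiplicities below go through is_pole and zorder, which depend only on the punctured
   germ of a function. Hence the values that a pointwise expression such as 1 / f z or
   hahn_diff q c g z takes at the discrete set of points where a division by zero occurs, or
   where some function has a pole, are irrelevant. *)

definition log_plus :: "real \<Rightarrow> real" where
  "log_plus x = ln (max 1 x)"

(* The order at a point as a zero (resp. pole); it is 0 if the point is not a zero (resp. pole). *)
definition zero_mult :: "(complex \<Rightarrow> complex) \<Rightarrow> complex \<Rightarrow> nat" where
  "zero_mult f z = nat (zorder f z)"

definition pole_mult :: "(complex \<Rightarrow> complex) \<Rightarrow> complex \<Rightarrow> nat" where
  "pole_mult f z = nat (- zorder f z)"


(* The integrand vanishes near t = 0 when n counts points of a discrete set in |z| \<le> t. *)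
definition integrated_count :: "(real \<Rightarrow> nat) \<Rightarrow> real \<Rightarrow> real" where
  "integrated_count n r =
     integral {0..r} (\<lambda>t. (real (n t) - real (n 0)) / t) + real (n 0) * ln r"

definition pole_count :: "(complex \<Rightarrow> complex) \<Rightarrow> real \<Rightarrow> nat" where
  "pole_count f r = (\<Sum>z | norm z \<le> r \<and> is_pole f z. pole_mult f z)"

definition nevanlinna_N :: "real \<Rightarrow> (complex \<Rightarrow> complex) \<Rightarrow> real" where
  "nevanlinna_N r f = integrated_count (pole_count f) r"

definition nevanlinna_m :: "real \<Rightarrow> (complex \<Rightarrow> complex) \<Rightarrow> real" where
  "nevanlinna_m r f = 1 / (2 * pi) *
     integral {0..2 * pi} (\<lambda>t. log_plus (norm (f (of_real r * cis t))))"

definition nevanlinna_T :: "real \<Rightarrow> (complex \<Rightarrow> complex) \<Rightarrow> real" where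
  "nevanlinna_T r f = nevanlinna_m r f + nevanlinna_N r f"

definition meromorphic_order :: "(complex \<Rightarrow> complex) \<Rightarrow> ereal" where
  "meromorphic_order f =
     Limsup at_top (\<lambda>r::real. ereal (log_plus (nevanlinna_T r f) / ln r))"


(* Points of the extended complex plane: Some a is the finite point a, None is infinity. *)
type_synonym ecomplex = "complex option"

definition nevanlinna_N_at :: "real \<Rightarrow> (complex \<Rightarrow> complex) \<Rightarrow> ecomplex \<Rightarrow> real" where
  "nevanlinna_N_at r g a =
     (case a of Some b \<Rightarrow> nevanlinna_N r (\<lambda>z. 1 / (g z - b)) | None \<Rightarrow> nevanlinna_N r g)"

definition hahn_diff :: "complex \<Rightarrow> complex \<Rightarrow> (complex \<Rightarrow> complex) \<Rightarrow> complex \<Rightarrow> complex" where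
  "hahn_diff q c g z = (g (q * z + c) - g z) / ((q - 1) * z + c)"

(* In the finite case poles are excluded explicitly, since a nicely meromorphic function takes
   the value 0 at its poles. *)
definition hat_count ::
    "complex \<Rightarrow> complex \<Rightarrow> (complex \<Rightarrow> complex) \<Rightarrow> ecomplex \<Rightarrow> real \<Rightarrow> nat" where
  "hat_count q c g a r = (case a of
     Some b \<Rightarrow> (\<Sum>z | norm z \<le> r \<and> \<not> is_pole g z \<and> g z = b.
       let n = zero_mult (\<lambda>w. g w - b) z; m = min n (zero_mult (hahn_diff q c g) z)
       in n - m)
   | None \<Rightarrow> (\<Sum>z | norm z \<le> r \<and> is_pole g z.
       let n = pole_mult g z; m = min n (zero_mult (hahn_diff q c (\<lambda>w. 1 / g w)) z)
       in n - m))"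

definition hat_N ::
    "complex \<Rightarrow> complex \<Rightarrow> real \<Rightarrow> (complex \<Rightarrow> complex) \<Rightarrow> ecomplex \<Rightarrow> real" where
  "hat_N q c r g a = integrated_count (hat_count q c g a) r"

definition ramification_N ::
    "complex \<Rightarrow> complex \<Rightarrow> (complex \<Rightarrow> complex) \<Rightarrow> real \<Rightarrow> real" where
  "ramification_N q c g r =
     2 * nevanlinna_N r g - nevanlinna_N r (hahn_diff q c g)
       + nevanlinna_N r (\<lambda>z. 1 / hahn_diff q c g z)"


definition has_log_density_1 :: "real set \<Rightarrow> bool" where
  "has_log_density_1 E \<longleftrightarrow> E \<subseteq> {1..} \<and> E \<in> sets lebesgue \<and>
     ((\<lambda>r. 1 / ln r * integral (E \<inter> {1..r}) (\<lambda>t. 1 / t)) \<longlongrightarrow> 1) at_top"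

end

theory Submission
  imports Defs
begin

text \<open>
  Write \<open>s z = q z + c\<close> and \<open>D\<close> for the Hahn difference of \<open>g\<close>. As in Nevanlinna's theory, at most one of
  the values \<open>a\<^sub>i\<close> can be close to \<open>g z\<close>, so the left inequality reduces to the first main theorem for \<open>D\<close>
  together with \<open>m(r, D / (g - a)) = o(T(r, g))\<close>, that is, to \<open>m(r, f \<circ> s / f) = o(T(r, g))\<close> for \<open>f = g - a\<close>.

  Divide \<open>f\<close> by \<open>\<Prod>((z - z\<^sub>j) / R)\<^bsup>m\<^sub>j\<^esup>\<close> over its zeros and poles in the disc of radius \<open>R\<close>; the logarithm of the
  zero-free quotient varies on the circle of radius \<open>r\<close> by at most \<open>O(r / R)\<close> times a mean value that is
  \<open>O(R\<^bsup>1/2\<^esup>)\<close>, because \<open>g\<close> has order zero. Letting \<open>R\<close> tend to infinity, \<open>f \<circ> s / f\<close> is controlled by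
  its divisor alone: \<open>m(r, f \<circ> s / f) \<le> C (\<Sum> \<bar>m\<^sub>j\<bar> min(1, r / \<bar>z\<^sub>j\<bar>))\<close>.

  If \<open>N(t)\<close> is the sum of the integrated counting functions of these divisors and \<open>M(r) = r \<integral>\<^sub>r\<^sup>\<infinity> N(t) / t\<^sup>2 dt\<close>, the
  last sum is at most \<open>Q = M - N = r M'\<close>. So the logarithmic mean of \<open>Q / (1 + M)\<close> over \<open>[1, R]\<close> is
  \<open>(ln (1 + M(R)) - ln (1 + M(1))) / ln R\<close>, which tends to \<open>0\<close>, and \<open>Q = o(1 + N) = o(T)\<close> off a set of
  logarithmic density \<open>0\<close>.

  The right inequality follows by comparing multiplicities pointwise, which leaves the error
  \<open>N(r, g \<circ> s) - N(r, g)\<close>; it is bounded above since \<open>s\<close> is a contraction. Circles meeting a zero or pole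
  of one of the functions involved have only countably many radii and are discarded.
\<close>

subsection \<open>Mean values on circles\<close>

text \<open>The estimate of \<open>f \<circ> s / f\<close> must not lose growth: a remainder taken
  at a radius comparable to \<open>r\<close> would be comparable with the characteristic itself.
  Hence \<open>r\<close> is kept fixed while \<open>R\<close> tends to infinity, and the remainder
  disappears completely. What is left depends on the divisor only, so growth is measured by
  \<open>N\<close>, an explicit sum that is visibly monotone and continuous, and is compared with
  \<open>T\<close> only at the end.

  Order zero enters twice. Growth below a linear function removes the remainder; growth below every
  power of \<open>R\<close> gives \<open>ln (1 + M R) = o(ln R)\<close>, which is what produces
  logarithmic density 1.

  All targets share one weight, so one error function and one exceptional set serve them
  simultaneously. Bounded errors are absorbed because \<open>T\<close> is at least
  \<open>ln r - C\<close>; for this a value that \<open>g\<close> attains is adjoined to the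
  targets.\<close>

lemma fundamental_theorem_real:
  fixes F f :: "real \<Rightarrow> real"
  assumes "a \<le> b" "\<And>t. a \<le> t \<Longrightarrow> t \<le> b \<Longrightarrow> (F has_real_derivative f t) (at t within {a..b})"
  shows "(f has_integral (F b - F a)) {a..b}"
  using assms by (intro fundamental_theorem_of_calculus) (auto simp flip: has_real_derivative_iff_has_vector_derivative)

text \<open>The range is a general normed space because the formulas of Cauchy and Schwarz average
  complex functions, whereas proximity functions average real ones.\<close>

definition circle_mean :: "real \<Rightarrow> (complex \<Rightarrow> 'b::real_normed_vector) \<Rightarrow> 'b" where
  "circle_mean r u = (1 / (2 * pi)) *\<^sub>R integral {0..2 * pi} (\<lambda>t. u (of_real r * cis t))"

lemma nevanlinna_m_eq_circle_mean: "nevanlinna_m r f = circle_mean r (\<lambda>z. log_plus (norm (f z)))"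
  by (simp add: nevanlinna_m_def circle_mean_def)

lemma circle_integrable:
  fixes u :: "complex \<Rightarrow> 'b::banach"
  assumes "continuous_on (sphere 0 r) u" "r \<ge> 0"
  shows "(\<lambda>t. u (of_real r * cis t)) integrable_on {0..2 * pi}"
proof (rule integrable_continuous_real)
  show "continuous_on {0..2 * pi} (\<lambda>t. u (of_real r * cis t))"
    by (rule continuous_on_compose2[OF assms(1)])
       (use assms(2) in \<open>auto intro!: continuous_intros simp: norm_mult\<close>)
qed

lemma circle_mean_cong:
  assumes "\<And>z. norm z = r \<Longrightarrow> u z = v z" "r \<ge> 0"
  shows "circle_mean r u = circle_mean r v"
  unfolding circle_mean_def using assms by (auto simp: norm_mult intro!: arg_cong[of _ _ "scaleR _"] integral_cong)

lemma circle_mean_const [simp]: "circle_mean r (\<lambda>_. c :: 'b::banach) = c"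
  by (simp add: circle_mean_def scaleR_scaleR)

lemma circle_mean_add:
  fixes u v :: "complex \<Rightarrow> 'b::banach"
  assumes "continuous_on (sphere 0 r) u" "continuous_on (sphere 0 r) v" "r \<ge> 0"
  shows "circle_mean r (\<lambda>z. u z + v z) = circle_mean r u + circle_mean r v"
  unfolding circle_mean_def
  by (subst integral_add) (use assms in \<open>auto intro!: circle_integrable simp: scaleR_add_right\<close>)

lemma circle_mean_diff:
  fixes u v :: "complex \<Rightarrow> 'b::banach"
  assumes "continuous_on (sphere 0 r) u" "continuous_on (sphere 0 r) v" "r \<ge> 0"
  shows "circle_mean r (\<lambda>z. u z - v z) = circle_mean r u - circle_mean r v"
  unfolding circle_mean_def
  by (subst integral_diff) (use assms in \<open>auto intro!: circle_integrable simp: scaleR_diff_right\<close>)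

lemma circle_mean_cmult:
  fixes u :: "complex \<Rightarrow> real"
  shows "circle_mean r (\<lambda>z. c * u z) = c * circle_mean r u"
  unfolding circle_mean_def by simp

lemma circle_mean_sum:
  fixes u :: "'i \<Rightarrow> complex \<Rightarrow> 'b::banach"
  assumes "\<And>i. i \<in> I \<Longrightarrow> continuous_on (sphere 0 r) (u i)" "r \<ge> 0" "finite I"
  shows "circle_mean r (\<lambda>z. \<Sum>i\<in>I. u i z) = (\<Sum>i\<in>I. circle_mean r (u i))"
  unfolding circle_mean_def
  by (subst integral_sum) (use assms in \<open>auto intro!: circle_integrable simp: scaleR_sum_right\<close>)

lemma circle_mean_linear:
  fixes u :: "complex \<Rightarrow> 'b::banach"
  assumes "continuous_on (sphere 0 r) u" "r \<ge> 0" "bounded_linear h"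
  shows "circle_mean r (\<lambda>z. h (u z)) = h (circle_mean r u)"
proof -
  interpret bounded_linear h by fact
  show ?thesis
    unfolding circle_mean_def scaleR
    using integral_linear[OF circle_integrable[OF assms(1,2)] assms(3)] by (simp add: o_def)
qed

lemma circle_mean_mono:
  fixes u v :: "complex \<Rightarrow> real"
  assumes "continuous_on (sphere 0 r) u" "continuous_on (sphere 0 r) v" "r \<ge> 0"
    and "\<And>z. norm z = r \<Longrightarrow> u z \<le> v z"
  shows "circle_mean r u \<le> circle_mean r v"
  unfolding circle_mean_def
  using assms by (auto intro!: divide_right_mono integral_le circle_integrable simp: norm_mult)

lemma norm_circle_mean_le:
  fixes u :: "complex \<Rightarrow> 'b::euclidean_space" and v :: "complex \<Rightarrow> real"
  assumes "continuous_on (sphere 0 r) u" "continuous_on (sphere 0 r) v" "r \<ge> 0"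
    and "\<And>z. norm z = r \<Longrightarrow> norm (u z) \<le> v z"
  shows "norm (circle_mean r u) \<le> circle_mean r v"
  unfolding circle_mean_def
  using assms
  by (auto intro!: divide_right_mono integral_norm_bound_integral circle_integrable simp: norm_mult)

text \<open>Covers circles through poles as well: a non-integrable integrand has integral 0 by
  convention.\<close>

lemma circle_mean_nonneg:
  fixes u :: "complex \<Rightarrow> real"
  assumes "\<And>z. norm z = r \<Longrightarrow> u z \<ge> 0" "r \<ge> 0"
  shows "circle_mean r u \<ge> 0"
proof -
  have "integral {0..2 * pi} (\<lambda>t. u (of_real r * cis t)) \<ge> 0"
  proof (cases "(\<lambda>t. u (of_real r * cis t)) integrable_on {0..2 * pi}")
    case True
    thus ?thesis using assms by (intro integral_nonneg) (auto simp: norm_mult)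
  qed (simp add: not_integrable_integral)
  thus ?thesis by (simp add: circle_mean_def)
qed
     
section \<open>Integral formulas of Cauchy and Schwarz on circles\<close>

lemma holomorphic_imp_continuous_on_sphere:
  "h holomorphic_on cball 0 R \<Longrightarrow> continuous_on (sphere 0 R) h"
  by (rule continuous_on_subset[OF holomorphic_on_imp_continuous_on]) auto

text \<open>On the circle \<open>d\<zeta> = \<i> \<zeta> dt\<close>, which turns the Cauchy kernel
  into \<open>\<zeta> / (\<zeta> - z)\<close>.\<close>

lemma Cauchy_circle_mean:
  assumes "h holomorphic_on cball 0 R" "norm z < R"
  shows "circle_mean R (\<lambda>\<zeta>. h \<zeta> * \<zeta> / (\<zeta> - z)) = h z"
proof -
  have R: "R > 0" using assms(2) norm_ge_zero[of z] by linarith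
  have "((\<lambda>u. h u/(u-z)) has_contour_integral (2 * of_real pi * \<i> * h z)) (circlepath 0 R)"
    using Cauchy_integral_circlepath_simple[of h 0 R z] assms by simp
  hence "((\<lambda>t. h (R * cis t) / (R * cis t - z) * R * \<i> * cis t) has_integral (2 * of_real pi * \<i> * h z))
           {0..2*pi}"
    unfolding circlepath_def by (subst (asm) has_contour_integral_part_circlepath_iff) auto
  hence "((\<lambda>t. (h (R * cis t) / (R * cis t - z) * R * \<i> * cis t) * (-\<i>)) has_integral
       ((2 * of_real pi * \<i> * h z) * (- \<i>))) {0..2*pi}"
    by (rule has_integral_mult_left)
  hence "((\<lambda>t. h (R * cis t) * (R * cis t) / (R * cis t - z)) has_integral (2 * of_real pi * h z)) {0..2*pi}"
    by (simp add: field_simps)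
  hence "integral {0..2*pi} (\<lambda>t. h (R * cis t) * (R * cis t) / (R * cis t - z)) = 2 * of_real pi * h z"
    by (rule integral_unique)
  thus ?thesis
    by (simp add: circle_mean_def scaleR_conv_of_real)
qed

lemma holomorphic_circle_mean:
  assumes "h holomorphic_on cball 0 R" "R > 0"
  shows "circle_mean R h = h 0"
proof -
  have "circle_mean R h = circle_mean R (\<lambda>\<zeta>. h \<zeta> * \<zeta> / (\<zeta> - 0))"
    using assms(2) by (intro circle_mean_cong) auto
  also have "\<dots> = h 0"
    using assms by (intro Cauchy_circle_mean) auto
  finally show ?thesis .
qed

lemma Re_holomorphic_circle_mean:
  assumes "h holomorphic_on cball 0 R" "R > 0"
  shows "circle_mean R (\<lambda>z. Re (h z)) = Re (h 0)"
  using assms circle_mean_linear[of R h Re] holomorphic_circle_mean[OF assms]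
  by (simp add: bounded_linear_Re holomorphic_imp_continuous_on_sphere)

text \<open>Schwarz's formula recovers a holomorphic function from its real part. Split
  \<open>2 Re L\<close> into \<open>L\<close> and its conjugate. Cauchy's formula handles the first
  part. For the second, \<open>R^2 = \<zeta> * cnj \<zeta>\<close> on the circle shows that the
  integrand is the conjugate of a function \<open>k\<close> holomorphic in the disc, whose mean is
  \<open>k 0 = L 0\<close>.\<close>

lemma Schwarz_circle_mean:
  assumes L: "L holomorphic_on cball 0 R" and z: "norm z < R"
  shows "circle_mean R (\<lambda>\<zeta>. of_real (2 * Re (L \<zeta>)) * \<zeta> / (\<zeta> - z)) = L z + cnj (L 0)"
proof -
  have R: "R > 0" using z norm_ge_zero[of z] by linarith
  note contL = holomorphic_imp_continuous_on_sphere[OF L]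
  have ne: "\<zeta> - z \<noteq> 0" if "norm \<zeta> = R" for \<zeta> using that z by auto
  have den: "of_real (R^2) - cnj z * \<zeta> \<noteq> 0" if "norm \<zeta> \<le> R" for \<zeta>
  proof
    assume "of_real (R^2) - cnj z * \<zeta> = 0"
    hence "norm (of_real (R^2) :: complex) = norm (cnj z * \<zeta>)" by simp
    also have "\<dots> \<le> norm z * R" using that by (auto simp: norm_mult intro: mult_left_mono)
    also have "\<dots> < R * R" using z R by simp
    finally show False by (simp only: norm_of_real power2_eq_square) 
  qed
  define k where "k = (\<lambda>\<zeta>. L \<zeta> * (of_real (R^2) / (of_real (R^2) - cnj z * \<zeta>)))"
  have holk: "k holomorphic_on cball 0 R"
    unfolding k_def by (intro holomorphic_intros L den) auto
  note contk = holomorphic_imp_continuous_on_sphere[OF holk]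
  have cnj_eq: "cnj (L \<zeta>) * \<zeta> / (\<zeta> - z) = cnj (k \<zeta>)" if "norm \<zeta> = R" for \<zeta>
  proof -
    have 1: "of_real (R^2) = \<zeta> * cnj \<zeta>"
      using that complex_norm_square[of \<zeta>] by simp
    have "\<zeta> \<noteq> 0" using that R by auto
    hence "of_real (R^2) / (of_real (R^2) - z * cnj \<zeta>) = \<zeta> / (\<zeta> - z)"
      unfolding 1 using ne[OF that] by (simp add: field_simps)
    thus ?thesis unfolding k_def complex_cnj_mult complex_cnj_divide complex_cnj_diff
      by (metis complex_cnj_cnj complex_cnj_complex_of_real times_divide_eq_right)
  qed
  have split: "of_real (2 * Re w) = w + cnj w" for w :: complex
    using complex_add_cnj[of w] by simp
  have cont1: "continuous_on (sphere 0 R) (\<lambda>\<zeta>. L \<zeta> * \<zeta> / (\<zeta> - z))"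
    by (intro continuous_intros contL) (use ne in auto)
  have "circle_mean R (\<lambda>\<zeta>. of_real (2 * Re (L \<zeta>)) * \<zeta> / (\<zeta> - z)) =
        circle_mean R (\<lambda>\<zeta>. L \<zeta> * \<zeta> / (\<zeta> - z) + cnj (k \<zeta>))"
  proof (intro circle_mean_cong)
    fix \<zeta> :: complex assume n: "norm \<zeta> = R"
    show "of_real (2 * Re (L \<zeta>)) * \<zeta> / (\<zeta> - z) = L \<zeta> * \<zeta> / (\<zeta> - z) + cnj (k \<zeta>)"
      unfolding split cnj_eq[OF n, symmetric] by (simp add: ring_distribs add_divide_distrib)
  qed (use R in auto)
  also have "\<dots> = circle_mean R (\<lambda>\<zeta>. L \<zeta> * \<zeta> / (\<zeta> - z)) + circle_mean R (\<lambda>\<zeta>. cnj (k \<zeta>))"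
    using R by (intro circle_mean_add cont1 continuous_intros contk) auto
  also have "circle_mean R (\<lambda>\<zeta>. L \<zeta> * \<zeta> / (\<zeta> - z)) = L z"
    using Cauchy_circle_mean[OF L z] by simp
  also have "circle_mean R (\<lambda>\<zeta>. cnj (k \<zeta>)) = cnj (circle_mean R k)"
    using R by (intro circle_mean_linear contk bounded_linear_cnj) auto
  also have "circle_mean R k = L 0"
    using holomorphic_circle_mean[OF holk R] R by (simp add: k_def)
  finally show ?thesis .
qed

text \<open>The constant \<open>cnj (L 0)\<close> cancels between two Schwarz formulas. The
  difference of the kernels is at most \<open>R * 2r / (R/2)^2 = 8 r / R\<close>, and the factor 2
  in front of \<open>Re L\<close> makes this \<open>16 r / R\<close>.\<close>

lemma holomorphic_diff_le_mean_Re: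
  assumes L: "L holomorphic_on cball 0 R" and r: "2 * r \<le> R" "r > 0" "norm z \<le> r" "norm w \<le> r"
  shows "norm (L z - L w) \<le> 16 * r / R * circle_mean R (\<lambda>\<zeta>. \<bar>Re (L \<zeta>)\<bar>)"
proof -
  have R: "R > 0" using r by linarith
  note contL = holomorphic_imp_continuous_on_sphere[OF L]
  have zR: "norm z < R" "norm w < R" using r by linarith+
  have ne: "\<zeta> \<noteq> z" "\<zeta> \<noteq> w" if "norm \<zeta> = R" for \<zeta> using that zR by auto
  have "L z - L w = circle_mean R (\<lambda>\<zeta>. of_real (2 * Re (L \<zeta>)) * \<zeta> / (\<zeta> - z)) -
                    circle_mean R (\<lambda>\<zeta>. of_real (2 * Re (L \<zeta>)) * \<zeta> / (\<zeta> - w))"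
    using Schwarz_circle_mean[OF L zR(1)] Schwarz_circle_mean[OF L zR(2)] by simp
  also have "\<dots> = circle_mean R (\<lambda>\<zeta>. of_real (2 * Re (L \<zeta>)) * \<zeta> / (\<zeta> - z) - of_real (2 * Re (L \<zeta>)) * \<zeta> / (\<zeta> - w))"
    using R ne by (intro circle_mean_diff [symmetric] continuous_intros contL) auto
  also have "norm \<dots> \<le> circle_mean R (\<lambda>\<zeta>. (16 * r / R) * \<bar>Re (L \<zeta>)\<bar>)"
  proof (intro norm_circle_mean_le)
    fix \<zeta> :: complex assume n: "norm \<zeta> = R"
    have "of_real (2 * Re (L \<zeta>)) * \<zeta> / (\<zeta> - z) - of_real (2 * Re (L \<zeta>)) * \<zeta> / (\<zeta> - w) =
          of_real (2 * Re (L \<zeta>)) * (\<zeta> * (z - w) / ((\<zeta> - z) * (\<zeta> - w)))"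
      using ne[OF n] by (simp add: divide_simps) (simp add: algebra_simps)
    also have "norm \<dots> = 2 * \<bar>Re (L \<zeta>)\<bar> * (R * norm (z - w) / (norm (\<zeta> - z) * norm (\<zeta> - w)))"
      by (simp add: norm_mult norm_divide n)
    also have "\<dots> \<le> 2 * \<bar>Re (L \<zeta>)\<bar> * (R * (2 * r) / ((R/2) * (R/2)))"
    proof (intro mult_left_mono frac_le mult_mono)
      show "norm (z - w) \<le> 2 * r" using norm_triangle_ineq4[of z w] r by linarith
      show "R/2 \<le> norm (\<zeta> - z)" using norm_triangle_ineq2[of \<zeta> z] n r by linarith
      show "R/2 \<le> norm (\<zeta> - w)" using norm_triangle_ineq2[of \<zeta> w] n r by linarith
    qed (use R r in auto)
    also have "\<dots> = (16 * r / R) * \<bar>Re (L \<zeta>)\<bar>" using R by (simp add: field_simps)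
    finally show "norm (of_real (2 * Re (L \<zeta>)) * \<zeta> / (\<zeta> - z) - of_real (2 * Re (L \<zeta>)) * \<zeta> / (\<zeta> - w)) \<le> (16 * r / R) * \<bar>Re (L \<zeta>)\<bar>" .
  qed (use R ne in \<open>auto intro!: continuous_intros contL\<close>)
  also have "\<dots> = 16 * r / R * circle_mean R (\<lambda>\<zeta>. \<bar>Re (L \<zeta>)\<bar>)"
    by (rule circle_mean_cmult)
  finally show ?thesis .
qed

section \<open>Logarithmic means of linear factors\<close>

text \<open>In the closed disc \<open>1 - b z\<close> has positive real part, so its principal
  logarithm is holomorphic there and vanishes at 0.\<close>

lemma circle_mean_ln_one_minus:
  assumes "norm b * R < 1" "R > 0"
  shows "circle_mean R (\<lambda>z. ln (norm (1 - b * z))) = 0"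
proof -
  have small: "norm (b * z) < 1" if "norm z \<le> R" for z
    using mult_left_mono[OF that, of "norm b"] assms by (simp add: norm_mult)
  have pos: "Re (1 - b * z) > 0" if "norm z \<le> R" for z
    using small[OF that] complex_Re_le_cmod[of "b * z"] by (simp del: times_complex.sel)
  define h where "h = (\<lambda>z. Ln (1 - b * z))"
  have "h holomorphic_on cball 0 R"
    unfolding h_def by (intro holomorphic_intros) (auto dest!: pos simp: complex_nonpos_Reals_iff)
  from Re_holomorphic_circle_mean[OF this assms(2)]
  have "circle_mean R (\<lambda>z. Re (h z)) = 0" by (simp add: h_def)
  moreover have "circle_mean R (\<lambda>z. ln (norm (1 - b * z))) = circle_mean R (\<lambda>z. Re (h z))"
  proof (intro circle_mean_cong)
    fix z :: complex assume "norm z = R"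
    hence "1 - b * z \<noteq> 0" using small[of z] by (metis norm_one order.refl order_less_irrefl right_minus_eq)
    thus "ln (norm (1 - b * z)) = Re (h z)" by (simp add: h_def)
  qed (use assms in auto)
  ultimately show ?thesis by simp
qed

text \<open>On the circle, \<open>norm (z - a)\<close> is a constant \<open>C\<close> times
  \<open>norm (1 - b z)\<close> with \<open>norm b * R < 1\<close>. For \<open>a\<close> outside
  take \<open>b = 1 / a\<close> and \<open>C = norm a\<close>; for \<open>a\<close> inside use the
  reflected point, \<open>b = cnj a / R^2\<close> and \<open>C = R\<close>.\<close>

lemma circle_mean_ln_dist:
  assumes "norm a \<noteq> R" "R > 0"
  shows "circle_mean R (\<lambda>z. ln (norm (z - a))) = ln (max R (norm a))"
proof -
  have aux: "circle_mean R (\<lambda>z. ln (norm (z - a))) = ln C"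
    if "norm b * R < 1" "C > 0" "\<And>z. norm z = R \<Longrightarrow> norm (z - a) = C * norm (1 - b * z)" for b C
  proof -
    have ne: "1 - b * z \<noteq> 0" if "norm z = R" for z
    proof
      assume "1 - b * z = 0"
      hence "norm (b * z) = 1" by simp
      with that \<open>norm b * R < 1\<close> show False by (simp only: norm_mult)
    qed
    have "circle_mean R (\<lambda>z. ln (norm (z - a))) = circle_mean R (\<lambda>z. ln C + ln (norm (1 - b * z)))"
      using that assms ne by (intro circle_mean_cong) (auto simp: ln_mult)
    also have "\<dots> = circle_mean R (\<lambda>z. ln C) + circle_mean R (\<lambda>z. ln (norm (1 - b * z)))"
      using assms ne by (intro circle_mean_add continuous_intros) auto
    also have "\<dots> = ln C" using circle_mean_ln_one_minus[OF that(1) assms(2)] by simp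
    finally show ?thesis .
  qed
  show ?thesis
  proof (cases "norm a > R")
    case True
    hence "a \<noteq> 0" using assms by auto
    have "circle_mean R (\<lambda>z. ln (norm (z - a))) = ln (norm a)"
    proof (rule aux[of "1 / a"])
      fix z :: complex assume "norm z = R"
      have "norm (z - a) = norm (a * (1 - 1 / a * z))"
        using \<open>a \<noteq> 0\<close> by (simp add: algebra_simps norm_minus_commute)
      thus "norm (z - a) = norm a * norm (1 - 1 / a * z)" by (simp only: norm_mult)
    qed (use True assms \<open>a \<noteq> 0\<close> in \<open>auto simp: norm_divide field_simps\<close>)
    thus ?thesis using True by (simp add: max_def)
  next
    case False
    hence aR: "norm a < R" using assms by auto
    have "circle_mean R (\<lambda>z. ln (norm (z - a))) = ln R"
    proof (rule aux[of "cnj a / of_real (R^2)"])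
      show "norm (cnj a / of_real (R^2)) * R < 1"
        using aR assms by (simp add: norm_divide power2_eq_square norm_mult)
    next
      fix z :: complex assume z: "norm z = R"
      have 1: "of_real (R^2) = z * cnj z"
        using z complex_norm_square[of z] by simp
      have "norm (z - a) * R = norm (z * cnj (z - a))" using z by (simp only: norm_mult complex_mod_cnj mult.commute)
      also have "z * cnj (z - a) = of_real (R^2) * (1 - cnj a / of_real (R^2) * z)"
      proof -
        have "of_real (R^2) * (1 - cnj a / of_real (R^2) * z) = of_real (R^2) - cnj a * z"
          using assms by (simp add: right_diff_distrib)
        thus ?thesis unfolding 1 by (simp add: algebra_simps)
      qed
      also have "norm \<dots> = R^2 * norm (1 - cnj a / of_real (R^2) * z)" 
        by (simp add: norm_mult norm_power)
      finally show "norm (z - a) = R * norm (1 - cnj a / of_real (R^2) * z)"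
        using assms by (simp add: power2_eq_square)
    qed (use assms in auto)
    thus ?thesis using aR by (simp add: max_def)
  qed
qed

text \<open>If \<open>x \<le> m\<close> and \<open>m \<ge> 0\<close>, then
  \<open>\<bar>x\<bar> \<le> 2 m - x\<close>. This is applied to
  \<open>x = ln (norm (z - a) / R)\<close>, whose mean is nonnegative, with the pointwise upper
  bound \<open>m = ln (1 + norm a / R)\<close>.\<close>

lemma circle_mean_abs_ln_dist_le:
  assumes "norm a \<noteq> R" "R > 0"
  shows "circle_mean R (\<lambda>z. \<bar>ln (norm (z - a) / R)\<bar>) \<le> 2 * ln (1 + norm a / R)"
proof -
  have ne: "z \<noteq> a" if "norm z = R" for z using that assms by auto
  have cont: "continuous_on (sphere 0 R) (\<lambda>z. ln (norm (z - a)))"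
    using ne by (intro continuous_intros) auto
  have "circle_mean R (\<lambda>z. \<bar>ln (norm (z - a) / R)\<bar>) \<le>
        circle_mean R (\<lambda>z. (2 * ln (1 + norm a / R) + ln R) - ln (norm (z - a)))"
  proof (intro circle_mean_mono)
    fix z :: complex assume z: "norm z = R"
    have p: "norm (z - a) > 0" using ne[OF z] by simp
    have eq: "ln (norm (z - a) / R) = ln (norm (z - a)) - ln R"
      using p assms by (simp add: ln_div)
    have "norm (z - a) / R \<le> 1 + norm a / R"
      using norm_triangle_ineq4[of z a] z assms by (simp add: field_simps)
    hence "ln (norm (z - a) / R) \<le> ln (1 + norm a / R)"
      using p assms by (subst ln_le_cancel_iff) (auto intro!: divide_pos_pos add_pos_nonneg)
    moreover have "ln (1 + norm a / R) \<ge> 0" using assms by simp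
    ultimately show "\<bar>ln (norm (z - a) / R)\<bar> \<le> (2 * ln (1 + norm a / R) + ln R) - ln (norm (z - a))"
      using eq by linarith
  qed (use assms ne cont in \<open>auto intro!: continuous_intros\<close>)
  also have "\<dots> = (2 * ln (1 + norm a / R) + ln R) - ln (max R (norm a))"
    using assms cont by (subst circle_mean_diff) (auto simp: circle_mean_ln_dist)
  also have "ln R \<le> ln (max R (norm a))" using assms by simp
  finally show ?thesis by simp
qed

subsection \<open>Divisors of meromorphic functions and integrated counting functions\<close>

text \<open>Nonvanishing is required on punctured neighbourhoods, so values at zeros and poles do
  not matter. On this class, which is closed under products, quotients and affine substitutions,
  \<open>zorder\<close> is additive.\<close>

definition mero_nz :: "(complex \<Rightarrow> complex) \<Rightarrow> bool" where
  "mero_nz f \<longleftrightarrow> f meromorphic_on UNIV \<and> (\<forall>z. \<forall>\<^sub>F w in at z. f w \<noteq> 0)"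

lemma mero_nzD:
  assumes "mero_nz f"
  shows "f meromorphic_on A" "isolated_singularity_at f z" "not_essential f z"
    "\<forall>\<^sub>F w in at z. f w \<noteq> 0" "\<exists>\<^sub>F w in at z. f w \<noteq> 0"
proof -
  have *: "f meromorphic_on UNIV" "\<forall>\<^sub>F w in at z. f w \<noteq> 0"
    using assms by (auto simp: mero_nz_def)
  show "f meromorphic_on A" by (rule meromorphic_on_subset[OF *(1)]) auto
  show "isolated_singularity_at f z" "not_essential f z"
    using *(1) by (auto simp: meromorphic_on_altdef)
  show "\<forall>\<^sub>F w in at z. f w \<noteq> 0" by fact
  thus "\<exists>\<^sub>F w in at z. f w \<noteq> 0" by (intro eventually_frequently) auto
qed

lemma mero_nzI:
  assumes "f meromorphic_on UNIV" "\<And>z. \<forall>\<^sub>F w in at z. f w \<noteq> 0"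
  shows "mero_nz f"
  using assms by (simp add: mero_nz_def)

lemma mero_nz_mult:
  assumes "mero_nz f" "mero_nz g"
  shows "mero_nz (\<lambda>z. f z * g z)"
proof (rule mero_nzI)
  show "(\<lambda>z. f z * g z) meromorphic_on UNIV"
    by (intro meromorphic_intros mero_nzD assms)
  show "\<forall>\<^sub>F w in at z. f w * g w \<noteq> 0" for z
    using mero_nzD(4)[OF assms(1), of z] mero_nzD(4)[OF assms(2), of z] by eventually_elim auto
qed

lemma mero_nz_inverse:
  assumes "mero_nz f"
  shows "mero_nz (\<lambda>z. inverse (f z))"
proof (rule mero_nzI)
  show "(\<lambda>z. inverse (f z)) meromorphic_on UNIV"
    by (intro meromorphic_intros mero_nzD assms)
  show "\<forall>\<^sub>F w in at z. inverse (f w) \<noteq> 0" for z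
    using mero_nzD(4)[OF assms(1), of z] by eventually_elim auto
qed

lemma mero_nz_divide:
  assumes "mero_nz f" "mero_nz g"
  shows "mero_nz (\<lambda>z. f z / g z)"
  using mero_nz_mult[OF assms(1) mero_nz_inverse[OF assms(2)]] by (simp add: field_simps)

lemma mero_nz_compose_affine:
  assumes "mero_nz f" "q \<noteq> 0"
  shows "mero_nz (\<lambda>z. f (q * z + c))"
proof (rule mero_nzI)
  show "(\<lambda>z. f (q * z + c)) meromorphic_on UNIV"
    by (rule meromorphic_on_compose[of f UNIV "\<lambda>z. q * z + c"])
       (auto intro!: mero_nzD[OF assms(1)] analytic_intros)
  have "filterlim (\<lambda>w. q * w + c) (at (q * z + c)) (at z)" for z
    using assms(2) by (intro filterlim_atI tendsto_intros) (auto simp: eventually_at_filter)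
  thus "\<forall>\<^sub>F w in at z. f (q * w + c) \<noteq> 0" for z
    using mero_nzD(4)[OF assms(1), of "q * z + c"] by (rule eventually_compose_filterlim [rotated])
qed

lemma zorder_compose_affine:
  assumes "mero_nz f" "q \<noteq> 0"
  shows "zorder (\<lambda>z. f (q * z + c)) z = zorder f (q * z + c)"
proof -
  define h where "h = (\<lambda>u. f (u + c))"
  have "mero_nz h" using mero_nz_compose_affine[OF assms(1), of 1 c] by (simp add: h_def)
  hence "zorder (\<lambda>w. h (q * w)) z = zorder h (q * z)"
    using assms(2) by (intro Meromorphic.zorder_scale) (auto intro: mero_nzD)
  moreover have "zorder h (q * z) = zorder f (q * z + c)"
    unfolding h_def using zorder_shift[of f "q * z + c"] zorder_shift[of "\<lambda>u. f (u + c)" "q * z"]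
    by (simp add: o_def add_ac)
  ultimately show ?thesis by (simp add: h_def)
qed

lemma mero_nz_diff_const:
  assumes "f nicely_meromorphic_on UNIV" "\<not> f constant_on UNIV"
  shows "mero_nz (\<lambda>z. f z - b)"
proof (rule mero_nzI)
  show "(\<lambda>z. f z - b) meromorphic_on UNIV"
    using assms by (auto intro!: meromorphic_intros simp: nicely_meromorphic_on_def)
  have "\<forall>\<^sub>\<approx>x\<in>UNIV. f x \<noteq> b"
    using nicely_meromorphic_imp_constant_or_avoid[OF assms(1), of b] assms(2)
    by (auto simp: constant_on_def)
  hence "\<forall>\<^sub>F w in at z. f w \<noteq> b" for z
    by (rule eventually_cosparse_imp_eventually_at) auto
  thus "\<forall>\<^sub>F w in at z. f w - b \<noteq> 0" for z by simp
qed

lemma zorder_mero_nz_mult: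
  assumes "mero_nz f" "mero_nz g"
  shows "zorder (\<lambda>z. f z * g z) z = zorder f z + zorder g z"
  by (intro zorder_mult mero_nzD assms)

lemma zorder_mero_nz_divide:
  assumes "mero_nz f" "mero_nz g"
  shows "zorder (\<lambda>z. f z / g z) z = zorder f z - zorder g z"
  by (intro zorder_divide mero_nzD assms)

lemma zorder_mero_nz_inverse:
  assumes "mero_nz f"
  shows "zorder (\<lambda>z. 1 / f z) z = - zorder f z"
  using zorder_inverse[OF mero_nzD(2,3,5)[OF assms]] by (simp add: divide_inverse)

lemma is_pole_iff_zorder:
  assumes "mero_nz f"
  shows "is_pole f z \<longleftrightarrow> zorder f z < 0"
  using isolated_pole_imp_neg_zorder[OF mero_nzD(2)[OF assms]]
    zorder_neg_imp_is_pole[OF mero_nzD(1,4)[OF assms]] by blast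

text \<open>Stronger than \<open>zorder f z = 0\<close>, which ignores the value at
  \<open>z\<close>: mean values over circles see the actual values, also at removable
  singularities.\<close>

definition regular_pt :: "(complex \<Rightarrow> complex) \<Rightarrow> complex \<Rightarrow> bool" where
  "regular_pt f z \<longleftrightarrow> f analytic_on {z} \<and> f z \<noteq> 0"

lemma regular_pt_zorder: "regular_pt f z \<Longrightarrow> zorder f z = 0"
  by (auto simp: regular_pt_def intro: zorder_eq_0I)

lemma sparse_not_regular:
  assumes "mero_nz f"
  shows "{z. \<not> regular_pt f z} sparse_in UNIV"
proof -
  have "\<forall>\<^sub>\<approx>z\<in>UNIV. f analytic_on {z}"
    using assms by (intro meromorphic_on_imp_analytic_cosparse mero_nzD)
  moreover have "\<forall>\<^sub>\<approx>z\<in>UNIV. f z \<noteq> 0"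
    using mero_nzD(4)[OF assms] by (subst eventually_cosparse_open_eq) auto
  ultimately have "\<forall>\<^sub>\<approx>z\<in>UNIV. regular_pt f z"
    unfolding regular_pt_def by eventually_elim auto
  thus ?thesis by (simp add: eventually_cosparse)
qed

lemma finite_not_regular:
  assumes "mero_nz f"
  shows "finite {z. norm z \<le> r \<and> \<not> regular_pt f z}"
proof -
  have "{z. \<not> regular_pt f z} sparse_in (cball 0 r)"
    using sparse_in_subset[OF sparse_not_regular[OF assms]] by auto
  hence "finite (cball 0 r \<inter> {z. \<not> regular_pt f z})"
    by (intro sparse_in_compact_finite) auto
  thus ?thesis by (rule finite_subset[rotated]) auto
qed

lemma finite_zorder_nonzero:
  assumes "mero_nz f"
  shows "finite {z. norm z \<le> r \<and> zorder f z \<noteq> 0}"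
  by (rule finite_subset[OF _ finite_not_regular[OF assms, of r]]) (auto simp: regular_pt_zorder)

definition regular_circle :: "(complex \<Rightarrow> complex) \<Rightarrow> real \<Rightarrow> bool" where
  "regular_circle f r \<longleftrightarrow> (\<forall>z. norm z = r \<longrightarrow> regular_pt f z)"

lemma countable_not_regular_circle:
  assumes "mero_nz f"
  shows "countable {r. \<not> regular_circle f r}"
proof -
  have "countable {z. \<not> regular_pt f z}"
    using sparse_imp_countable[OF _ sparse_not_regular[OF assms]] by auto
  moreover have "{r. \<not> regular_circle f r} \<subseteq> norm ` {z. \<not> regular_pt f z}"
    by (auto simp: regular_circle_def)
  ultimately show ?thesis by (meson countable_image countable_subset)
qed

lemma regular_circle_continuous:
  assumes "regular_circle f r"
  shows "continuous_on (sphere 0 r) f"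
  using assms by (auto simp: regular_circle_def regular_pt_def continuous_at_imp_continuous_on analytic_at_imp_isCont)

lemma regular_circle_nonzero: "regular_circle f r \<Longrightarrow> norm z = r \<Longrightarrow> f z \<noteq> 0"
  by (auto simp: regular_circle_def regular_pt_def)

lemma regular_circle_zorder: "regular_circle f r \<Longrightarrow> norm z = r \<Longrightarrow> zorder f z = 0"
  by (auto simp: regular_circle_def regular_pt_zorder)

text \<open>The value 1 at the origin turns \<open>\<Sum> w z * ln (r / norm1 z)\<close> into the integrated counting function.\<close>
definition norm1 :: "complex \<Rightarrow> real" where
  "norm1 z = (if z = 0 then 1 else norm z)"

lemma norm1_simps [simp]: "norm1 z > 0" "norm1 z \<ge> 0" "norm1 z \<noteq> 0" "norm1 0 = 1" "z \<noteq> 0 \<Longrightarrow> norm1 z = norm z"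
  by (auto simp: norm1_def)

definition weight_N :: "(complex \<Rightarrow> real) \<Rightarrow> real \<Rightarrow> real" where
  "weight_N w r = (\<Sum>z | norm z \<le> r \<and> w z \<noteq> 0. w z * ln (r / norm1 z))"

definition locally_finite_weight :: "(complex \<Rightarrow> real) \<Rightarrow> bool" where
  "locally_finite_weight w \<longleftrightarrow> (\<forall>r. finite {z. norm z \<le> r \<and> w z \<noteq> 0})"

lemma locally_finite_weightD: "locally_finite_weight w \<Longrightarrow> finite {z. norm z \<le> r \<and> w z \<noteq> 0}"
  by (simp add: locally_finite_weight_def)

lemma locally_finite_weight_mono:
  assumes "locally_finite_weight w" "\<And>z. w z = 0 \<Longrightarrow> v z = 0"
  shows "locally_finite_weight v"
  unfolding locally_finite_weight_def
proof
  fix r show "finite {z. norm z \<le> r \<and> v z \<noteq> 0}"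
    by (rule finite_subset[OF _ locally_finite_weightD[OF assms(1), of r]]) (use assms(2) in auto)
qed

lemma locally_finite_weight_add:
  assumes "locally_finite_weight w" "locally_finite_weight v"
  shows "locally_finite_weight (\<lambda>z. w z + v z)"
  unfolding locally_finite_weight_def
proof
  fix r show "finite {z. norm z \<le> r \<and> w z + v z \<noteq> 0}"
    by (rule finite_subset[OF _ finite_UnI[OF locally_finite_weightD[OF assms(1), of r] 
             locally_finite_weightD[OF assms(2), of r]]]) auto
qed

lemma locally_finite_weight_sum:
  assumes "\<And>i. i \<in> I \<Longrightarrow> locally_finite_weight (w i)"
  shows "locally_finite_weight (\<lambda>z. \<Sum>i\<in>I. w i z)"
  using assms
  by (induction I rule: infinite_finite_induct)
     (auto intro!: locally_finite_weight_add simp: locally_finite_weight_def[of "\<lambda>_. 0"])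

lemma locally_finite_weight_cmult:
  "locally_finite_weight w \<Longrightarrow> locally_finite_weight (\<lambda>z. c * w z)"
  by (erule locally_finite_weight_mono) auto

lemma weight_N_superset:
  assumes "finite S" "{z. norm z \<le> r \<and> w z \<noteq> 0} \<subseteq> S" "S \<subseteq> cball 0 r"
  shows "weight_N w r = (\<Sum>z\<in>S. w z * ln (r / norm1 z))"
  unfolding weight_N_def using assms by (intro sum.mono_neutral_left) auto

lemma weight_N_add:
  assumes "locally_finite_weight w" "locally_finite_weight v"
  shows "weight_N (\<lambda>z. w z + v z) r = weight_N w r + weight_N v r"
proof -
  define S where "S = {z. norm z \<le> r \<and> w z \<noteq> 0} \<union> {z. norm z \<le> r \<and> v z \<noteq> 0}"
  have S: "finite S" "S \<subseteq> cball 0 r"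
    unfolding S_def using locally_finite_weightD assms by auto
  have "weight_N u r = (\<Sum>z\<in>S. u z * ln (r / norm1 z))"
    if "u = w \<or> u = v \<or> u = (\<lambda>z. w z + v z)" for u
    by (rule weight_N_superset[OF S(1) _ S(2)]) (use that in \<open>auto simp: S_def\<close>)
  thus ?thesis by (simp add: sum.distrib ring_distribs)
qed

lemma weight_N_sum:
  assumes "\<And>i. i \<in> I \<Longrightarrow> locally_finite_weight (w i)" "finite I"
  shows "weight_N (\<lambda>z. \<Sum>i\<in>I. w i z) r = (\<Sum>i\<in>I. weight_N (w i) r)"
  using assms(2,1)
proof (induction I rule: finite_induct)
  case (insert i I)
  have "weight_N (\<lambda>z. w i z + (\<Sum>i\<in>I. w i z)) r = weight_N (w i) r + weight_N (\<lambda>z. \<Sum>i\<in>I. w i z) r"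
    by (intro weight_N_add locally_finite_weight_sum insert.prems) auto
  thus ?case using insert by simp
qed (simp add: weight_N_def)

lemma weight_N_cmult: "weight_N (\<lambda>z. c * w z) r = c * weight_N w r"
  by (cases "c = 0") (auto simp: weight_N_def sum_distrib_left mult_ac)

text \<open>\<open>r \<ge> 1\<close> is what the origin requires, whose \<open>norm1\<close> is
  1.\<close>

lemma weight_N_kernel_nonneg:
  assumes "norm z \<le> r" "r \<ge> 1"
  shows "ln (r / norm1 z) \<ge> 0"
  using assms by (auto simp: norm1_def)

lemma weight_N_mono:
  assumes "locally_finite_weight w" "locally_finite_weight v" "\<And>z. w z \<le> v z" "r \<ge> 1"
  shows "weight_N w r \<le> weight_N v r"
proof -
  define S where "S = {z. norm z \<le> r \<and> w z \<noteq> 0} \<union> {z. norm z \<le> r \<and> v z \<noteq> 0}"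
  have S: "finite S" "S \<subseteq> cball 0 r"
    unfolding S_def using locally_finite_weightD assms by auto
  have *: "weight_N u r = (\<Sum>z\<in>S. u z * ln (r / norm1 z))"
    if "u = w \<or> u = v" for u
    by (rule weight_N_superset[OF S(1) _ S(2)]) (use that in \<open>auto simp: S_def\<close>)
  show ?thesis
    unfolding *[of w, simplified] *[of v, simplified] using S(2)
    by (intro sum_mono mult_right_mono assms weight_N_kernel_nonneg) auto
qed

lemma weight_N_nonneg:
  assumes "\<And>z. w z \<ge> 0" "r \<ge> 1"
  shows "weight_N w r \<ge> 0"
  unfolding weight_N_def
  by (intro sum_nonneg mult_nonneg_nonneg assms weight_N_kernel_nonneg) auto

lemma weight_N_mono_radius:
  assumes "locally_finite_weight w" "\<And>z. w z \<ge> 0" "1 \<le> r" "r \<le> s"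
  shows "weight_N w r \<le> weight_N w s"
proof -
  have "weight_N w r \<le> (\<Sum>z | norm z \<le> r \<and> w z \<noteq> 0. w z * ln (s / norm1 z))"
    unfolding weight_N_def using assms
    by (intro sum_mono mult_left_mono) (auto intro!: divide_right_mono)
  also have "\<dots> \<le> weight_N w s"
    unfolding weight_N_def using assms
    by (intro sum_mono2 locally_finite_weightD mult_nonneg_nonneg weight_N_kernel_nonneg) auto
  finally show ?thesis .
qed

text \<open>Exchange the sum with the integral: a point \<open>z \<noteq> 0\<close> is counted from
  \<open>t = norm z\<close> on and contributes the integral of \<open>1 / t\<close> up to
  \<open>r\<close>. The origin is exactly the part \<open>n 0\<close> that the definition splits
  off.\<close>

lemma integrated_count_eq_weight_N:
  fixes w :: "complex \<Rightarrow> nat"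
  assumes fin: "\<And>r. finite {z. norm z \<le> r \<and> w z \<noteq> 0}" and r: "r > 0"
    and n: "\<And>t. n t = (\<Sum>z | norm z \<le> t \<and> w z \<noteq> 0. w z)"
  shows "integrated_count n r = weight_N (\<lambda>z. real (w z)) r"
proof -
  define S where "S = {z. norm z \<le> r \<and> w z \<noteq> 0}"
  have S: "finite S" unfolding S_def by (rule fin)
  have n0: "n 0 = w 0"
  proof -
    have "{z. norm z \<le> 0 \<and> w z \<noteq> 0} = (if w 0 \<noteq> 0 then {0} else {})" by auto
    thus ?thesis unfolding n by simp
  qed
  have nt: "real (n t) - real (n 0) = (\<Sum>z\<in>S-{0}. if norm z \<le> t then real (w z) else 0)"
    if t: "0 \<le> t" "t \<le> r" for t
  proof -
    have "real (n t) = (\<Sum>z\<in>S. if norm z \<le> t then real (w z) else 0)"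
      unfolding n of_nat_sum using t S
      by (intro sum.mono_neutral_cong_left) (auto simp: S_def)
    also have "\<dots> = (\<Sum>z\<in>S-{0}. if norm z \<le> t then real (w z) else 0) + real (w 0)"
    proof (cases "0 \<in> S")
      case True
      thus ?thesis using S t by (simp add: sum.remove[of S 0])
    next
      case False
      hence "w 0 = 0" using r by (auto simp: S_def)
      thus ?thesis using False by simp
    qed
    finally show ?thesis using n0 by simp
  qed
  have int1: "((\<lambda>t. if t \<in> {norm z..r} then 1 / t else 0) has_integral ln (r / norm z)) {0..r}"
    if "z \<in> S - {0}" for z
  proof -
    have z: "norm z > 0" "norm z \<le> r" using that by (auto simp: S_def)
    have "((\<lambda>t. 1 / t) has_integral (ln r - ln (norm z))) {norm z..r}"
      using z by (intro fundamental_theorem_real) (auto intro!: derivative_eq_intros intro: less_le_trans[of 0 "norm z"])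
    hence "((\<lambda>t. 1 / t) has_integral ln (r / norm z)) {norm z..r}"
      using z r by (simp add: ln_div)
    thus ?thesis using z by (subst has_integral_restrict) auto
  qed
  have "((\<lambda>t. \<Sum>z\<in>S-{0}. real (w z) * (if t \<in> {norm z..r} then 1 / t else 0)) has_integral
           (\<Sum>z\<in>S-{0}. real (w z) * ln (r / norm z))) {0..r}"
    using S by (intro has_integral_sum has_integral_mult_right int1) auto
  hence "((\<lambda>t. (real (n t) - real (n 0)) / t) has_integral
           (\<Sum>z\<in>S-{0}. real (w z) * ln (r / norm z))) {0..r}"
    by (rule has_integral_eq[rotated]) (auto simp: nt sum_divide_distrib intro!: sum.cong split: if_splits)
  hence "integral {0..r} (\<lambda>t. (real (n t) - real (n 0)) / t) = (\<Sum>z\<in>S-{0}. real (w z) * ln (r / norm z))"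
    by (rule integral_unique)
  moreover have "weight_N (\<lambda>z. real (w z)) r = (\<Sum>z\<in>insert 0 S. real (w z) * ln (r / norm1 z))"
    using S r by (intro weight_N_superset) (auto simp: S_def)
  moreover have "\<dots> = (\<Sum>z\<in>S-{0}. real (w z) * ln (r / norm z)) + real (w 0) * ln r"
    using S by (subst sum.insert_remove) (auto intro!: sum.cong)
  ultimately show ?thesis by (simp add: integrated_count_def n0)
qed

definition pole_weight :: "(complex \<Rightarrow> complex) \<Rightarrow> complex \<Rightarrow> real" where
  "pole_weight f z = real (pole_mult f z)"

lemma locally_finite_zorder:
  assumes "mero_nz f"
  shows "locally_finite_weight (\<lambda>z. of_int (zorder f z))"
  unfolding locally_finite_weight_def using finite_zorder_nonzero[OF assms] by simp

lemma locally_finite_pole_weight: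
  assumes "mero_nz f"
  shows "locally_finite_weight (pole_weight f)"
  by (rule locally_finite_weight_mono[OF locally_finite_zorder[OF assms]]) 
     (auto simp: pole_weight_def pole_mult_def)

lemma nevanlinna_N_eq_weight_N:
  assumes "mero_nz f" "r > 0"
  shows "nevanlinna_N r f = weight_N (pole_weight f) r"
proof -
  have ip: "is_pole f z \<longleftrightarrow> pole_mult f z \<noteq> 0" for z
    unfolding is_pole_iff_zorder[OF assms(1)] pole_mult_def by auto
  have "integrated_count (pole_count f) r = weight_N (\<lambda>z. real (pole_mult f z)) r"
  proof (rule integrated_count_eq_weight_N[OF _ assms(2)])
    show "finite {z. norm z \<le> r \<and> pole_mult f z \<noteq> 0}" for r
      using locally_finite_weightD[OF locally_finite_pole_weight[OF assms(1)], of r]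
      by (simp add: pole_weight_def)
    show "pole_count f t = (\<Sum>z | norm z \<le> t \<and> pole_mult f z \<noteq> 0. pole_mult f z)" for t
      unfolding pole_count_def ip ..
  qed
  thus ?thesis
    unfolding nevanlinna_N_def pole_weight_def .
qed

lemma pole_weight_zorder: "pole_weight f z = max 0 (- of_int (zorder f z))"
  by (auto simp: pole_weight_def pole_mult_def max_def)

lemma pole_weight_inverse:
  assumes "mero_nz f"
  shows "pole_weight (\<lambda>z. 1 / f z) z = max 0 (of_int (zorder f z))"
  by (simp add: pole_weight_zorder zorder_mero_nz_inverse[OF assms])

subsection \<open>Jensen's formula\<close>

lemma mero_nz_power_int:
  assumes "mero_nz f"
  shows "mero_nz (\<lambda>z. f z powi n)"
proof (rule mero_nzI)
  show "(\<lambda>z. f z powi n) meromorphic_on UNIV"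
    by (intro meromorphic_intros mero_nzD assms)
  show "\<forall>\<^sub>F w in at z. f w powi n \<noteq> 0" for z
    using mero_nzD(4)[OF assms(1), of z] by eventually_elim auto
qed

lemma mero_nz_prod:
  assumes "\<And>i. i \<in> I \<Longrightarrow> mero_nz (f i)"
  shows "mero_nz (\<lambda>z. \<Prod>i\<in>I. f i z)"
  using assms
  by (induction I rule: infinite_finite_induct)
     (auto intro!: mero_nz_mult simp: mero_nz_def[of "\<lambda>_. 1"])

lemma mero_nz_linear:
  assumes "R \<noteq> 0"
  shows "mero_nz (\<lambda>z. (z - j) / of_real R)"
proof (rule mero_nzI)
  show "(\<lambda>z. (z - j) / of_real R) meromorphic_on UNIV"
    by (intro meromorphic_intros)
  have "\<forall>\<^sub>F w in at z. w \<noteq> j" for z :: complex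
    by (simp add: eventually_neq_at_within)
  thus "\<forall>\<^sub>F w in at z. (w - j) / of_real R \<noteq> 0" for z :: complex
    by (rule eventually_mono) (use assms in auto)
qed

lemma zorder_linear:
  assumes "R \<noteq> 0"
  shows "zorder (\<lambda>z. (z - j) / of_real R) z = (if z = j then 1 else 0)"
proof (cases "z = j")
  case True
  have "zorder (\<lambda>z. (z - j) / of_real R) z = 1"
    by (rule zorder_eqI[where S = UNIV and g = "\<lambda>_. 1 / of_real R"]) (use assms True in auto)
  thus ?thesis using True by simp
next
  case False
  have "(\<lambda>z. (z - j) / of_real R) analytic_on {z}"
    using assms by (intro analytic_intros) auto
  thus ?thesis using False assms by (auto intro: zorder_eq_0I)
qed

lemma regular_pt_remove_sings:
  assumes "mero_nz f" "zorder f z = 0"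
  shows "regular_pt (remove_sings f) z"
proof -
  have ev: "eventually (\<lambda>w. remove_sings f w = f w) (at z)" for z
    by (intro eventually_remove_sings_eq_at mero_nzD assms)
  have nice: "remove_sings f nicely_meromorphic_on UNIV"
    by (intro remove_sings_nicely_meromorphic mero_nzD assms)
  have "mero_nz (remove_sings f)"
    unfolding mero_nz_def
  proof (intro conjI allI)
    show "remove_sings f meromorphic_on UNIV" using nice by (simp add: nicely_meromorphic_on_def)
    show "\<forall>\<^sub>F w in at z. remove_sings f w \<noteq> 0" for z
      using ev[of z] mero_nzD(4)[OF assms(1), of z] by eventually_elim auto
  qed
  moreover have zo: "zorder (remove_sings f) z = 0"
    using zorder_cong[OF ev refl] assms(2) by simp
  ultimately have "\<not> is_pole (remove_sings f) z"
    by (simp add: is_pole_iff_zorder)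
  hence an: "remove_sings f analytic_on {z}"
    using nicely_meromorphic_on_imp_analytic_at[OF nice] by auto
  with zo show ?thesis
    using mero_nzD(5)[OF \<open>mero_nz (remove_sings f)\<close>, of z]
    by (simp add: regular_pt_def zorder_eq_0_iff)
qed

lemma open_regular_pts: "open {z. regular_pt f z}"
proof -
  have "\<exists>T. open T \<and> z \<in> T \<and> T \<subseteq> {z. regular_pt f z}" if reg: "regular_pt f z" for z
  proof -
    from reg obtain T where T: "open T" "z \<in> T" "f holomorphic_on T"
      by (auto simp: regular_pt_def analytic_at)
    have "open (T \<inter> f -` (- {0}))"
      using T holomorphic_on_imp_continuous_on by (auto intro: continuous_open_preimage)
    moreover have "regular_pt f w" if "w \<in> T \<inter> f -` (- {0})" for w
      using that T by (auto simp: regular_pt_def analytic_at)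
    ultimately show ?thesis
      using T reg by (intro exI[of _ "T \<inter> f -` (- {0})"]) (auto simp: regular_pt_def)
  qed
  thus ?thesis by (subst open_subopen) blast
qed

text \<open>A holomorphic logarithm is obtained on an open disc. By compactness the regular points
  contain a slightly larger one: each of its points outside radius \<open>R\<close> lies within
  \<open>e\<close> of its radial projection to the circle.\<close>

lemma holomorphic_log_cball:
  assumes "\<And>z. norm z \<le> R \<Longrightarrow> regular_pt F z" "R > 0"
  obtains L where "L holomorphic_on cball 0 R" "\<And>z. norm z \<le> R \<Longrightarrow> F z = exp (L z)"
proof -
  obtain e where e: "e > 0" "(\<Union>x\<in>cball 0 R. ball x e) \<subseteq> {z. regular_pt F z}"
    by (rule compact_subset_open_imp_ball_epsilon_subset[of "cball 0 R" "{z. regular_pt F z}"])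
       (use assms open_regular_pts in auto)
  have sub: "z \<in> {z. regular_pt F z}" if "z \<in> ball 0 (R + e)" for z
  proof (cases "norm z \<le> R")
    case False
    define w where "w = of_real (R / norm z) * z"
    have z0: "norm z > 0" using False assms(2) by linarith
    hence "norm w = R" using assms by (simp add: w_def norm_mult norm_divide)
    moreover have "dist w z = norm z - R"
    proof -
      have "w - z = of_real (R / norm z - 1) * z" by (simp add: w_def algebra_simps)
      hence "norm (w - z) = \<bar>R / norm z - 1\<bar> * norm z" by (simp only: norm_mult norm_of_real)
      also have "\<dots> = norm z - R" using z0 False assms(2) by (simp add: abs_if field_simps)
      finally show ?thesis by (simp add: dist_norm)
    qed
    ultimately have "z \<in> (\<Union>x\<in>cball 0 R. ball x e)"
      using that by (intro UN_I[of w]) auto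
    thus ?thesis using e by blast
  qed (use assms in auto)
  have "F holomorphic_on ball 0 (R + e)"
    by (intro analytic_imp_holomorphic) (use sub in \<open>auto simp: regular_pt_def analytic_on_analytic_at[of F "ball _ _"]\<close>)
  then obtain L where L: "L holomorphic_on ball 0 (R + e)" "\<And>x. x \<in> ball 0 (R + e) \<Longrightarrow> exp (L x) = F x"
    using holomorphic_logarithm_exists[of "ball 0 (R + e)" F 0] sub assms e
    by (auto simp: regular_pt_def)
  show ?thesis
  proof (rule that)
    show "L holomorphic_on cball 0 R"
      by (rule holomorphic_on_subset[OF L(1)]) (use e in auto)
    show "F z = exp (L z)" if "norm z \<le> R" for z
      using L(2)[of z] that e by auto
  qed
qed

lemma ln_power_int:
  fixes x :: real
  assumes "x > 0"
  shows "ln (x powi n) = of_int n * ln x"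
proof -
  have "x powi n = x powr of_int n" using assms by (subst powr_real_of_int') auto
  thus ?thesis using assms by (simp add: ln_powr)
qed

text \<open>After the zeros and poles are divided out, every order in the disc is 0, and the
  quotient has a logarithm once its removable singularities are filled in. Scaling the factors by
  \<open>R\<close> gives each of them logarithmic mean 0 on the circle of radius \<open>R\<close>
  when \<open>norm j < R\<close>.\<close>

lemma ln_norm_factorization:
  assumes f: "mero_nz f" and R: "R > 0"
  obtains L where "L holomorphic_on cball 0 R"
    "\<And>z. norm z \<le> R \<Longrightarrow> regular_pt f z \<Longrightarrow> ln (norm (f z)) =
       Re (L z) + (\<Sum>j | norm j \<le> R \<and> zorder f j \<noteq> 0. of_int (zorder f j) * ln (norm (z - j) / R))"
proof -
  define S where "S = {j. norm j \<le> R \<and> zorder f j \<noteq> 0}"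
  have S: "finite S" unfolding S_def by (rule finite_zorder_nonzero[OF f])
  define P where "P = (\<lambda>z. \<Prod>j\<in>S. ((z - j) / of_real R) powi (- zorder f j))"
  have mP1: "mero_nz (\<lambda>z. ((z - j) / of_real R) powi n)" for j n
    using R by (intro mero_nz_power_int mero_nz_linear) auto
  have mP: "mero_nz P" unfolding P_def by (intro mero_nz_prod mP1)
  define F where "F = (\<lambda>z. f z * P z)"
  have mF: "mero_nz F" unfolding F_def by (intro mero_nz_mult f mP)
  have zP1: "zorder (\<lambda>z. ((z - j) / of_real R) powi n) z = (if z = j then n else 0)" for j n z
    using R zorder_power_int[OF mero_nzD(1,5)[OF mero_nz_linear[of R j]], of n z] by (simp add: zorder_linear)
  have zP: "zorder P z = (\<Sum>j\<in>S. if z = j then - zorder f j else 0)" for z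
    unfolding P_def using mero_nzD(4)[OF mP, of z] mP1
    by (subst zorder_prod) (auto intro: mero_nzD simp: zP1 P_def)
  have zF: "zorder F z = 0" if "norm z \<le> R" for z
    unfolding F_def zorder_mero_nz_mult[OF f mP] zP using S that by (auto simp: S_def)
  obtain L where L: "L holomorphic_on cball 0 R" "\<And>z. norm z \<le> R \<Longrightarrow> remove_sings F z = exp (L z)"
    using holomorphic_log_cball[of R "remove_sings F"] regular_pt_remove_sings[OF mF zF] R by metis
  show ?thesis
  proof (rule that)
    fix z assume z: "norm z \<le> R" "regular_pt f z"
    have zS: "z \<notin> S" using regular_pt_zorder[OF z(2)] by (simp add: S_def)
    have "P analytic_on {z}"
      unfolding P_def
    proof (rule analytic_on_prod)
      fix j assume "j \<in> S"
      have "(\<lambda>z. (z - j) / of_real R) analytic_on {z}" using R by (intro analytic_intros) auto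
      thus "(\<lambda>z. ((z - j) / of_real R) powi (- zorder f j)) analytic_on {z}"
        by (rule analytic_on_power_int[rotated]) (use R zS \<open>j \<in> S\<close> in auto)
    qed
    hence "F analytic_on {z}"
      unfolding F_def using z(2) by (intro analytic_intros) (auto simp: regular_pt_def)
    hence "exp (L z) = F z" using L(2)[OF z(1)] by simp
    hence "exp (Re (L z)) = norm (F z)" by (metis norm_exp_eq_Re)
    have Pnz: "P z \<noteq> 0" using zS R S by (auto simp: P_def)
    have fnz: "f z \<noteq> 0" using z(2) by (simp add: regular_pt_def)
    have "Re (L z) = ln (norm (F z))"
      using \<open>exp (Re (L z)) = norm (F z)\<close> by (metis ln_exp)
    also have "\<dots> = ln (norm (f z)) + ln (norm (P z))"
      using Pnz fnz by (simp add: F_def norm_mult ln_mult)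
    also have "norm (P z) = (\<Prod>j\<in>S. (norm (z - j) / R) powi (- zorder f j))"
      using R unfolding P_def by (simp add: prod_norm[symmetric] norm_power_int norm_divide)
    also have "ln \<dots> = (\<Sum>j\<in>S. ln ((norm (z - j) / R) powi (- zorder f j)))"
      using zS R S by (intro ln_prod) auto
    also have "\<dots> = (\<Sum>j\<in>S. - (of_int (zorder f j) * ln (norm (z - j) / R)))"
    proof (intro sum.cong refl)
      fix j assume "j \<in> S"
      hence "z \<noteq> j" using zS by auto
      hence "norm (z - j) / R > 0" using R by simp
      thus "ln ((norm (z - j) / R) powi (- zorder f j)) = - (of_int (zorder f j) * ln (norm (z - j) / R))"
        by (subst ln_power_int) auto
    qed
    finally show "ln (norm (f z)) = Re (L z) + (\<Sum>j | norm j \<le> R \<and> zorder f j \<noteq> 0. of_int (zorder f j) * ln (norm (z - j) / R))"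
      by (simp add: sum_negf S_def)
  qed fact
qed

text \<open>\<open>zor_poly f 0 0\<close> is the leading Laurent coefficient at the origin.\<close>

lemma tendsto_ln_norm_leading:
  assumes f: "mero_nz f"
  shows "((\<lambda>z. ln (norm (f z)) - of_int (zorder f 0) * ln (norm z)) \<longlongrightarrow> ln (norm (zor_poly f 0 0))) (at 0)"
proof -
  obtain r where r: "r > 0" and nz: "zor_poly f 0 0 \<noteq> 0" and hol: "zor_poly f 0 holomorphic_on cball 0 r"
    and eq: "\<And>w. w \<in> cball 0 r - {0} \<Longrightarrow> f w = zor_poly f 0 w * (w - 0) powi zorder f 0 \<and> zor_poly f 0 w \<noteq> 0"
    using zorder_exist[OF mero_nzD(2,3,5)[OF f, of 0]] by blast
  have "continuous_on (ball 0 r) (zor_poly f 0)"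
    using holomorphic_on_imp_continuous_on[OF hol] by (rule continuous_on_subset) auto
  hence "isCont (zor_poly f 0) 0"
    using r by (simp add: continuous_on_eq_continuous_at)
  hence "((\<lambda>z. ln (norm (zor_poly f 0 z))) \<longlongrightarrow> ln (norm (zor_poly f 0 0))) (at 0)"
    using nz by (intro tendsto_intros) (auto simp: isCont_def)
  moreover have "eventually (\<lambda>z. ln (norm (zor_poly f 0 z)) = ln (norm (f z)) - of_int (zorder f 0) * ln (norm z)) (at 0)"
  proof -
    have "eventually (\<lambda>z. z \<in> ball 0 r - {0}) (at (0::complex))"
      using r by (intro eventually_at_in_open) auto
    thus ?thesis
    proof eventually_elim
      case (elim z)
      have "ln (norm (f z)) = ln (norm (zor_poly f 0 z) * norm z powi zorder f 0)"
        using eq[of z] elim by (simp add: norm_mult norm_power_int)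
      also have "\<dots> = ln (norm (zor_poly f 0 z)) + ln (norm z powi zorder f 0)"
        using elim eq[of z] by (intro ln_mult_pos) auto
      also have "ln (norm z powi zorder f 0) = of_int (zorder f 0) * ln (norm z)"
        using elim by (intro ln_power_int) auto
      finally show ?case by simp
    qed
  qed
  ultimately show ?thesis by (rule Lim_transform_eventually)
qed

lemma regular_circle_norm_less:
  assumes "regular_circle f R" "norm j \<le> R" "zorder f j \<noteq> 0"
  shows "norm j < R"
  using assms regular_circle_zorder[of f R j] by fastforce

lemma continuous_ln_norm:
  assumes "regular_circle f R"
  shows "continuous_on (sphere 0 R) (\<lambda>z. ln (norm (f z)))"
  using regular_circle_continuous[OF assms] regular_circle_nonzero[OF assms]
  by (intro continuous_intros) auto

text \<open>All linear factors of the factorization have mean 0, so the mean of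
  \<open>ln (norm (f z))\<close> is \<open>Re (L 0)\<close>. It remains to express this number
  through \<open>f\<close>.\<close>

theorem Jensen_formula:
  assumes f: "mero_nz f" and reg: "regular_circle f R" and R: "R > 0"
  shows "circle_mean R (\<lambda>z. ln (norm (f z))) =
           ln (norm (zor_poly f 0 0)) + weight_N (\<lambda>z. of_int (zorder f z)) R"
proof -
  define S where "S = {j. norm j \<le> R \<and> zorder f j \<noteq> 0}"
  have S: "finite S" unfolding S_def by (rule finite_zorder_nonzero[OF f])
  have SR: "norm j < R" if "j \<in> S" for j
    using that regular_circle_norm_less[OF reg, of j] by (auto simp: S_def)
  obtain L where L: "L holomorphic_on cball 0 R" and
    eq: "\<And>z. norm z \<le> R \<Longrightarrow> regular_pt f z \<Longrightarrow> ln (norm (f z)) =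
       Re (L z) + (\<Sum>j\<in>S. of_int (zorder f j) * ln (norm (z - j) / R))"
    by (rule ln_norm_factorization[OF f R, folded S_def]) blast
  have contL: "continuous_on (cball 0 R) L" by (rule holomorphic_on_imp_continuous_on[OF L])
  note contLs = holomorphic_imp_continuous_on_sphere[OF L]
  have conts: "continuous_on (sphere 0 R) (\<lambda>z. ln (norm (z - j)))" if "j \<in> S" for j
    using SR[OF that] by (intro continuous_intros) auto
  have "circle_mean R (\<lambda>z. ln (norm (f z))) =
      circle_mean R (\<lambda>z. Re (L z) + (\<Sum>j\<in>S. of_int (zorder f j) * (ln (norm (z - j)) - ln R)))"
  proof (rule circle_mean_cong)
    fix z :: complex assume z: "norm z = R"
    have "z \<noteq> j" if "j \<in> S" for j using SR[OF that] z by auto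
    thus "ln (norm (f z)) = Re (L z) + (\<Sum>j\<in>S. of_int (zorder f j) * (ln (norm (z - j)) - ln R))"
      using eq[of z] z reg R by (auto simp: regular_circle_def ln_div)
  qed (use R in auto)
  also have "\<dots> = circle_mean R (\<lambda>z. Re (L z)) + circle_mean R (\<lambda>z. (\<Sum>j\<in>S. of_int (zorder f j) * (ln (norm (z - j)) - ln R)))"
    using R by (intro circle_mean_add continuous_intros contLs conts) auto
  also have "circle_mean R (\<lambda>z. (\<Sum>j\<in>S. of_int (zorder f j) * (ln (norm (z - j)) - ln R))) =
      (\<Sum>j\<in>S. circle_mean R (\<lambda>z. of_int (zorder f j) * (ln (norm (z - j)) - ln R)))"
    using R S by (intro circle_mean_sum continuous_intros conts) auto
  also have "\<dots> = (\<Sum>j\<in>S. 0)"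
  proof (intro sum.cong refl)
    fix j assume j: "j \<in> S"
    have "circle_mean R (\<lambda>z. ln (norm (z - j)) - ln R) = ln (max R (norm j)) - ln R"
      using R SR[OF j] conts[OF j] by (subst circle_mean_diff) (auto simp: circle_mean_ln_dist)
    thus "circle_mean R (\<lambda>z. of_int (zorder f j) * (ln (norm (z - j)) - ln R)) = 0"
      using SR[OF j] by (subst circle_mean_cmult) (simp add: max_def)
  qed
  also have "circle_mean R (\<lambda>z. Re (L z)) = Re (L 0)"
    by (rule Re_holomorphic_circle_mean[OF L R])
  finally have main: "circle_mean R (\<lambda>z. ln (norm (f z))) = Re (L 0)" by simp

  \<comment> \<open>The origin may be a zero or a pole of \<open>f\<close>, so
    \<open>Re (L 0)\<close> is computed as a limit at 0 after removing
    \<open>zorder f 0 * ln (norm z)\<close>. The factor belonging to \<open>j = 0\<close> leaves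
    behind \<open>zorder f 0 * ln R\<close>, the term that \<open>norm1 0 = 1\<close> accounts
    for.\<close>
  define b0 where "b0 = (\<Sum>j\<in>S-{0}. of_int (zorder f j) * ln (norm (0 - j) / R))"
  define A where "A = (\<lambda>z. ln (norm (f z)) - of_int (zorder f 0) * ln (norm z))"
  define B where "B = (\<lambda>z. (\<Sum>j\<in>S-{0}. of_int (zorder f j) * ln (norm (z - j) / R)))"
  have limA: "(A \<longlongrightarrow> ln (norm (zor_poly f 0 0))) (at 0)"
    unfolding A_def by (rule tendsto_ln_norm_leading[OF f])
  have limB: "(B \<longlongrightarrow> b0) (at 0)"
    unfolding B_def b0_def using R by (intro tendsto_intros) auto
  have "isCont L 0"
    using continuous_on_subset[OF contL, of "ball 0 R"] R by (simp add: continuous_on_eq_continuous_at)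
  hence limL: "((\<lambda>z. Re (L z)) \<longlongrightarrow> Re (L 0)) (at 0)"
    by (intro tendsto_intros) (auto simp: isCont_def)
  have "eventually (\<lambda>z. A z - B z + of_int (zorder f 0) * ln R = Re (L z)) (at 0)"
  proof -
    have "\<forall>\<^sub>\<approx>z\<in>UNIV. regular_pt f z"
      using sparse_not_regular[OF f] by (simp add: eventually_cosparse)
    hence "eventually (\<lambda>z. regular_pt f z) (at 0)"
      by (rule eventually_cosparse_imp_eventually_at) auto
    moreover have "eventually (\<lambda>z. z \<in> ball 0 R - {0}) (at (0::complex))"
      using R by (intro eventually_at_in_open) auto
    ultimately show ?thesis
    proof eventually_elim
      case (elim z)
      have "(\<Sum>j\<in>S. of_int (zorder f j) * ln (norm (z - j) / R)) =
            B z + of_int (zorder f 0) * ln (norm z / R)"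
      proof (cases "0 \<in> S")
        case True thus ?thesis unfolding B_def using S by (simp add: sum.remove[of S 0])
      next
        case False
        hence "zorder f 0 = 0" using R by (auto simp: S_def)
        thus ?thesis unfolding B_def using False by simp
      qed
      moreover have "ln (norm (f z)) = Re (L z) + (\<Sum>j\<in>S. of_int (zorder f j) * ln (norm (z - j) / R))"
        using elim by (intro eq) auto
      moreover have "ln (norm z / R) = ln (norm z) - ln R" using elim R by (simp add: ln_div)
      ultimately show ?case unfolding A_def by (simp add: algebra_simps)
    qed
  qed
  moreover have "((\<lambda>z. A z - B z + of_int (zorder f 0) * ln R) \<longlongrightarrow>
      ln (norm (zor_poly f 0 0)) - b0 + of_int (zorder f 0) * ln R) (at 0)"
    by (intro tendsto_intros limA limB)
  ultimately have "((\<lambda>z. Re (L z)) \<longlongrightarrow>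
      ln (norm (zor_poly f 0 0)) - b0 + of_int (zorder f 0) * ln R) (at 0)"
    by (rule Lim_transform_eventually[rotated])
  hence "Re (L 0) = ln (norm (zor_poly f 0 0)) - b0 + of_int (zorder f 0) * ln R"
    using limL by (intro tendsto_unique[OF _ limL]) auto
  moreover have "- b0 = (\<Sum>j\<in>S-{0}. of_int (zorder f j) * ln (R / norm j))"
    unfolding b0_def sum_negf[symmetric] using R by (intro sum.cong) (auto simp: ln_div algebra_simps)
  ultimately have "Re (L 0) = ln (norm (zor_poly f 0 0)) + ((\<Sum>j\<in>S-{0}. of_int (zorder f j) * ln (R / norm j)) + of_int (zorder f 0) * ln R)"
    by linarith
  moreover have "weight_N (\<lambda>z. of_int (zorder f z)) R = (\<Sum>z\<in>insert 0 S. of_int (zorder f z) * ln (R / norm1 z))"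
    using S R by (intro weight_N_superset) (auto simp: S_def)
  moreover have "\<dots> = (\<Sum>j\<in>S-{0}. of_int (zorder f j) * ln (R / norm j)) + of_int (zorder f 0) * ln R"
    using S by (subst sum.insert_remove) (auto intro!: sum.cong)
  ultimately show ?thesis using main by simp
qed

section \<open>Proximity functions and the first main theorem\<close>

lemma log_plus_nonneg [simp]: "log_plus x \<ge> 0"
  by (simp add: log_plus_def)

lemma log_plus_diff:
  assumes "x > 0"
  shows "log_plus x - log_plus (1 / x) = ln x"
  using assms by (cases "x \<ge> 1") (auto simp: log_plus_def max_def ln_div field_simps)

lemma log_plus_add:
  assumes "x > 0"
  shows "log_plus x + log_plus (1 / x) = \<bar>ln x\<bar>"
  using assms by (cases "x \<ge> 1") (auto simp: log_plus_def max_def ln_div field_simps)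

lemma continuous_on_log_plus [continuous_intros]:
  assumes "continuous_on A u"
  shows "continuous_on A (\<lambda>x. log_plus (u x))"
  unfolding log_plus_def using assms by (intro continuous_intros) (auto simp: max_def)

lemma continuous_log_plus_norm:
  assumes "regular_circle f R"
  shows "continuous_on (sphere 0 R) (\<lambda>z. log_plus (norm (f z)))"
    "continuous_on (sphere 0 R) (\<lambda>z. log_plus (norm (1 / f z)))"
  using regular_circle_continuous[OF assms] regular_circle_nonzero[OF assms]
  by (auto intro!: continuous_intros)

lemma mean_ln_norm_eq:
  assumes reg: "regular_circle f R" and R: "R > 0"
  shows "circle_mean R (\<lambda>z. ln (norm (f z))) = nevanlinna_m R f - nevanlinna_m R (\<lambda>z. 1 / f z)"
  unfolding nevanlinna_m_eq_circle_mean
  using R continuous_log_plus_norm[OF reg] regular_circle_nonzero[OF reg]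
  by (subst circle_mean_diff[symmetric]) (auto intro!: circle_mean_cong log_plus_diff[symmetric] simp: norm_divide)

lemma mean_abs_ln_norm_eq:
  assumes reg: "regular_circle f R" and R: "R > 0"
  shows "circle_mean R (\<lambda>z. \<bar>ln (norm (f z))\<bar>) = nevanlinna_m R f + nevanlinna_m R (\<lambda>z. 1 / f z)"
  unfolding nevanlinna_m_eq_circle_mean
  using R continuous_log_plus_norm[OF reg] regular_circle_nonzero[OF reg]
  by (subst circle_mean_add[symmetric]) (auto intro!: circle_mean_cong log_plus_add[symmetric] simp: norm_divide)

lemma weight_N_zorder:
  assumes f: "mero_nz f" and r: "r > 0"
  shows "weight_N (\<lambda>z. of_int (zorder f z)) r = nevanlinna_N r (\<lambda>z. 1 / f z) - nevanlinna_N r f"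
proof -
  have inv: "mero_nz (\<lambda>z. 1 / f z)" using mero_nz_inverse[OF f] by (simp add: divide_inverse)
  have "weight_N (\<lambda>z. of_int (zorder f z)) r = 
        weight_N (\<lambda>z. pole_weight (\<lambda>z. 1 / f z) z + (-1) * pole_weight f z) r"
    unfolding pole_weight_inverse[OF f] pole_weight_zorder[of f]
    by (intro arg_cong2[of _ _ _ _ weight_N] ext refl) auto
  also have "\<dots> = weight_N (pole_weight (\<lambda>z. 1 / f z)) r + weight_N (\<lambda>z. (-1) * pole_weight f z) r"
    by (intro weight_N_add locally_finite_weight_cmult locally_finite_pole_weight f inv)
  finally show ?thesis
    using r by (subst (asm) weight_N_cmult) (simp add: nevanlinna_N_eq_weight_N f inv)
qed

text \<open>Jensen's formula, with the mean and the divisor sum each split into positive and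
  negative parts.\<close>

theorem first_main_theorem:
  assumes f: "mero_nz f" and reg: "regular_circle f r" and r: "r > 0"
  shows "nevanlinna_T r (\<lambda>z. 1 / f z) = nevanlinna_T r f - ln (norm (zor_poly f 0 0))"
  using Jensen_formula[OF f reg r] mean_ln_norm_eq[OF reg r] weight_N_zorder[OF f r]
  by (simp add: nevanlinna_T_def)

subsection \<open>Logarithmic means of affine shifts\<close>

text \<open>Written by cases because \<open>r / norm a\<close> is 0 at the origin, where the kernel
  has to be 1.\<close>

definition root_kernel :: "real \<Rightarrow> complex \<Rightarrow> real" where
  "root_kernel r a = (if norm a \<le> r then 1 else r / norm a)"

text \<open>Twice the bound for roots with \<open>norm a < 2 * r\<close>, where the kernel can be as
  small as 1/2, plus 4 for the remaining roots.\<close>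

definition shift_bound :: "complex \<Rightarrow> real" where
  "shift_bound q = 4 * ln 3 + 4 * ln (1 + 3 / norm q) + 2 * \<bar>ln (norm q)\<bar> + 4"

lemma shift_bound_ge_4: "shift_bound q \<ge> 4"
proof -
  have "4 * ln 3 + 4 * ln (1 + 3 / norm q) + 2 * \<bar>ln (norm q)\<bar> \<ge> (0::real)"
    by (intro add_nonneg_nonneg mult_nonneg_nonneg ln_ge_zero) auto
  thus ?thesis by (simp add: shift_bound_def)
qed

lemma abs_ln_norm_diff_le:
  fixes a w :: complex
  assumes "norm w \<le> r" "2 * r \<le> norm a" "r > 0"
  shows "\<bar>ln (norm (w - a)) - ln (norm a)\<bar> \<le> 2 * (r / norm a)"
proof -
  define t where "t = r / norm a"
  have a: "norm a > 0" using assms by linarith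
  have t: "0 \<le> t" "t \<le> 1/2" using assms a by (auto simp: t_def field_simps)
  have 1: "norm (w - a) / norm a \<le> 1 + t"
    using norm_triangle_ineq4[of w a] assms a by (simp add: t_def field_simps)
  have 2: "1 - t \<le> norm (w - a) / norm a"
  proof -
    have "(1 - t) * norm a = norm a - r" using a by (simp add: t_def field_simps)
    also have "\<dots> \<le> norm (w - a)"
      using norm_triangle_ineq2[of a w] assms(1) by (simp add: norm_minus_commute)
    finally show ?thesis using a by (simp add: pos_le_divide_eq)
  qed
  have p: "norm (w - a) / norm a > 0" using 2 t by linarith
  have "ln (norm (w - a) / norm a) \<le> ln (1 + t)"
    using 1 p t by (subst ln_le_cancel_iff) auto
  also have "\<dots> \<le> t" using t by (intro ln_add_one_self_le_self) auto
  finally have u: "ln (norm (w - a) / norm a) \<le> t" .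
  have "- (2 * t) \<le> - t - 2 * t\<^sup>2"
    using mult_left_mono[OF t(2) t(1)] by (simp add: power2_eq_square)
  also have "\<dots> \<le> ln (1 - t)" using t by (intro ln_one_minus_pos_lower_bound) auto
  also have "\<dots> \<le> ln (norm (w - a) / norm a)"
    using 2 p t by (subst ln_le_cancel_iff) auto
  finally have "\<bar>ln (norm (w - a) / norm a)\<bar> \<le> 2 * t" using u t by linarith
  moreover have "norm (w - a) > 0" using p a by (simp add: zero_less_divide_iff)
  ultimately show ?thesis using a by (simp add: ln_div t_def)
qed

text \<open>For a far root, \<open>z\<close> and \<open>q * z + c\<close> both lie in the disc of
  radius \<open>r\<close>, so each logarithm is within \<open>2 r / norm a\<close> of
  \<open>ln (norm a)\<close>. For a near root, the two logarithms are compared with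
  \<open>ln r\<close>, and their means are bounded separately.\<close>

lemma circle_mean_root_shift_le:
  fixes q c a :: complex
  assumes q: "q \<noteq> 0" "norm q * r + norm c \<le> r" and r: "r > 0"
    and a: "norm a \<noteq> r" "\<And>z. norm z = r \<Longrightarrow> q * z + c \<noteq> a"
  shows "circle_mean r (\<lambda>z. \<bar>ln (norm (q * z + c - a)) - ln (norm (z - a))\<bar>) \<le>
           shift_bound q * root_kernel r a"
proof -
  have ne: "z \<noteq> a" if "norm z = r" for z using a that by auto
  have cont: "continuous_on (sphere 0 r) (\<lambda>z. \<bar>ln (norm (q * z + c - a)) - ln (norm (z - a))\<bar>)"
    by (intro continuous_intros) (use ne a(2) in auto)
  show ?thesis
  proof (cases "2 * r \<le> norm a")
    case True
    hence ker: "root_kernel r a = r / norm a" using r by (simp add: root_kernel_def)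
    have "circle_mean r (\<lambda>z. \<bar>ln (norm (q * z + c - a)) - ln (norm (z - a))\<bar>) \<le>
          circle_mean r (\<lambda>z. 4 * (r / norm a))"
    proof (intro circle_mean_mono cont continuous_intros)
      fix z :: complex assume z: "norm z = r"
      have "norm (q * z + c) \<le> r"
        using norm_triangle_ineq[of "q * z" c] q z by (simp add: norm_mult)
      from abs_ln_norm_diff_le[OF this True r] abs_ln_norm_diff_le[OF _ True r, of z] z
      show "\<bar>ln (norm (q * z + c - a)) - ln (norm (z - a))\<bar> \<le> 4 * (r / norm a)" by auto
    qed (use r in auto)
    also have "\<dots> = 4 * root_kernel r a" by (simp add: ker)
    also have "\<dots> \<le> shift_bound q * root_kernel r a"
      using shift_bound_ge_4[of q] r by (intro mult_right_mono) (auto simp: ker)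
    finally show ?thesis .
  next
    case False
    \<comment> \<open>\<open>b\<close> is the preimage of the root:
      \<open>q * z + c - a = q * (z - b)\<close>. It has modulus at most
      \<open>3 r / norm q\<close>, because \<open>norm a < 2 r\<close> and
      \<open>norm c \<le> r\<close>.\<close>
    define b where "b = (a - c) / q"
    have qb: "q * b = a - c" using q by (simp add: b_def)
    have qza: "q * z + c - a = q * (z - b)" for z by (simp add: right_diff_distrib qb)
    have b: "norm b \<noteq> r" using a(2)[of b] qza[of b] by auto
    have neb: "z \<noteq> b" if "norm z = r" for z using b that by auto
    have ra: "norm a < 2 * r" using False by simp
    have "norm q * r \<ge> 0" using r by simp
    hence c: "norm c \<le> r" using q by linarith
    have "norm (a - c) \<le> 3 * r" using norm_triangle_ineq4[of a c] ra c by linarith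
    hence nb: "norm b \<le> 3 * r / norm q" by (simp add: b_def norm_divide divide_right_mono)
    have c1: "continuous_on (sphere 0 r) (\<lambda>z. \<bar>ln (norm (z - b) / r)\<bar>)"
      by (intro continuous_intros) (use neb r in auto)
    have c2: "continuous_on (sphere 0 r) (\<lambda>z. \<bar>ln (norm (z - a) / r)\<bar>)"
      by (intro continuous_intros) (use ne r in auto)
    have "circle_mean r (\<lambda>z. \<bar>ln (norm (q * z + c - a)) - ln (norm (z - a))\<bar>) \<le>
          circle_mean r (\<lambda>z. \<bar>ln (norm (z - b) / r)\<bar> + (\<bar>ln (norm (z - a) / r)\<bar> + \<bar>ln (norm q)\<bar>))"
    proof (intro circle_mean_mono cont continuous_on_add c1 c2 continuous_on_const)
      fix z :: complex assume z: "norm z = r"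
      have "ln (norm (q * z + c - a)) = ln (norm q) + ln (norm (z - b))"
        unfolding qza using q neb[OF z] by (simp add: norm_mult ln_mult)
      moreover have "ln (norm (z - b) / r) = ln (norm (z - b)) - ln r" "ln (norm (z - a) / r) = ln (norm (z - a)) - ln r"
        using neb[OF z] ne[OF z] r by (simp_all add: ln_div)
      ultimately show "\<bar>ln (norm (q * z + c - a)) - ln (norm (z - a))\<bar> \<le>
         \<bar>ln (norm (z - b) / r)\<bar> + (\<bar>ln (norm (z - a) / r)\<bar> + \<bar>ln (norm q)\<bar>)" by linarith
    qed (use r in auto)
    also have "\<dots> = circle_mean r (\<lambda>z. \<bar>ln (norm (z - b) / r)\<bar>) + (circle_mean r (\<lambda>z. \<bar>ln (norm (z - a) / r)\<bar>) + \<bar>ln (norm q)\<bar>)"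
    proof -
      have "circle_mean r (\<lambda>z. \<bar>ln (norm (z - a) / r)\<bar> + \<bar>ln (norm q)\<bar>) =
            circle_mean r (\<lambda>z. \<bar>ln (norm (z - a) / r)\<bar>) + \<bar>ln (norm q)\<bar>"
        using r c2 by (subst circle_mean_add) auto
      moreover have "continuous_on (sphere 0 r) (\<lambda>z. \<bar>ln (norm (z - a) / r)\<bar> + \<bar>ln (norm q)\<bar>)"
        by (intro continuous_on_add c2 continuous_on_const)
      ultimately show ?thesis using r c1 by (subst circle_mean_add) auto
    qed
    also have "\<dots> \<le> 2 * ln (1 + norm b / r) + (2 * ln (1 + norm a / r) + \<bar>ln (norm q)\<bar>)"
      using a(1) b r by (intro add_mono circle_mean_abs_ln_dist_le) auto
    also have "\<dots> \<le> 2 * ln (1 + 3 / norm q) + (2 * ln 3 + \<bar>ln (norm q)\<bar>)"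
    proof (intro add_mono mult_left_mono order.refl)
      have "norm b / r \<le> 3 / norm q" using divide_right_mono[OF nb, of r] r by simp
      thus "ln (1 + norm b / r) \<le> ln (1 + 3 / norm q)"
        using r q by (subst ln_le_cancel_iff) (auto intro!: add_pos_nonneg)
      have "norm a / r \<le> 2" using ra r by (simp add: field_simps)
      thus "ln (1 + norm a / r) \<le> ln 3"
        using r q by (subst ln_le_cancel_iff) (auto intro!: add_pos_nonneg)
    qed auto
    also have "\<dots> \<le> shift_bound q * (1 / 2)" by (simp add: shift_bound_def)
    also have "\<dots> \<le> shift_bound q * root_kernel r a"
    proof (intro mult_left_mono)
      show "1 / 2 \<le> root_kernel r a"
      proof (cases "norm a \<le> r")
        case False
        hence "norm a > 0" using r by linarith
        thus ?thesis using ra False by (simp add: root_kernel_def pos_le_divide_eq)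
      qed (simp add: root_kernel_def)
    qed (use shift_bound_ge_4[of q] in auto)
    finally show ?thesis .
  qed
qed

lemma continuous_on_regular_image:
  assumes "\<And>z. norm z = r \<Longrightarrow> regular_pt f (q * z + c)"
  shows "continuous_on (sphere 0 r) (\<lambda>z. f (q * z + c))"
proof -
  have "isCont (\<lambda>z. f (q * z + c)) z" if "norm z = r" for z
    using assms[OF that]
    by (intro isCont_o2[of _ "\<lambda>z. q * z + c" f]) (auto simp: regular_pt_def analytic_at_imp_isCont)
  thus ?thesis by (auto intro: continuous_at_imp_continuous_on)
qed

definition divisor_sum :: "(complex \<Rightarrow> complex) \<Rightarrow> real \<Rightarrow> (complex \<Rightarrow> real) \<Rightarrow> real" where
  "divisor_sum f R k = (\<Sum>j | norm j \<le> R \<and> zorder f j \<noteq> 0. \<bar>of_int (zorder f j)\<bar> * k j)"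

text \<open>Factor \<open>f\<close> in the disc of radius \<open>R\<close>. The zero-free part
  changes little between \<open>z\<close> and \<open>q * z + c\<close>, both in the disc of radius
  \<open>r\<close>; its real part on the large circle is controlled by
  \<open>ln (norm (f z))\<close> and the linear factors. The \<open>2 * ln 2\<close> is the mean
  bound \<open>2 * ln (1 + norm j / R)\<close> for \<open>norm j < R\<close>.\<close>

lemma mean_log_shift_le_remainder:
  fixes q c :: complex
  assumes f: "mero_nz f"
    and q: "q \<noteq> 0" "norm q * r + norm c \<le> r" and r: "r > 0" "2 * r \<le> R"
    and reg: "regular_circle f r" "\<And>z. norm z = r \<Longrightarrow> regular_pt f (q * z + c)" "regular_circle f R"
  shows "circle_mean r (\<lambda>z. \<bar>ln (norm (f (q * z + c) / f z))\<bar>) \<le>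
     16 * r / R * (nevanlinna_m R f + nevanlinna_m R (\<lambda>z. 1 / f z) + divisor_sum f R (\<lambda>_. 2 * ln 2)) +
     shift_bound q * divisor_sum f R (root_kernel r)"
proof -
  have R: "R > 0" using r by linarith
  define S where "S = {j. norm j \<le> R \<and> zorder f j \<noteq> 0}"
  have S: "finite S" unfolding S_def by (rule finite_zorder_nonzero[OF f])
  have SR: "norm j < R" if "j \<in> S" for j
    using that regular_circle_norm_less[OF reg(3), of j] by (auto simp: S_def)
  have Sr: "norm j \<noteq> r" if "j \<in> S" for j
    using that regular_circle_zorder[OF reg(1), of j] unfolding S_def by blast
  have Sq: "q * z + c \<noteq> j" if "j \<in> S" "norm z = r" for j z
    using that regular_pt_zorder[OF reg(2), of z] unfolding S_def by blast
  define Z where "Z = (\<lambda>z. \<Sum>j\<in>S. of_int (zorder f j) * ln (norm (z - j) / R))"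
  define Y where "Y = (\<lambda>z. \<Sum>j\<in>S. of_int (zorder f j) * (ln (norm (q * z + c - j)) - ln (norm (z - j))))"
  obtain L where L: "L holomorphic_on cball 0 R" and
    eq: "\<And>z. norm z \<le> R \<Longrightarrow> regular_pt f z \<Longrightarrow> ln (norm (f z)) =
       Re (L z) + Z z"
    unfolding Z_def by (rule ln_norm_factorization[OF f R, folded S_def]) blast
  note contL = holomorphic_imp_continuous_on_sphere[OF L]
  define d where "d = (\<lambda>j. \<bar>real_of_int (zorder f j)\<bar>)"
  define u where "u = (\<lambda>j z. \<bar>ln (norm (q * z + c - j)) - ln (norm (z - j))\<bar>)"
  have contu: "continuous_on (sphere 0 r) (u j)" if "j \<in> S" for j
    unfolding u_def using Sr[OF that] Sq[OF that]
    by (intro continuous_intros) auto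
  have contR: "continuous_on (sphere 0 R) (\<lambda>z. \<bar>ln (norm (z - j) / R)\<bar>)" if "j \<in> S" for j
    using SR[OF that] R by (intro continuous_intros) auto
  define M where "M = circle_mean R (\<lambda>z. \<bar>Re (L z)\<bar>)"
  have M: "M \<le> nevanlinna_m R f + nevanlinna_m R (\<lambda>z. 1 / f z) + divisor_sum f R (\<lambda>_. 2 * ln 2)"
  proof -
    have cont1: "continuous_on (sphere 0 R) (\<lambda>z. \<bar>ln (norm (f z))\<bar>)"
      by (intro continuous_intros continuous_ln_norm reg)
    have cont2: "continuous_on (sphere 0 R) (\<lambda>z. \<Sum>j\<in>S. d j * \<bar>ln (norm (z - j) / R)\<bar>)"
      by (intro continuous_on_sum continuous_on_mult continuous_on_const contR)
    have "M \<le> circle_mean R (\<lambda>z. \<bar>ln (norm (f z))\<bar> + (\<Sum>j\<in>S. d j * \<bar>ln (norm (z - j) / R)\<bar>))"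
      unfolding M_def
    proof (intro circle_mean_mono continuous_on_add cont1 cont2)
      show "continuous_on (sphere 0 R) (\<lambda>z. \<bar>Re (L z)\<bar>)" by (intro continuous_intros contL)
      fix z :: complex assume z: "norm z = R"
      have "Re (L z) = ln (norm (f z)) - Z z"
        using eq[of z] z reg(3) by (auto simp: regular_circle_def)
      moreover have "\<bar>Z z\<bar> \<le> (\<Sum>j\<in>S. d j * \<bar>ln (norm (z - j) / R)\<bar>)"
        using sum_abs[of "\<lambda>j. of_int (zorder f j) * ln (norm (z - j) / R)" S] by (simp add: Z_def d_def abs_mult)
      ultimately show "\<bar>Re (L z)\<bar> \<le> \<bar>ln (norm (f z))\<bar> + (\<Sum>j\<in>S. d j * \<bar>ln (norm (z - j) / R)\<bar>)"
        by linarith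
    qed (use R in auto)
    also have "\<dots> = circle_mean R (\<lambda>z. \<bar>ln (norm (f z))\<bar>) + circle_mean R (\<lambda>z. \<Sum>j\<in>S. d j * \<bar>ln (norm (z - j) / R)\<bar>)"
      using R by (intro circle_mean_add cont1 cont2) auto
    also have "circle_mean R (\<lambda>z. \<Sum>j\<in>S. d j * \<bar>ln (norm (z - j) / R)\<bar>) = (\<Sum>j\<in>S. circle_mean R (\<lambda>z. d j * \<bar>ln (norm (z - j) / R)\<bar>))"
      using R S by (intro circle_mean_sum continuous_on_mult continuous_on_const contR) auto
    also have "\<dots> \<le> (\<Sum>j\<in>S. d j * (2 * ln 2))"
    proof (intro sum_mono)
      fix j assume j: "j \<in> S"
      have "circle_mean R (\<lambda>z. \<bar>ln (norm (z - j) / R)\<bar>) \<le> 2 * ln (1 + norm j / R)"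
        using SR[OF j] R by (intro circle_mean_abs_ln_dist_le) auto
      also have "\<dots> \<le> 2 * ln 2"
      proof -
        have "norm j / R \<le> 1" using SR[OF j] R by simp
        hence "ln (1 + norm j / R) \<le> ln 2"
          using R by (subst ln_le_cancel_iff) (auto intro!: add_pos_nonneg)
        thus ?thesis by simp
      qed
      finally show "circle_mean R (\<lambda>z. d j * \<bar>ln (norm (z - j) / R)\<bar>) \<le> d j * (2 * ln 2)"
        unfolding circle_mean_cmult by (intro mult_left_mono) (auto simp: d_def)
    qed
    finally show ?thesis
      using mean_abs_ln_norm_eq[OF reg(3) R] by (simp add: divisor_sum_def d_def S_def)
  qed
  have cont3: "continuous_on (sphere 0 r) (\<lambda>z. \<Sum>j\<in>S. d j * u j z)"
    by (intro continuous_on_sum continuous_on_mult continuous_on_const contu)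
  note contf = continuous_on_regular_image[OF reg(2)]
  have "circle_mean r (\<lambda>z. \<bar>ln (norm (f (q * z + c) / f z))\<bar>) \<le>
        circle_mean r (\<lambda>z. 16 * r / R * M + (\<Sum>j\<in>S. d j * u j z))"
  proof (intro circle_mean_mono continuous_on_add continuous_on_const cont3)
    show "continuous_on (sphere 0 r) (\<lambda>z. \<bar>ln (norm (f (q * z + c) / f z))\<bar>)"
      using regular_circle_continuous[OF reg(1)] contf regular_circle_nonzero[OF reg(1)] reg(2)
      by (intro continuous_intros) (auto simp: regular_pt_def)
    fix z :: complex assume z: "norm z = r"
    have sz: "norm (q * z + c) \<le> r"
      using norm_triangle_ineq[of "q * z" c] q z by (simp add: norm_mult)
    have fnz: "f z \<noteq> 0" "f (q * z + c) \<noteq> 0" using reg z by (auto simp: regular_circle_def regular_pt_def)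
    have 1: "\<bar>Re (L (q * z + c)) - Re (L z)\<bar> \<le> 16 * r / R * M"
      using holomorphic_diff_le_mean_Re[OF L r(2,1) sz, of z] z abs_Re_le_cmod[of "L (q * z + c) - L z"]
      by (simp add: M_def)
    have "ln (norm (f (q * z + c) / f z)) = ln (norm (f (q * z + c))) - ln (norm (f z))"
      using fnz by (simp add: norm_divide ln_div)
    also have "\<dots> = (Re (L (q * z + c)) - Re (L z)) + 
        (Z (q * z + c) - Z z)"
      using eq[of z] eq[of "q * z + c"] z sz r reg by (simp add: regular_circle_def)
    \<comment> \<open>The normalisation \<open>ln R\<close> cancels, so the divisor part of the
      estimate is independent of \<open>R\<close>.\<close>
    also have "Z (q * z + c) - Z z
        = Y z"
      unfolding Z_def Y_def sum_subtractf[symmetric]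
    proof (intro sum.cong refl)
      fix j assume j: "j \<in> S"
      have "z \<noteq> j" "q * z + c \<noteq> j" using Sr[OF j] Sq[OF j z] z by auto
      thus "of_int (zorder f j) * ln (norm (q * z + c - j) / R) - of_int (zorder f j) * ln (norm (z - j) / R) =
         of_int (zorder f j) * (ln (norm (q * z + c - j)) - ln (norm (z - j)))"
        using R by (simp add: ln_div algebra_simps)
    qed
    finally have "\<bar>ln (norm (f (q * z + c) / f z))\<bar> \<le> \<bar>Re (L (q * z + c)) - Re (L z)\<bar> +
       \<bar>Y z\<bar>" by linarith
    moreover have "\<bar>Y z\<bar> \<le> (\<Sum>j\<in>S. d j * u j z)"
      unfolding Y_def d_def u_def abs_mult[symmetric] by (rule sum_abs)
    ultimately show "\<bar>ln (norm (f (q * z + c) / f z))\<bar> \<le> 16 * r / R * M + (\<Sum>j\<in>S. d j * u j z)"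
      using 1 by linarith
  qed (use r in auto)
  also have "\<dots> = 16 * r / R * M + circle_mean r (\<lambda>z. \<Sum>j\<in>S. d j * u j z)"
    using r cont3 by (subst circle_mean_add) auto
  also have "circle_mean r (\<lambda>z. \<Sum>j\<in>S. d j * u j z) = (\<Sum>j\<in>S. circle_mean r (\<lambda>z. d j * u j z))"
    using r S by (intro circle_mean_sum continuous_on_mult continuous_on_const contu) auto
  also have "\<dots> \<le> (\<Sum>j\<in>S. d j * (shift_bound q * root_kernel r j))"
    unfolding circle_mean_cmult u_def using q r Sr Sq
    by (intro sum_mono mult_left_mono circle_mean_root_shift_le) (auto simp: d_def)
  also have "\<dots> = shift_bound q * divisor_sum f R (root_kernel r)"
    by (simp add: divisor_sum_def d_def S_def sum_distrib_left mult_ac)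
  also have "16 * r / R * M \<le> 16 * r / R * (nevanlinna_m R f + nevanlinna_m R (\<lambda>z. 1 / f z) + divisor_sum f R (\<lambda>_. 2 * ln 2))"
    using r R by (intro mult_left_mono M) auto
  finally show ?thesis by simp
qed

subsection \<open>A growth lemma with logarithmic density\<close>

text \<open>
  Chebyshev's inequality with a moving threshold: let \<open>\<delta> r\<close> be the square root of the supremum of the means
  over \<open>[1, R]\<close>, \<open>R \<ge> r\<close>. As \<open>\<delta>\<close> is decreasing, the set where \<open>h > \<delta>\<close> has logarithmic mean at most \<open>\<delta> r\<close> up to \<open>r\<close>.
\<close>
lemma log_density_of_small_mean:
  fixes h :: "real \<Rightarrow> real"
  assumes cont: "continuous_on {1..} h" and nonneg: "\<And>t. t \<ge> 1 \<Longrightarrow> h t \<ge> 0"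
    and mean: "((\<lambda>R. 1 / ln R * integral {1..R} (\<lambda>t. h t / t)) \<longlongrightarrow> 0) at_top"
    and B: "countable B"
  obtains E where "has_log_density_1 E" "E \<subseteq> {r0..}" "E \<inter> B = {}"
    "(h \<longlongrightarrow> 0) (inf at_top (principal E))"
proof -
  define m where "m = (\<lambda>R. 1 / ln R * integral {1..R} (\<lambda>t. h t / t))"
  have mlim: "(m \<longlongrightarrow> 0) at_top" using mean by (simp add: m_def)
  have int_h: "(\<lambda>t. h t / t) integrable_on {a..b}" if "a \<ge> 1" for a b
    using that by (intro integrable_continuous_real continuous_intros continuous_on_subset[OF cont]) auto
  have m0: "m R \<ge> 0" if "R \<ge> 1" for R
    unfolding m_def using that nonneg
    by (intro mult_nonneg_nonneg integral_nonneg int_h) auto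
  from mlim have "eventually (\<lambda>R. m R < 1) at_top" by (rule order_tendstoD) auto
  then obtain R1 where R1: "\<And>R. R \<ge> R1 \<Longrightarrow> m R < 1" by (auto simp: eventually_at_top_linorder)
  \<comment> \<open>Beyond \<open>R1\<close> the means are below 1, so the suprema taken from
    \<open>r1\<close> on are finite.\<close>
  define r1 where "r1 = Max {r0, R1, 2}"
  have r1: "r1 \<ge> r0" "r1 \<ge> R1" "r1 \<ge> 2" by (auto simp: r1_def)
  define \<eta> where "\<eta> = (\<lambda>R. SUP R'\<in>{max R r1..}. m R')"
  have bdd: "bdd_above (m ` {max R r1..})" for R
    using R1 r1 by (intro bdd_aboveI[of _ 1]) (auto intro: less_imp_le)
  have m_le: "m R' \<le> \<eta> R" if "R' \<ge> R" "R' \<ge> r1" for R R'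
    unfolding \<eta>_def using that by (intro cSUP_upper bdd) auto
  have \<eta>0: "\<eta> R \<ge> 0" for R
  proof -
    have "max R r1 \<ge> 1" using r1 by linarith
    thus ?thesis using m_le[of R "max R r1"] m0[of "max R r1"] by simp
  qed
  have \<eta>_anti: "\<eta> R' \<le> \<eta> R" if "R \<le> R'" for R R'
    unfolding \<eta>_def using that by (intro cSUP_subset_mono bdd) auto
  have \<eta>lim: "(\<eta> \<longlongrightarrow> 0) at_top"
  proof (rule tendstoI)
    fix e :: real assume e: "e > 0"
    have "eventually (\<lambda>R. m R < e / 2) at_top" using mlim by (rule order_tendstoD) (use e in auto)
    then obtain R2 where R2: "\<And>R. R \<ge> R2 \<Longrightarrow> m R < e / 2" by (auto simp: eventually_at_top_linorder)
    have "dist (\<eta> R) 0 < e" if "R \<ge> R2" for R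
    proof -
      have "\<eta> R \<le> e / 2"
        unfolding \<eta>_def
      proof (rule cSUP_least)
        fix x assume "x \<in> {max R r1..}"
        hence "x \<ge> R2" using that by simp
        thus "m x \<le> e / 2" using R2[of x] by simp
      qed simp
      thus ?thesis using \<eta>0[of R] e by simp
    qed
    thus "eventually (\<lambda>R. dist (\<eta> R) 0 < e) at_top" by (auto simp: eventually_at_top_linorder)
  qed
  \<comment> \<open>The summand \<open>1 / max R 1\<close> keeps \<delta> positive where \<eta>
    vanishes, so that one can divide by it, and it still tends to 0.\<close>
  define \<delta> where "\<delta> = (\<lambda>R. sqrt (\<eta> R + 1 / max R 1))"
  have \<delta>0: "\<delta> R > 0" for R
    unfolding \<delta>_def using \<eta>0[of R] by (intro real_sqrt_gt_zero add_nonneg_pos) auto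
  have \<delta>_anti: "\<delta> R' \<le> \<delta> R" if "R \<le> R'" for R R'
    unfolding \<delta>_def using that by (intro real_sqrt_le_mono add_mono \<eta>_anti divide_left_mono) auto
  have \<delta>lim: "(\<delta> \<longlongrightarrow> 0) at_top"
  proof -
    have "((\<lambda>R::real. 1 / max R 1) \<longlongrightarrow> 0) at_top"
    proof (rule Lim_transform_eventually)
      show "((\<lambda>R::real. 1 / R) \<longlongrightarrow> 0) at_top"
        using tendsto_inverse_0_at_top[OF filterlim_ident] by (simp add: divide_inverse)
      show "\<forall>\<^sub>F x in at_top. 1 / x = 1 / max x (1::real)"
        using eventually_ge_at_top[of 1] by eventually_elim (auto simp: max_def)
    qed
    hence "(\<delta> \<longlongrightarrow> sqrt (0 + 0)) at_top"
      unfolding \<delta>_def by (intro tendsto_intros \<eta>lim)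
    thus ?thesis by simp
  qed
  have \<delta>_meas: "\<delta> \<in> borel_measurable borel"
  proof -
    have "(\<lambda>R. - \<delta> R) \<in> borel_measurable borel"
      by (intro borel_measurable_mono monoI) (use \<delta>_anti in auto)
    hence "(\<lambda>R. - (- \<delta> R)) \<in> borel_measurable borel" by (rule borel_measurable_uminus)
    thus ?thesis by simp
  qed
  \<comment> \<open>Extends \<open>h\<close> continuously to the whole line, which gives Borel
    measurability of the set below.\<close>
  define h' where "h' = (\<lambda>r. h (max r 1))"
  have h'_meas: "h' \<in> borel_measurable borel"
    unfolding h'_def
    by (intro borel_measurable_continuous_onI continuous_on_compose2[OF cont] continuous_intros) auto
  define E' where "E' = {r. r1 \<le> r \<and> h' r \<le> \<delta> r}"
  have E'_meas: "E' \<in> sets borel"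
    unfolding E'_def using h'_meas \<delta>_meas by measurable
  have B_meas: "B \<in> sets borel" using B by (rule sets.countable[rotated]) auto
  define E where "E = E' - B"
  show ?thesis
  proof (rule that[of E])
    show "E \<subseteq> {r0..}" using r1 by (auto simp: E_def E'_def)
    show "E \<inter> B = {}" by (auto simp: E_def)
    show "(h \<longlongrightarrow> 0) (inf at_top (principal E))"
    proof (rule tendsto_sandwich[of "\<lambda>_. 0" _ _ \<delta>])
      show "\<forall>\<^sub>F x in inf at_top (principal E). 0 \<le> h x"
        using r1 by (auto simp: eventually_inf_principal E_def E'_def intro!: always_eventually nonneg)
      show "\<forall>\<^sub>F x in inf at_top (principal E). h x \<le> \<delta> x"
        using r1 by (auto simp: eventually_inf_principal E_def E'_def h'_def max_def intro!: always_eventually split: if_splits)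
      show "(\<delta> \<longlongrightarrow> 0) (inf at_top (principal E))"
        using \<delta>lim by (rule tendsto_mono[rotated]) auto
    qed auto
    define d where "d = (\<lambda>r. 1 / ln r * integral (E \<inter> {1..r}) (\<lambda>t. 1 / t))"
    have int1: "((\<lambda>t. 1 / t) has_integral ln r) {1..r}" if "r \<ge> 1" for r :: real
    proof -
      have "((\<lambda>t. 1 / t) has_integral (ln r - ln 1)) {1..r}"
        using that by (intro fundamental_theorem_real) (auto intro!: derivative_eq_intros)
      thus ?thesis by simp
    qed
    have dbounds: "1 - (ln r1 / ln r + \<delta> r) \<le> d r \<and> d r \<le> 1" if r: "r > r1" for r
    proof -
      have r_gt: "r > 1" "ln r > 0" using r r1 by auto
      define I where "I = (\<lambda>t. if t \<in> E' then 1 / t else (0::real))"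
      have I_int: "I integrable_on {1..r}"
      proof (rule measurable_bounded_by_integrable_imp_integrable)
        have "I \<in> borel_measurable borel"
          unfolding I_def using E'_meas by measurable
        thus "I \<in> borel_measurable (lebesgue_on {1..r})"
          by (intro measurable_restrict_space1 measurable_completion) auto
        show "(\<lambda>t. 1 / t) integrable_on {1..r}" using int1[of r] r_gt by auto
      qed (auto simp: I_def)
      have "integral (E \<inter> {1..r}) (\<lambda>t. 1 / t) = integral (E' \<inter> {1..r}) (\<lambda>t. 1 / t)"
      proof (rule integral_spike_set)
        have nB: "negligible B" 
          unfolding negligible_iff_null_sets
          using countable_imp_null_set_lborel[OF B] by (rule null_sets_completionI)
        show "negligible {x \<in> E \<inter> {1..r} - E' \<inter> {1..r}. 1 / x \<noteq> 0}"
          by (rule negligible_subset[OF nB]) (auto simp: E_def)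
        show "negligible {x \<in> E' \<inter> {1..r} - E \<inter> {1..r}. 1 / x \<noteq> 0}"
          by (rule negligible_subset[OF nB]) (auto simp: E_def)
      qed
      also have "\<dots> = integral {1..r} I"
        using integral_restrict_Int[of "{1..r}" E' "\<lambda>t. 1 / t"] by (simp add: I_def Int_commute)
      finally have dI: "d r = integral {1..r} I / ln r" by (simp add: d_def)
      have up: "integral {1..r} I \<le> ln r"
        using integral_le[OF I_int, of "\<lambda>t. 1 / t"] int1[of r] r_gt
        by (auto simp: I_def integral_unique)
      have lowsplit: "integral {r1..r} I = integral {1..r} I - integral {1..r1} I"
        using Henstock_Kurzweil_Integration.integral_combine[OF _ _ I_int, of r1] r r1 by simp
      have I_int1: "I integrable_on {1..r1}"
        by (rule integrable_on_subinterval[OF I_int]) (use r in auto)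
      have I_int2: "I integrable_on {r1..r}"
        by (rule integrable_on_subinterval[OF I_int]) (use r r1 in auto)
      have I1: "integral {1..r1} I \<ge> 0"
        using r1 by (intro integral_nonneg I_int1) (auto simp: I_def)
      have int1': "((\<lambda>t. 1 / t) has_integral (ln r - ln r1)) {r1..r}"
        using r r1 by (intro fundamental_theorem_real) (auto intro!: derivative_eq_intros)
      have hint: "integral {r1..r} (\<lambda>t. h t / t) \<le> ln r * m r"
      proof -
        have "integral {1..r1} (\<lambda>t. h t / t) \<ge> 0"
          using nonneg by (intro integral_nonneg int_h) auto
        moreover have "integral {1..r1} (\<lambda>t. h t / t) + integral {r1..r} (\<lambda>t. h t / t) = integral {1..r} (\<lambda>t. h t / t)"
          using r r1 by (intro Henstock_Kurzweil_Integration.integral_combine int_h) auto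
        ultimately show ?thesis using r_gt by (simp add: m_def)
      qed
      have "ln r - ln r1 = integral {r1..r} (\<lambda>t. 1 / t)" using int1' by (simp add: integral_unique)
      also have "\<dots> \<le> integral {r1..r} (\<lambda>t. I t + (1 / \<delta> r) * (h t / t))"
      proof (intro integral_le)
        show "(\<lambda>t. 1 / t) integrable_on {r1..r}" using int1' by blast
        show "(\<lambda>t. I t + 1 / \<delta> r * (h t / t)) integrable_on {r1..r}"
          using r1 by (intro integrable_add I_int2 integrable_on_mult_right int_h) auto
        fix t assume t: "t \<in> {r1..r}"
        show "1 / t \<le> I t + 1 / \<delta> r * (h t / t)"
        proof (cases "t \<in> E'")
          case True
          thus ?thesis using t r1 \<delta>0[of r] nonneg[of t] by (simp add: I_def)
        next
          case False
          hence "h t > \<delta> t" using t r1 by (auto simp: E'_def h'_def max_def split: if_splits)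
          moreover have "\<delta> t \<ge> \<delta> r" using t by (intro \<delta>_anti) auto
          ultimately have "h t / \<delta> r \<ge> 1" using \<delta>0[of r] by simp
          hence "1 / t \<le> (h t / \<delta> r) / t" using t r1 by (intro divide_right_mono) auto
          thus ?thesis using False by (simp add: I_def mult_ac)
        qed
      qed
      also have "\<dots> = integral {r1..r} I + (1 / \<delta> r) * integral {r1..r} (\<lambda>t. h t / t)"
      proof -
        have "(\<lambda>t. (1 / \<delta> r) * (h t / t)) integrable_on {r1..r}"
          using r1 by (intro integrable_on_mult_right int_h) auto
        from integral_add[OF I_int2 this] show ?thesis by (simp only: integral_mult_right)
      qed
      also have "\<dots> \<le> integral {r1..r} I + (1 / \<delta> r) * (ln r * m r)"
        using hint \<delta>0[of r] by (intro add_left_mono mult_left_mono) auto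
      also have "(1 / \<delta> r) * (ln r * m r) \<le> (1 / \<delta> r) * (ln r * (\<delta> r)\<^sup>2)"
      proof (intro mult_left_mono)
        have "m r \<le> \<eta> r" using r by (intro m_le) auto
        also have "\<dots> \<le> (\<delta> r)\<^sup>2" using \<eta>0[of r] by (simp add: \<delta>_def)
        finally show "m r \<le> (\<delta> r)\<^sup>2" .
      qed (use r_gt \<delta>0[of r] in auto)
      also have "(1 / \<delta> r) * (ln r * (\<delta> r)\<^sup>2) = ln r * \<delta> r"
        using \<delta>0[of r] by (simp add: power2_eq_square)
      finally have "ln r - ln r1 \<le> integral {1..r} I + ln r * \<delta> r" using lowsplit I1 by linarith
      hence "(ln r - (ln r1 + ln r * \<delta> r)) / ln r \<le> integral {1..r} I / ln r"
        using r_gt by (intro divide_right_mono) auto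
      moreover have "(ln r - (ln r1 + ln r * \<delta> r)) / ln r = 1 - (ln r1 / ln r + \<delta> r)"
        using r_gt by (simp add: field_simps)
      ultimately show ?thesis using up r_gt by (simp add: dI)
    qed
    have "(d \<longlongrightarrow> 1) at_top"
    proof (rule tendsto_sandwich)
      show "\<forall>\<^sub>F r in at_top. 1 - (ln r1 / ln r + \<delta> r) \<le> d r"
        using eventually_gt_at_top[of r1] by eventually_elim (use dbounds in auto)
      show "\<forall>\<^sub>F r in at_top. d r \<le> 1"
        using eventually_gt_at_top[of r1] by eventually_elim (use dbounds in auto)
      have "((\<lambda>r. ln r1 / ln r) \<longlongrightarrow> 0) at_top"
        by (intro tendsto_divide_0[OF tendsto_const] filterlim_at_top_imp_at_infinity ln_at_top)
      hence "((\<lambda>r. 1 - (ln r1 / ln r + \<delta> r)) \<longlongrightarrow> 1 - (0 + 0)) at_top"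
        by (intro tendsto_intros \<delta>lim)
      thus "((\<lambda>r. 1 - (ln r1 / ln r + \<delta> r)) \<longlongrightarrow> 1) at_top" by simp
    qed auto
    moreover have "E \<in> sets lebesgue"
      unfolding E_def using E'_meas B_meas by auto
    ultimately show "has_log_density_1 E"
      unfolding has_log_density_1_def d_def using r1 by (auto simp: E_def E'_def)
  qed
qed

text \<open>Bounds \<open>M r - N r\<close>: since \<open>r\<close> times the integral of
  \<open>1 / t\<^sup>2\<close> over \<open>[r, \<infinity>)\<close> is 1, \<open>N r\<close> can be
  moved under the integral defining \<open>M r\<close>. Quantifying over the finite upper limits
  avoids an improper integral.\<close>

definition excess_le :: "(real \<Rightarrow> real) \<Rightarrow> real \<Rightarrow> real \<Rightarrow> bool" where
  "excess_le N r Q \<longleftrightarrow> (\<forall>R\<ge>r. r * integral {r..R} (\<lambda>t. (N t - N r) / t\<^sup>2) \<le> Q)"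

text \<open>The hypothesis \<open>small\<close> is used with a fixed exponent for the convergence of
  the tail integral, and with arbitrarily small exponents for the logarithmic mean. The error is
  first small relative to \<open>1 + M\<close> and then, by absorption, relative to
  \<open>1 + N\<close>.\<close>

theorem growth_lemma:
  fixes N :: "real \<Rightarrow> real"
  assumes cont: "continuous_on {1..} N" and mono: "\<And>s t. 1 \<le> s \<Longrightarrow> s \<le> t \<Longrightarrow> N s \<le> N t"
    and N0: "\<And>t. t \<ge> 1 \<Longrightarrow> N t \<ge> 0"
    and small: "\<And>e. e > 0 \<Longrightarrow> \<exists>C. \<forall>t\<ge>1. N t \<le> C * t powr e"
    and B: "countable B"
  obtains Q E where "has_log_density_1 E" "E \<subseteq> {r0..}" "E \<inter> B = {}"
    "Q \<in> o[inf at_top (principal E)](\<lambda>r. 1 + N r)"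
    "\<And>r. r \<ge> 1 \<Longrightarrow> Q r \<ge> 0"
    "\<And>r. r \<ge> 1 \<Longrightarrow> excess_le N r (Q r)"
proof -
  define f where "f = (\<lambda>t. N t / t\<^sup>2)"
  have contf: "continuous_on {1..} f"
    unfolding f_def by (intro continuous_intros cont) auto
  have int_f: "f integrable_on {a..b}" if "a \<ge> 1" for a b
    using that by (intro integrable_continuous_real continuous_on_subset[OF contf]) auto
  \<comment> \<open>Multiplied by \<open>r\<close>, this tail bound says that \<open>M\<close>
    inherits the growth \<open>r powr e\<close> of \<open>N\<close>. The exponent has to stay below
    1 for the tail of \<open>t powr (e - 2)\<close> to converge.\<close>
  have pow: "\<exists>C\<ge>0. \<forall>r R. 1 \<le> r \<longrightarrow> r \<le> R \<longrightarrow> integral {r..R} f \<le> C * r powr (e - 1)"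
    if e: "e > 0" "e < 1" for e
  proof -
    obtain C0 where C0: "\<And>t. t \<ge> 1 \<Longrightarrow> N t \<le> C0 * t powr e" using small[OF e(1)] by auto
    have C0nn: "C0 \<ge> 0" using C0[of 1] N0[of 1] by simp
    have "integral {r..R} f \<le> C0 / (1 - e) * r powr (e - 1)" if r: "1 \<le> r" "r \<le> R" for r R
    proof -
      have "((\<lambda>t. C0 * t powr (e - 2)) has_integral
             (C0 / (e - 1) * R powr (e - 1) - C0 / (e - 1) * r powr (e - 1))) {r..R}"
      proof (rule fundamental_theorem_real)
        fix t assume t: "r \<le> t" "t \<le> R"
        have "((\<lambda>t. C0 / (e - 1) * t powr (e - 1)) has_real_derivative (C0 / (e - 1) * ((e - 1) * t powr (e - 1 - 1)))) (at t within {r..R})"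
          using t r by (intro DERIV_cmult has_field_derivative_at_within[OF has_real_derivative_powr]) auto
        moreover have "C0 / (e - 1) * ((e - 1) * t powr (e - 1 - 1)) = C0 * t powr (e - 2)" using e by simp
        ultimately show "((\<lambda>t. C0 / (e - 1) * t powr (e - 1)) has_real_derivative C0 * t powr (e - 2)) (at t within {r..R})"
          by simp
      qed (use r in auto)
      hence hi: "(\<lambda>t. C0 * t powr (e - 2)) integrable_on {r..R}"
        "integral {r..R} (\<lambda>t. C0 * t powr (e - 2)) = C0 / (e - 1) * R powr (e - 1) - C0 / (e - 1) * r powr (e - 1)"
        by (rule has_integral_integrable, rule integral_unique)
      have "integral {r..R} f \<le> integral {r..R} (\<lambda>t. C0 * t powr (e - 2))"
      proof (intro integral_le int_f hi r)
        fix t assume t: "t \<in> {r..R}"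
        have "N t / t\<^sup>2 \<le> C0 * t powr e / t\<^sup>2" using C0[of t] t r by (intro divide_right_mono) auto
        also have "t powr (e - 2) = t powr e / t\<^sup>2" using t r by (simp add: powr_diff)
        hence "C0 * t powr e / t\<^sup>2 = C0 * t powr (e - 2)" by simp
        finally show "f t \<le> C0 * t powr (e - 2)" by (simp add: f_def)
      qed
      also have "\<dots> = C0 / (1 - e) * r powr (e - 1) - C0 / (1 - e) * R powr (e - 1)"
      proof -
        have "C0 / (e - 1) = - (C0 / (1 - e))" using e by (simp add: field_simps)
        thus ?thesis unfolding hi(2) by simp
      qed
      also have "\<dots> \<le> C0 / (1 - e) * r powr (e - 1)" using C0nn e by simp
      finally show ?thesis .
    qed
    thus ?thesis using C0nn e by (intro exI[of _ "C0 / (1 - e)"]) auto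
  qed
  define W where "W = (\<lambda>R. integral {1..R} f)"
  \<comment> \<open>\<open>J\<close> is the integral over \<open>[1, \<infinity>)\<close>, realised
    as a supremum of partial integrals, so that \<open>J - W r\<close> is the tail from
    \<open>r\<close> on.\<close>
  define J where "J = (SUP R\<in>{1..}. W R)"
  have f0: "f t \<ge> 0" if "t \<ge> 1" for t using N0[OF that] by (simp add: f_def)
  have Wdiff: "W R - W r = integral {r..R} f" if "1 \<le> r" "r \<le> R" for r R
    using Henstock_Kurzweil_Integration.integral_combine[OF that int_f] by (simp add: W_def)
  have Wb: "bdd_above (W ` {1..})"
  proof -
    obtain C where C: "\<And>R. 1 \<le> R \<Longrightarrow> integral {1..R} f \<le> C * 1 powr (1/2 - 1)"
      using pow[of "1/2"] by auto
    thus ?thesis by (intro bdd_aboveI[of _ C]) (auto simp: W_def)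
  qed
  have WJ: "W R \<le> J" if "R \<ge> 1" for R
    unfolding J_def using that by (intro cSUP_upper Wb) auto
  have Jle: "J \<le> W r + b" if "1 \<le> r" "\<And>R. r \<le> R \<Longrightarrow> integral {r..R} f \<le> b" for r b
    unfolding J_def
  proof (rule cSUP_least)
    fix R :: real assume R: "R \<in> {1..}"
    show "W R \<le> W r + b"
    proof (cases "r \<le> R")
      case True thus ?thesis using Wdiff[of r R] that by fastforce
    next
      case False
      have "integral {R..r} f \<ge> 0" using R by (intro integral_nonneg int_f f0) auto
      hence "W R \<le> W r" using Wdiff[of R r] R False by auto
      moreover have "b \<ge> 0" using that(2)[of r] by simp
      ultimately show ?thesis by linarith
    qed
  qed auto
  define M where "M = (\<lambda>r. r * (J - W r))"
  \<comment> \<open>As \<open>N\<close> increases, the tail of \<open>N t / t\<^sup>2\<close>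
    dominates that of \<open>N r / t\<^sup>2\<close>, which is \<open>N r / r\<close>. The
    comparison is made up to \<open>R\<close>, followed by
    \<open>R \<rightarrow> \<infinity>\<close>.\<close>
  have MN: "N r \<le> M r" if r: "r \<ge> 1" for r
  proof -
    have "N r * (1 - r / R) \<le> M r" if R: "R \<ge> r" for R
    proof -
      have hi: "((\<lambda>t. N r / t\<^sup>2) has_integral (- (N r / R) - (- (N r / r)))) {r..R}"
        using r R by (intro fundamental_theorem_real)
          (auto intro!: derivative_eq_intros simp: power2_eq_square)
      have "N r * (1 - r / R) = r * integral {r..R} (\<lambda>t. N r / t\<^sup>2)"
        using r R unfolding integral_unique[OF hi] by (simp add: field_simps)
      also have "\<dots> \<le> r * integral {r..R} f"
      proof (intro mult_left_mono integral_le)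
        show "(\<lambda>t. N r / t\<^sup>2) integrable_on {r..R}" using hi by blast
        show "f integrable_on {r..R}" using r by (intro int_f)
        show "N r / t\<^sup>2 \<le> f t" if "t \<in> {r..R}" for t
          using that r mono[of r t] by (auto simp: f_def intro!: divide_right_mono)
      qed (use r in auto)
      also have "\<dots> \<le> M r"
        using Wdiff[OF r R] WJ[of R] r R unfolding M_def by (intro mult_left_mono) auto
      finally show ?thesis .
    qed
    hence "eventually (\<lambda>R. N r * (1 - r / R) \<le> M r) at_top"
      by (intro eventually_mono[OF eventually_ge_at_top[of r]]) auto
    moreover have "((\<lambda>R. N r * (1 - r / R)) \<longlongrightarrow> N r * (1 - 0)) at_top"
      by (intro tendsto_intros tendsto_divide_0[OF tendsto_const] filterlim_at_top_imp_at_infinity filterlim_ident)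
    ultimately have "N r * (1 - 0) \<le> M r"
      by (intro tendsto_upperbound) auto
    thus ?thesis by simp
  qed
  have M0: "M r \<ge> 0" if "r \<ge> 1" for r using MN[OF that] N0[OF that] by linarith
  have Mup: "\<exists>C\<ge>0. \<forall>r\<ge>1. M r \<le> C * r powr e" if e: "e > 0" "e < 1" for e
  proof -
    obtain C where C: "C \<ge> 0" "\<And>r R. 1 \<le> r \<Longrightarrow> r \<le> R \<Longrightarrow> integral {r..R} f \<le> C * r powr (e - 1)"
      using pow[OF e] by blast
    have "M r \<le> C * r powr e" if r: "r \<ge> 1" for r
    proof -
      have "M r \<le> r * (C * r powr (e - 1))"
        using Jle[OF r C(2)[OF r]] r unfolding M_def by (intro mult_left_mono) auto
      also have "\<dots> = C * r powr e" using r by (simp add: powr_diff)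
      finally show ?thesis .
    qed
    thus ?thesis using C by blast
  qed
  have W_deriv: "(W has_real_derivative f r) (at r within {1..R})" if "r \<in> {1..R}" for r R
    unfolding W_def has_real_derivative_iff_has_vector_derivative
    using that by (intro integral_has_vector_derivative continuous_on_subset[OF contf]) auto
  have M_deriv: "(M has_real_derivative ((M r - N r) / r)) (at r within {1..R})" if r: "r \<in> {1..R}" for r R
  proof -
    have "(M has_real_derivative (1 * (J - W r) + (0 - f r) * r)) (at r within {1..R})"
      unfolding M_def by (intro DERIV_mult' DERIV_diff DERIV_ident DERIV_const W_deriv r derivative_eq_intros) (auto intro: W_deriv r)
    moreover have "1 * (J - W r) + (0 - f r) * r = (M r - N r) / r"
      using r by (simp add: M_def f_def field_simps power2_eq_square)
    ultimately show ?thesis by simp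
  qed
  have contM: "continuous_on {1..} M"
    unfolding continuous_on_eq_continuous_within
  proof
    fix r :: real assume r: "r \<in> {1..}"
    have "continuous (at r within {1..r+1}) M"
      by (rule DERIV_continuous[OF M_deriv]) (use r in auto)
    moreover have "at r within {1..} = at r within {1..r+1}"
      by (rule at_within_nhd[of _ "{..<r+1}"]) auto
    ultimately show "continuous (at r within {1..}) M" by simp
  qed
  define Q where "Q = (\<lambda>r. M r - N r)"
  define h where "h = (\<lambda>r. Q r / (1 + M r))"
  have h_int: "integral {1..R} (\<lambda>t. h t / t) = ln (1 + M R) - ln (1 + M 1)" if R: "R \<ge> 1" for R
  proof -
    have "((\<lambda>t. h t / t) has_integral (ln (1 + M R) - ln (1 + M 1))) {1..R}"
    proof (rule fundamental_theorem_real[OF R])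
      fix t assume t: "1 \<le> t" "t \<le> R"
      hence "1 + M t > 0" "t \<in> {1..R}" using M0[of t] by auto
      thus "((\<lambda>t. ln (1 + M t)) has_real_derivative (h t / t)) (at t within {1..R})"
        using t by (auto intro!: derivative_eq_intros M_deriv simp: h_def Q_def field_simps)
    qed
    thus ?thesis by (rule integral_unique)
  qed
  have conth: "continuous_on {1..} h"
    unfolding h_def Q_def using M0 by (intro continuous_intros contM cont) (auto simp: add_nonneg_eq_0_iff)
  have h0: "h t \<ge> 0" if "t \<ge> 1" for t
    using MN[OF that] M0[OF that] by (simp add: h_def Q_def)
  have mean: "((\<lambda>R. 1 / ln R * integral {1..R} (\<lambda>t. h t / t)) \<longlongrightarrow> 0) at_top"
  proof (rule tendstoI)
    fix e :: real assume e: "e > 0"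
    \<comment> \<open>The bound \<open>1 / 2\<close> keeps the exponent below 1; half of
      \<open>e\<close> is reserved for \<open>ln (1 + C) / ln R\<close>.\<close>
    define e' where "e' = min (e / 2) (1 / 2)"
    have e': "e' > 0" "e' < 1" "e' \<le> e / 2" using e by (auto simp: e'_def)
    obtain C where C: "C \<ge> 0" "\<And>r. r \<ge> 1 \<Longrightarrow> M r \<le> C * r powr e'" using Mup[OF e'(1,2)] by blast
    have "((\<lambda>R. ln (1 + C) / ln R) \<longlongrightarrow> 0) at_top"
      by (intro tendsto_divide_0[OF tendsto_const] filterlim_at_top_imp_at_infinity ln_at_top)
    hence "eventually (\<lambda>R. ln (1 + C) / ln R < e / 2) at_top"
      by (rule order_tendstoD) (use e in auto)
    thus "eventually (\<lambda>R. dist (1 / ln R * integral {1..R} (\<lambda>t. h t / t)) 0 < e) at_top"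
      using eventually_gt_at_top[of 1]
    proof eventually_elim
      case (elim R)
      have lnR: "ln R > 0" using elim by simp
      have nn: "integral {1..R} (\<lambda>t. h t / t) \<ge> 0"
        by (intro integral_nonneg integrable_continuous_real continuous_intros continuous_on_subset[OF conth])
           (auto intro!: divide_nonneg_nonneg h0)
      have "1 \<le> R powr e'" using elim e' by (intro ge_one_powr_ge_zero) auto
      hence "1 + M R \<le> (1 + C) * R powr e'" using C(2)[of R] elim by (simp add: ring_distribs)
      hence "ln (1 + M R) \<le> ln ((1 + C) * R powr e')"
        using M0[of R] C elim by (subst ln_le_cancel_iff) auto
      also have "\<dots> = ln (1 + C) + e' * ln R" using C elim by (simp add: ln_mult ln_powr)
      finally have "ln (1 + M R) \<le> ln (1 + C) + e' * ln R" .
      hence "integral {1..R} (\<lambda>t. h t / t) \<le> ln (1 + C) + e' * ln R"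
      proof -
        have "ln (1 + M 1) \<ge> 0" using M0[of 1] by (intro ln_ge_zero) auto
        thus ?thesis using h_int[of R] elim \<open>ln (1 + M R) \<le> ln (1 + C) + e' * ln R\<close> by simp
      qed
      hence "integral {1..R} (\<lambda>t. h t / t) / ln R \<le> (ln (1 + C) + e' * ln R) / ln R"
        using lnR by (intro divide_right_mono) auto
      also have "\<dots> = ln (1 + C) / ln R + e'" using lnR by (simp add: field_simps)
      also have "\<dots> < e" using elim e' by linarith
      finally show ?case using nn lnR by simp
    qed
  qed
  obtain E where E: "has_log_density_1 E" "E \<subseteq> {max r0 1..}" "E \<inter> B = {}"
    "(h \<longlongrightarrow> 0) (inf at_top (principal E))"
    using log_density_of_small_mean[OF conth h0 mean B] by blast
  show ?thesis
  proof (rule that[of E Q])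
    show "has_log_density_1 E" "E \<inter> B = {}" by fact+
    show "E \<subseteq> {r0..}" using E(2) by auto
    show "Q r \<ge> 0" if "r \<ge> 1" for r using MN[OF that] by (simp add: Q_def)
    have "r * integral {r..R} (\<lambda>t. (N t - N r) / t\<^sup>2) \<le> Q r" if r: "1 \<le> r" "r \<le> R" for r R
    proof -
      have hi: "((\<lambda>t. N r / t\<^sup>2) has_integral (- (N r / R) - (- (N r / r)))) {r..R}"
        using r by (intro fundamental_theorem_real)
          (auto intro!: derivative_eq_intros simp: power2_eq_square)
      have "integral {r..R} (\<lambda>t. (N t - N r) / t\<^sup>2) = integral {r..R} (\<lambda>t. f t - N r / t\<^sup>2)"
        by (simp add: f_def diff_divide_distrib)
      also have "\<dots> = integral {r..R} f - integral {r..R} (\<lambda>t. N r / t\<^sup>2)"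
        using r hi by (intro integral_diff int_f) auto
      also have "\<dots> = W R - W r - (N r / r - N r / R)"
        using Wdiff[OF r] integral_unique[OF hi] by simp
      also have "\<dots> \<le> J - W r - N r / r"
      proof -
        \<comment> \<open>Cutting the integral at \<open>R\<close> drops the tail
          \<open>J - W R\<close>, but also adds back \<open>N r / R\<close>; the tail is at least as
          large.\<close>
        have "N r \<le> N R" using mono r by auto
        also have "\<dots> \<le> R * (J - W R)" using MN[of R] r by (simp add: M_def)
        finally have "N r / R \<le> J - W R" using r by (simp add: pos_divide_le_eq mult.commute)
        thus ?thesis by linarith
      qed
      finally have "r * integral {r..R} (\<lambda>t. (N t - N r) / t\<^sup>2) \<le> r * (J - W r - N r / r)"
        using r by (intro mult_left_mono) auto
      also have "\<dots> = Q r" using r by (simp add: Q_def M_def field_simps)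
      finally show ?thesis .
    qed
    thus "excess_le N r (Q r)" if "r \<ge> 1" for r using that by (simp add: excess_le_def)
    show "Q \<in> o[inf at_top (principal E)](\<lambda>r. 1 + N r)"
    proof (rule landau_o.smallI)
      fix e :: real assume e: "e > 0"
      \<comment> \<open>With \<open>e' \<le> 1 / 2\<close> the term \<open>e' * Q r\<close> is
        absorbed on the left, which costs the factor 2 allowed for by
        \<open>e' \<le> e / 2\<close>.\<close>
      define e' where "e' = min (e / 2) (1 / 2)"
      have e': "e' > 0" "e' \<le> 1 / 2" "e' \<le> e / 2" using e by (auto simp: e'_def)
      have "eventually (\<lambda>r. h r < e') (inf at_top (principal E))"
        using E(4) by (rule order_tendstoD) (use e' in auto)
      moreover have "eventually (\<lambda>r. r \<in> E) (inf at_top (principal E))"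
        by (auto simp: eventually_inf_principal)
      ultimately show "\<forall>\<^sub>F r in inf at_top (principal E). norm (Q r) \<le> e * norm (1 + N r)"
      proof eventually_elim
        case (elim r)
        have r: "r \<ge> 1" using elim E(2) by auto
        have Q0: "Q r \<ge> 0" using MN[OF r] by (simp add: Q_def)
        have "Q r < e' * (1 + M r)" using elim M0[OF r] by (simp add: h_def pos_divide_less_eq)
        also have "\<dots> = e' * (1 + N r) + e' * Q r" by (simp add: Q_def algebra_simps)
        also have "e' * Q r \<le> 1 / 2 * Q r" using e' Q0 by (intro mult_right_mono) auto
        finally have "Q r \<le> 2 * e' * (1 + N r)" by simp
        also have "\<dots> \<le> e * (1 + N r)" using e' N0[OF r] by (intro mult_right_mono) auto
        finally show ?case using Q0 N0[OF r] by simp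
      qed
    qed
  qed
qed

subsection \<open>Counting functions and affine maps\<close>

text \<open>Truncating the logarithm frees the index set from \<open>r\<close>. This gives
  continuity in \<open>r\<close> and allows two radii to be compared term by term.\<close>

lemma weight_N_eq_sum_max:
  assumes w: "locally_finite_weight w" and r: "1 \<le> r" "r \<le> R"
  shows "weight_N w r = (\<Sum>j | norm j \<le> R \<and> w j \<noteq> 0. w j * max 0 (ln (r / norm1 j)))"
proof -
  have "weight_N w r = (\<Sum>j | norm j \<le> r \<and> w j \<noteq> 0. w j * max 0 (ln (r / norm1 j)))"
    unfolding weight_N_def using r
    by (intro sum.cong refl) (auto simp: max_def not_le dest: weight_N_kernel_nonneg)
  also have "\<dots> = (\<Sum>j | norm j \<le> R \<and> w j \<noteq> 0. w j * max 0 (ln (r / norm1 j)))"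
  proof (rule sum.mono_neutral_left)
    show "finite {j. norm j \<le> R \<and> w j \<noteq> 0}" by (rule locally_finite_weightD[OF w])
    show "\<forall>j\<in>{j. norm j \<le> R \<and> w j \<noteq> 0} - {j. norm j \<le> r \<and> w j \<noteq> 0}.
      w j * max 0 (ln (r / norm1 j)) = 0"
    proof
      fix j assume "j \<in> {j. norm j \<le> R \<and> w j \<noteq> 0} - {j. norm j \<le> r \<and> w j \<noteq> 0}"
      hence j: "norm j > r" "j \<noteq> 0" using r by auto
      hence "r / norm j \<le> 1" using r by (auto simp: divide_le_eq)
      hence "ln (r / norm j) \<le> 0" using j r by simp
      thus "w j * max 0 (ln (r / norm1 j)) = 0" using j by (simp add: max_def)
    qed
  qed (use r in auto)
  finally show ?thesis .
qed

lemma continuous_on_weight_N: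
  assumes w: "locally_finite_weight w"
  shows "continuous_on {1..} (weight_N w)"
proof -
  have "continuous (at r within {1..}) (weight_N w)" if r: "r \<ge> 1" for r
  proof -
    have "continuous_on {1..r+1} (\<lambda>t. \<Sum>j | norm j \<le> r+1 \<and> w j \<noteq> 0. w j * max 0 (ln (t / norm1 j)))"
      by (intro continuous_intros) auto
    hence "continuous_on {1..r+1} (weight_N w)"
      by (rule continuous_on_eq) (auto simp: weight_N_eq_sum_max[OF w])
    hence "continuous (at r within {1..r+1}) (weight_N w)"
      using r by (simp add: continuous_on_eq_continuous_within)
    moreover have "at r within {1..} = at r within {1..r+1}"
      by (rule at_within_nhd[of _ "{..<r+1}"]) auto
    ultimately show ?thesis by simp
  qed
  thus ?thesis by (simp add: continuous_on_eq_continuous_within)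
qed

lemma has_integral_ln_over_square:
  fixes s r R :: real
  assumes "0 < r" "r \<le> s" "s \<le> R"
  shows "((\<lambda>t. max 0 (ln (t / s)) / t\<^sup>2) has_integral (1 / s - (1 + ln (R / s)) / R)) {r..R}"
proof -
  have "((\<lambda>t. ln (t / s) / t\<^sup>2) has_integral (- ((1 + ln (R / s)) / R) - (- ((1 + ln (s / s)) / s)))) {s..R}"
    using assms by (intro fundamental_theorem_real) (auto intro!: derivative_eq_intros simp: field_simps power2_eq_square)
  hence "((\<lambda>t. ln (t / s) / t\<^sup>2) has_integral (1 / s - (1 + ln (R / s)) / R)) {s..R}"
    using assms by simp
  hence "((\<lambda>t. if t \<in> {s..R} then ln (t / s) / t\<^sup>2 else 0) has_integral (1 / s - (1 + ln (R / s)) / R)) {r..R}"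
    using assms by (subst has_integral_restrict) auto
  thus ?thesis
  proof (rule has_integral_eq[rotated])
    fix t assume t: "t \<in> {r..R}"
    show "(if t \<in> {s..R} then ln (t / s) / t\<^sup>2 else 0) = max 0 (ln (t / s)) / t\<^sup>2"
    proof (cases "s \<le> t")
      case True
      hence "ln (t / s) \<ge> 0" using assms by simp
      thus ?thesis using True t by simp
    next
      case False
      hence "ln (t / s) \<le> 0" using assms t by simp
      thus ?thesis using False by (simp add: max_def)
    qed
  qed
qed

text \<open>With \<open>s = max r (norm j)\<close>, the growth of the kernel of \<open>j\<close>
  from \<open>r\<close> to \<open>t\<close> is \<open>max 0 (ln (t / s))\<close>. Its integral
  against \<open>r / t\<^sup>2\<close> over \<open>[r, \<infinity>)\<close> is \<open>r / s\<close>,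
  which is exactly \<open>root_kernel r j\<close>. Restricting to the finitely many \<open>j\<close>
  with \<open>norm j \<le> R0\<close> makes the passage to the limit a finite one.\<close>

lemma sum_root_kernel_le:
  assumes w: "locally_finite_weight w" "\<And>z. w z \<ge> 0" and r: "r \<ge> 1"
    and Q: "excess_le (weight_N w) r Q"
  shows "(\<Sum>j | norm j \<le> R0 \<and> w j \<noteq> 0. w j * root_kernel r j) \<le> Q"
proof -
  define S where "S = {j. norm j \<le> R0 \<and> w j \<noteq> 0}"
  have S: "finite S" unfolding S_def by (rule locally_finite_weightD[OF w(1)])
  define s where "s = (\<lambda>j::complex. max r (norm j))"
  have s: "s j \<ge> r" "s j > 0" for j using r by (auto simp: s_def)
  define k where "k = (\<lambda>t (j::complex). max 0 (ln (t / norm1 j)))"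
  have kd: "k t j - k r j = max 0 (ln (t / s j))" if t: "t \<ge> r" for t j
  proof (cases "j = 0")
    case True
    thus ?thesis using t r by (simp add: k_def s_def ln_div max_def)
  next
    case False
    hence j: "norm j > 0" by simp
    have "(0 \<le> ln (u / norm j)) = (norm j \<le> u)" if "u > 0" for u
      using j that by (simp add: ln_div)
    thus ?thesis using False j t r
      by (auto simp: k_def s_def max_def ln_div split: if_splits)
  qed
  have cont: "continuous_on {r..R} (weight_N w)" for R
    by (rule continuous_on_subset[OF continuous_on_weight_N[OF w(1)]]) (use r in auto)
  have bound: "(\<Sum>j\<in>S. w j * (r * (1 / s j - (1 + ln (R / s j)) / R))) \<le> Q" if R: "R \<ge> r" "R \<ge> R0" for R
  proof -
    have sR: "s j \<le> R" if "j \<in> S" for j using that R by (auto simp: s_def S_def)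
    have hi: "((\<lambda>t. \<Sum>j\<in>S. w j * (max 0 (ln (t / s j)) / t\<^sup>2)) has_integral (\<Sum>j\<in>S. w j * (1 / s j - (1 + ln (R / s j)) / R))) {r..R}"
      using S r s sR by (intro has_integral_sum has_integral_mult_right has_integral_ln_over_square) auto
    have "(\<Sum>j\<in>S. w j * (1 / s j - (1 + ln (R / s j)) / R)) = integral {r..R} (\<lambda>t. \<Sum>j\<in>S. w j * (max 0 (ln (t / s j)) / t\<^sup>2))"
      using hi by (simp add: integral_unique)
    also have "\<dots> \<le> integral {r..R} (\<lambda>t. (weight_N w t - weight_N w r) / t\<^sup>2)"
    proof (rule integral_le)
      show "(\<lambda>t. \<Sum>j\<in>S. w j * (max 0 (ln (t / s j)) / t\<^sup>2)) integrable_on {r..R}" using hi by blast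
      show "(\<lambda>t. (weight_N w t - weight_N w r) / t\<^sup>2) integrable_on {r..R}"
        using r by (intro integrable_continuous_real continuous_intros cont) auto
      fix t assume t: "t \<in> {r..R}"
      define S' where "S' = {j. norm j \<le> R \<and> w j \<noteq> 0}"
      have S': "finite S'" unfolding S'_def by (rule locally_finite_weightD[OF w(1)])
      have "weight_N w t - weight_N w r = (\<Sum>j\<in>S'. w j * (k t j - k r j))"
        using t r R by (simp add: weight_N_eq_sum_max[OF w(1), of _ R] S'_def k_def sum_subtractf right_diff_distrib)
      also have "\<dots> = (\<Sum>j\<in>S'. w j * max 0 (ln (t / s j)))"
        using t by (intro sum.cong refl) (auto simp: kd)
      also have "\<dots> \<ge> (\<Sum>j\<in>S. w j * max 0 (ln (t / s j)))"
        using S' R w(2) by (intro sum_mono2) (auto simp: S'_def S_def)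
      finally have "(\<Sum>j\<in>S. w j * max 0 (ln (t / s j))) / t\<^sup>2 \<le> (weight_N w t - weight_N w r) / t\<^sup>2"
        by (intro divide_right_mono) auto
      thus "(\<Sum>j\<in>S. w j * (max 0 (ln (t / s j)) / t\<^sup>2)) \<le> (weight_N w t - weight_N w r) / t\<^sup>2"
        by (simp add: sum_divide_distrib)
    qed
    finally have "r * (\<Sum>j\<in>S. w j * (1 / s j - (1 + ln (R / s j)) / R)) \<le> Q"
      using Q R(1) r mult_left_mono[of _ _ r] unfolding excess_le_def by (meson order.trans zero_le_one)
    thus ?thesis by (simp add: sum_distrib_left mult_ac)
  qed
  have "((\<lambda>R. \<Sum>j\<in>S. w j * (r * (1 / s j - (1 + ln (R / s j)) / R))) \<longlongrightarrow> (\<Sum>j\<in>S. w j * (r * (1 / s j - 0)))) at_top"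
  proof (intro tendsto_intros)
    fix j :: complex
    have "((\<lambda>R. (1 - ln (s j)) / R + ln R / R) \<longlongrightarrow> 0 + 0) at_top"
      by (intro tendsto_add ln_x_over_x_tendsto_0 tendsto_divide_0[OF tendsto_const]
            filterlim_at_top_imp_at_infinity filterlim_ident)
    hence "((\<lambda>R. (1 - ln (s j)) / R + ln R / R) \<longlongrightarrow> 0) at_top" by simp
    moreover have "\<forall>\<^sub>F R in at_top. (1 - ln (s j)) / R + ln R / R = (1 + ln (R / s j)) / R"
      using eventually_gt_at_top[of 0]
      by eventually_elim (use s(2)[of j] in \<open>simp add: ln_div flip: add_divide_distrib\<close>)
    ultimately show "((\<lambda>R. (1 + ln (R / s j)) / R) \<longlongrightarrow> 0) at_top"
      by (rule Lim_transform_eventually)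
  qed
  moreover have "eventually (\<lambda>R. (\<Sum>j\<in>S. w j * (r * (1 / s j - (1 + ln (R / s j)) / R))) \<le> Q) at_top"
    using eventually_ge_at_top[of r] eventually_ge_at_top[of R0] by eventually_elim (rule bound)
  ultimately have "(\<Sum>j\<in>S. w j * (r * (1 / s j - 0))) \<le> Q"
    by (intro tendsto_upperbound) auto
  also have "(\<Sum>j\<in>S. w j * (r * (1 / s j - 0))) = (\<Sum>j\<in>S. w j * root_kernel r j)"
    using r by (intro sum.cong) (auto simp: root_kernel_def s_def max_def)
  finally show ?thesis by (simp add: S_def)
qed

text \<open>A point \<open>w\<close> of \<open>p\<close> corresponds to the preimage
  \<open>(w - c) / q\<close>. For \<open>norm w > R0\<close> the preimage is no closer to the
  origin, so its logarithmic weight does not increase. The remaining points are finitely many, and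
  each changes its weight by an amount independent of \<open>r\<close>; these changes add up to
  \<open>K\<close>.\<close>

lemma weight_N_compose_affine_le:
  fixes q c :: complex
  assumes p: "locally_finite_weight p" "\<And>z. p z \<ge> 0" and q: "0 < norm q" "norm q < 1"
  obtains K r0 where "\<And>r. r \<ge> r0 \<Longrightarrow> weight_N (\<lambda>z. p (q * z + c)) r \<le> weight_N p r + K"
proof -
  define \<sigma> where "\<sigma> = (\<lambda>z. q * z + c)"
  define \<sigma>' where "\<sigma>' = (\<lambda>w. (w - c) / q)"
  have inv: "\<sigma>' (\<sigma> z) = z" for z using q by (auto simp: \<sigma>_def \<sigma>'_def)
  define R0 where "R0 = max 1 (norm c / (1 - norm q))"
  have shrink: "norm q * r + norm c \<le> r" if "r \<ge> R0" for r
  proof -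
    have "norm c / (1 - norm q) \<le> r" using that by (simp add: R0_def)
    thus ?thesis using q by (simp add: divide_le_eq algebra_simps)
  qed
  define F where "F = {w. norm w \<le> R0 \<and> p w \<noteq> 0}"
  have F: "finite F" unfolding F_def by (rule locally_finite_weightD[OF p(1)])
  define K where "K = (\<Sum>w\<in>F. p w * \<bar>ln (norm1 w) - ln (norm1 (\<sigma>' w))\<bar>)"
  have "weight_N (\<lambda>z. p (q * z + c)) r \<le> weight_N p r + K" if r: "r \<ge> R0" for r
  proof -
    have r1: "r \<ge> 1" using r by (simp add: R0_def)
    define S where "S = {z. norm z \<le> r \<and> p (\<sigma> z) \<noteq> 0}"
    define T where "T = {w. norm w \<le> r \<and> p w \<noteq> 0}"
    have T: "finite T" unfolding T_def by (rule locally_finite_weightD[OF p(1)])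
    have inj: "inj_on \<sigma> S" by (rule inj_on_inverseI[of _ \<sigma>']) (rule inv)
    have sub: "\<sigma> ` S \<subseteq> T"
    proof safe
      fix z assume z: "z \<in> S"
      have "norm (\<sigma> z) \<le> norm q * norm z + norm c"
        unfolding \<sigma>_def by (metis norm_mult norm_triangle_ineq)
      also have "\<dots> \<le> norm q * r + norm c" using z by (auto simp: S_def intro!: mult_left_mono)
      also have "\<dots> \<le> r" by (rule shrink[OF r])
      finally show "\<sigma> z \<in> T" using z by (simp add: S_def T_def)
    qed
    have "weight_N (\<lambda>z. p (q * z + c)) r = (\<Sum>z\<in>S. p (\<sigma> z) * ln (r / norm1 z))"
      by (simp add: weight_N_def S_def \<sigma>_def norm1_def)
    also have "\<dots> = (\<Sum>w\<in>\<sigma> ` S. p w * ln (r / norm1 (\<sigma>' w)))"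
      by (subst sum.reindex[OF inj]) (simp add: inv)
    also have "\<dots> \<le> (\<Sum>w\<in>\<sigma> ` S. p w * ln (r / norm1 w) + (if w \<in> F then p w * \<bar>ln (norm1 w) - ln (norm1 (\<sigma>' w))\<bar> else 0))"
    proof (rule sum_mono)
      fix w assume w: "w \<in> \<sigma> ` S"
      show "p w * ln (r / norm1 (\<sigma>' w)) \<le> p w * ln (r / norm1 w) + (if w \<in> F then p w * \<bar>ln (norm1 w) - ln (norm1 (\<sigma>' w))\<bar> else 0)"
      proof (cases "w \<in> F")
        case True
        have "ln (r / norm1 (\<sigma>' w)) \<le> ln (r / norm1 w) + \<bar>ln (norm1 w) - ln (norm1 (\<sigma>' w))\<bar>"
          using r1 by (simp add: ln_div)
        from mult_left_mono[OF this p(2)[of w]] show ?thesis using True by (simp add: ring_distribs)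
      next
        case False
        hence wR: "norm w > R0" using w sub by (auto simp: F_def T_def)
        have "norm q * norm w + norm c \<le> norm w" using wR by (intro shrink) auto
        also have "\<dots> \<le> norm (w - c) + norm c" using norm_triangle_ineq[of "w - c" c] by simp
        finally have "norm w \<le> norm (\<sigma>' w)"
          using q by (simp add: \<sigma>'_def norm_divide pos_le_divide_eq mult.commute)
        moreover have w0: "norm w > 0"
        proof -
          have "R0 \<ge> 1" by (simp add: R0_def)
          thus ?thesis using wR by linarith
        qed
        ultimately have "norm1 w \<le> norm1 (\<sigma>' w)" by (auto simp: norm1_def)
        hence "ln (r / norm1 (\<sigma>' w)) \<le> ln (r / norm1 w)"
          using r1 by (simp add: ln_div)
        thus ?thesis using False p(2)[of w] by (simp add: mult_left_mono)
      qed
    qed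
    also have "\<dots> \<le> (\<Sum>w\<in>T. p w * ln (r / norm1 w) + (if w \<in> F then p w * \<bar>ln (norm1 w) - ln (norm1 (\<sigma>' w))\<bar> else 0))"
    proof (rule sum_mono2[OF T sub])
      fix w assume "w \<in> T - \<sigma> ` S"
      hence "ln (r / norm1 w) \<ge> 0"
        using weight_N_kernel_nonneg[of w r] r1 by (simp add: T_def norm1_def)
      thus "0 \<le> p w * ln (r / norm1 w) + (if w \<in> F then p w * \<bar>ln (norm1 w) - ln (norm1 (\<sigma>' w))\<bar> else 0)"
        using p(2)[of w] by auto
    qed
    also have "\<dots> = weight_N p r + (\<Sum>w\<in>T. if w \<in> F then p w * \<bar>ln (norm1 w) - ln (norm1 (\<sigma>' w))\<bar> else 0)"
      by (simp add: sum.distrib weight_N_def T_def norm1_def)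
    also have "(\<Sum>w\<in>T. if w \<in> F then p w * \<bar>ln (norm1 w) - ln (norm1 (\<sigma>' w))\<bar> else 0) = K"
    proof -
      have "F \<subseteq> T" using r by (auto simp: F_def T_def)
      thus ?thesis unfolding K_def using T by (simp add: sum.If_cases Int_absorb1)
    qed
    finally show ?thesis .
  qed
  thus ?thesis by (rule that)
qed

section \<open>Orders of the Hahn difference\<close>

text \<open>Comparing leading coefficients at the fixed point gives \<open>q powi n = 1\<close> for
  the order \<open>n\<close>, and \<open>0 < norm q < 1\<close> forces \<open>n = 0\<close>.\<close>

lemma affine_invariant_zorder_0:
  fixes q c z :: complex
  assumes f: "mero_nz f" and q: "0 < norm q" "norm q < 1" and z: "q * z + c = z"
    and inv: "\<forall>\<^sub>F w in at z. f (q * w + c) = f w"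
  shows "zorder f z = 0"
proof (rule ccontr)
  assume ord: "zorder f z \<noteq> 0"
  define n where "n = zorder f z"
  define P where "P = zor_poly f z"
  obtain r where r: "r > 0" and nz: "P z \<noteq> 0" and hol: "P holomorphic_on cball z r"
    and eq: "\<And>w. w \<in> cball z r - {z} \<Longrightarrow> f w = P w * (w - z) powi n \<and> P w \<noteq> 0"
    using zorder_exist[OF mero_nzD(2,3,5)[OF f, of z]] unfolding n_def P_def by blast
  have \<sigma>: "q * w + c - z = q * (w - z)" for w
  proof -
    have "q * w + c - z = q * w + c - (q * z + c)" by (simp only: z)
    thus ?thesis by (simp add: algebra_simps)
  qed
  have "continuous_on (ball z r) P"
    using holomorphic_on_imp_continuous_on[OF hol] by (rule continuous_on_subset) auto
  hence cont: "isCont P z" using r by (simp add: continuous_on_eq_continuous_at)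
  have lim1: "(P \<longlongrightarrow> P z) (at z)" using cont by (simp add: isCont_def)
  have "isCont (\<lambda>w. P (q * w + c)) z"
    by (rule isCont_o2[of _ "\<lambda>w. q * w + c"]) (auto simp: z cont)
  hence lim2: "((\<lambda>w. P (q * w + c)) \<longlongrightarrow> P z) (at z)" by (simp add: isCont_def z)
  have "\<forall>\<^sub>F w in at z. w \<in> ball z r - {z}" using r by (intro eventually_at_in_open) auto
  hence "\<forall>\<^sub>F w in at z. P w = q powi n * P (q * w + c)"
    using inv
  proof eventually_elim
    case (elim w)
    have wz: "w - z \<noteq> 0" using elim by auto
    have "norm (q * w + c - z) \<le> 1 * norm (w - z)"
      unfolding \<sigma> norm_mult using q by (intro mult_right_mono) auto
    hence "q * w + c \<in> cball z r" using elim by (simp add: dist_norm norm_minus_commute)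
    moreover have "q * w + c \<noteq> z" using \<sigma>[of w] wz q by auto
    ultimately have "f (q * w + c) = P (q * w + c) * (q * (w - z)) powi n"
      using eq[of "q * w + c"] \<sigma>[of w] by simp
    moreover have "f w = P w * (w - z) powi n" using eq[of w] elim by simp
    ultimately have "P w * (w - z) powi n = (q powi n * P (q * w + c)) * (w - z) powi n"
      using elim by (simp add: power_int_mult_distrib mult_ac)
    thus ?case using wz by simp
  qed
  hence "((\<lambda>w. q powi n * P (q * w + c)) \<longlongrightarrow> P z) (at z)"
    by (rule Lim_transform_eventually[OF lim1])
  moreover have "((\<lambda>w. q powi n * P (q * w + c)) \<longlongrightarrow> q powi n * P z) (at z)"
    by (intro tendsto_intros lim2)
  ultimately have "P z = q powi n * P z" by (rule tendsto_unique[rotated]) simp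
  hence "q powi n = 1" using nz by simp
  hence "norm q powi n = 1" by (metis norm_one norm_power_int)
  hence "ln (norm q powi n) = 0" by simp
  hence "of_int n * ln (norm q) = 0" using ln_power_int[OF q(1), of n] by simp
  moreover have "ln (norm q) < 0" using q by simp
  ultimately show False using ord by (simp add: n_def)
qed

text \<open>Otherwise \<open>g\<close> would be invariant near the fixed point of
  \<open>z \<mapsto> q * z + c\<close>, and so would \<open>g - b\<close>. But \<open>b\<close> is
  chosen so that \<open>g - b\<close> has a zero or a pole there, contradicting the preceding
  lemma.\<close>

lemma mero_nz_affine_diff:
  fixes q c :: complex
  assumes g: "g nicely_meromorphic_on UNIV" "\<not> g constant_on UNIV" and q: "0 < norm q" "norm q < 1"
  shows "mero_nz (\<lambda>z. g (q * z + c) - g z)"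
proof -
  have g0: "mero_nz g" using mero_nz_diff_const[OF g, of 0] by simp
  have mer: "(\<lambda>z. g (q * z + c) - g z) meromorphic_on UNIV"
    using q by (intro meromorphic_intros mero_nzD[OF g0] mero_nzD[OF mero_nz_compose_affine[OF g0]]) auto
  define z where "z = c / (1 - q)"
  have q1: "q \<noteq> 1" using q by auto
  have z: "q * z + c = z" using q1 by (simp add: z_def field_simps)
  define b where "b = (if is_pole g z then 0 else g z)"
  define f where "f = (\<lambda>w. g w - b)"
  have f: "mero_nz f" unfolding f_def by (rule mero_nz_diff_const[OF g])
  have "zorder f z \<noteq> 0"
  proof (cases "is_pole g z")
    case True
    hence "f = g" by (simp add: f_def b_def)
    thus ?thesis using True is_pole_iff_zorder[OF g0] by auto
  next
    case False
    hence "g analytic_on {z}" using nicely_meromorphic_on_imp_analytic_at[OF g(1)] by auto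
    hence "f analytic_on {z}" unfolding f_def by (intro analytic_intros)
    thus ?thesis using False zorder_eq_0_iff[OF _ mero_nzD(5)[OF f, of z]] by (simp add: f_def b_def)
  qed
  hence "\<not> (\<forall>\<^sub>F w in at z. f (q * w + c) = f w)"
    using affine_invariant_zorder_0[OF f q z] by blast
  hence "\<not> (\<forall>\<^sub>F w in at z. g (q * w + c) - g w = 0)" by (simp add: f_def)
  hence "\<not> (\<forall>\<^sub>\<approx>w\<in>UNIV. g (q * w + c) - g w = 0)"
    using eventually_cosparse_imp_eventually_at by blast
  hence "\<forall>\<^sub>\<approx>w\<in>UNIV. g (q * w + c) - g w \<noteq> 0"
    using meromorphic_imp_constant_or_avoid[OF mer, of 0] by auto
  hence "\<forall>\<^sub>F w in at z. g (q * w + c) - g w \<noteq> 0" for z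
    by (rule eventually_cosparse_imp_eventually_at) auto
  thus ?thesis using mer by (simp add: mero_nz_def)
qed

text \<open>The denominator has a simple zero at the fixed point of the affine map and no other;
  hence the correction by 1 in all order formulas below.\<close>

lemma mero_nz_hahn_denominator:
  fixes q c :: complex
  assumes "norm q < 1"
  shows "mero_nz (\<lambda>z. (q - 1) * z + c)"
    "zorder (\<lambda>z. (q - 1) * z + c) z = (if q * z + c = z then 1 else 0)"
proof -
  have q1: "q - 1 \<noteq> 0" using assms by auto
  define z0 where "z0 = c / (1 - q)"
  have eq: "(q - 1) * z + c = (q - 1) * (z - z0)" for z
    using q1 by (simp add: z0_def right_diff_distrib) (simp add: field_simps)
  have lin: "mero_nz (\<lambda>z. (z - z0) / of_real 1)" by (rule mero_nz_linear) simp
  have con: "mero_nz (\<lambda>z. q - 1)" using q1 by (auto simp: mero_nz_def)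
  show "mero_nz (\<lambda>z. (q - 1) * z + c)"
    unfolding eq using mero_nz_mult[OF con lin] by simp
  have "zorder (\<lambda>z. (q - 1) * z + c) z = (if z = z0 then 1 else 0)"
    unfolding eq using zorder_mero_nz_mult[OF con lin, of z] zorder_linear[of 1 z0 z] q1 by simp
  moreover have "z = z0 \<longleftrightarrow> q * z + c = z"
  proof -
    have "q * z + c = z \<longleftrightarrow> (q - 1) * z + c = 0" by (auto simp: algebra_simps)
    thus ?thesis unfolding eq using q1 by auto
  qed
  ultimately show "zorder (\<lambda>z. (q - 1) * z + c) z = (if q * z + c = z then 1 else 0)" by simp
qed

lemma mero_nz_hahn_diff:
  fixes q c :: complex
  assumes g: "g nicely_meromorphic_on UNIV" "\<not> g constant_on UNIV" and q: "0 < norm q" "norm q < 1"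
  shows "mero_nz (hahn_diff q c g)"
    "zorder (hahn_diff q c g) z = zorder (\<lambda>z. g (q * z + c) - g z) z - (if q * z + c = z then 1 else 0)"
proof -
  have eq: "hahn_diff q c g = (\<lambda>z. (g (q * z + c) - g z) / ((q - 1) * z + c))"
    by (auto simp: hahn_diff_def)
  note num = mero_nz_affine_diff[OF g q] and den = mero_nz_hahn_denominator[OF q(2)]
  show "mero_nz (hahn_diff q c g)" unfolding eq by (intro mero_nz_divide num den)
  show "zorder (hahn_diff q c g) z = zorder (\<lambda>z. g (q * z + c) - g z) z - (if q * z + c = z then 1 else 0)"
    unfolding eq zorder_mero_nz_divide[OF num den(1)] den(2) ..
qed

lemma zorder_hahn_diff_inverse:
  fixes q c :: complex
  assumes g: "g nicely_meromorphic_on UNIV" "\<not> g constant_on UNIV" and q: "0 < norm q" "norm q < 1"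
  shows "zorder (hahn_diff q c (\<lambda>w. 1 / g w)) z =
    zorder (hahn_diff q c g) z - zorder g (q * z + c) - zorder g z"
proof -
  have g0: "mero_nz g" using mero_nz_diff_const[OF g, of 0] by simp
  have q0: "q \<noteq> 0" using q by auto
  have gs: "mero_nz (\<lambda>z. g (q * z + c))" by (rule mero_nz_compose_affine[OF g0 q0])
  note D = mero_nz_hahn_diff(1)[OF g q, of c]
  have con: "mero_nz (\<lambda>z. -1)" by (auto simp: mero_nz_def)
  have gg: "mero_nz (\<lambda>z. g (q * z + c) * g z)" by (intro mero_nz_mult gs g0)
  have "zorder (hahn_diff q c (\<lambda>w. 1 / g w)) z =
        zorder (\<lambda>z. -1 * (hahn_diff q c g z / (g (q * z + c) * g z))) z"
  proof (rule zorder_cong)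
    show "\<forall>\<^sub>F w in at z. hahn_diff q c (\<lambda>w. 1 / g w) w = -1 * (hahn_diff q c g w / (g (q * w + c) * g w))"
      using mero_nzD(4)[OF gs, of z] mero_nzD(4)[OF g0, of z]
    proof eventually_elim
      case (elim w)
      hence "1 / g (q * w + c) - 1 / g w = - ((g (q * w + c) - g w) / (g (q * w + c) * g w))"
        by (simp add: field_simps)
      moreover have "- (x / y) / d = -1 * (x / d / y)" for x y d :: complex
        by (simp add: mult.commute)
      ultimately show ?case by (simp only: hahn_diff_def)
    qed
  qed auto
  also have "\<dots> = zorder (\<lambda>z. hahn_diff q c g z / (g (q * z + c) * g z)) z"
    using zorder_mero_nz_mult[OF con mero_nz_divide[OF D gg], of z] by simp
  also have "\<dots> = zorder (hahn_diff q c g) z - (zorder (\<lambda>z. g (q * z + c)) z + zorder g z)"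
    by (simp add: zorder_mero_nz_divide[OF D gg] zorder_mero_nz_mult[OF gs g0])
  finally show ?thesis by (simp add: zorder_compose_affine[OF g0 q0])
qed

text \<open>Summed with logarithmic weights, this gives \<open>N\<^bsub>q,c\<^esub>(r)\<close> up to \<open>N(r, g (q z + c)) - N(r, g)\<close>.\<close>
definition order_balance :: "complex \<Rightarrow> complex \<Rightarrow> (complex \<Rightarrow> complex) \<Rightarrow> complex \<Rightarrow> real" where
  "order_balance q c g z = pole_weight g z + of_int (zorder (hahn_diff q c g) z) + pole_weight g (q * z + c)"

text \<open>Let \<open>D\<close> be the order of the Hahn difference. If neither \<open>z\<close>
  nor \<open>q * z + c\<close> is a pole of \<open>g\<close>, then \<open>b = D \<ge> 0\<close>. If
  both are poles, \<open>b\<close> is the order of the Hahn difference of \<open>1 / g\<close> at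
  \<open>z\<close>. If exactly one is a pole, it is also the pole of the difference quotient, and
  the orders cancel to \<open>b = 0\<close>.\<close>

lemma multiplicity_balance:
  fixes q c z :: complex
  assumes g: "g nicely_meromorphic_on UNIV" "\<not> g constant_on UNIV" and q: "0 < norm q" "norm q < 1"
  defines "b \<equiv> order_balance q c g z"
  shows "b \<ge> 0"
    "\<not> is_pole g z \<Longrightarrow> real (zero_mult (hahn_diff q c g) z) \<le> b"
    "is_pole g z \<Longrightarrow> real (min (pole_mult g z) (zero_mult (hahn_diff q c (\<lambda>w. 1 / g w)) z)) \<le> b"
proof -
  have g0: "mero_nz g" using mero_nz_diff_const[OF g, of 0] by simp
  have q0: "q \<noteq> 0" using q by auto
  have gs: "mero_nz (\<lambda>z. g (q * z + c))" by (rule mero_nz_compose_affine[OF g0 q0])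
  note num = mero_nz_affine_diff[OF g q, of c]
  note ip = is_pole_iff_zorder[OF g0]
  note zs = zorder_compose_affine[OF g0 q0, of c]
  define D where "D = zorder (hahn_diff q c g) z"
  define n where "n = zorder (\<lambda>z. g (q * z + c) - g z) z"
  have Dn: "D = n - (if q * z + c = z then 1 else 0)"
    unfolding D_def n_def by (rule mero_nz_hahn_diff[OF g q])
  define p where "p = zorder g z"
  define s where "s = zorder g (q * z + c)"
  have b: "b = max 0 (- of_int p) + of_int D + max 0 (- of_int s)"
    by (simp add: b_def order_balance_def pole_weight_zorder D_def p_def s_def)
  have "b \<ge> 0 \<and> real (zero_mult (hahn_diff q c g) z) \<le> b" if np: "\<not> is_pole g z"
  proof -
    have p: "p \<ge> 0" using np ip by (simp add: p_def)
    have an: "g analytic_on {z}" using nicely_meromorphic_on_imp_analytic_at[OF g(1)] np by auto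
    show ?thesis
    proof (cases "is_pole g (q * z + c)")
      case True
      hence s: "s < 0" using ip by (simp add: s_def)
      have "n = s"
        unfolding n_def s_def zs[symmetric]
        by (rule zorder_diff1) (use s p in \<open>auto intro: mero_nzD[OF gs] mero_nzD[OF g0] simp: zs s_def p_def\<close>)
      moreover have "q * z + c \<noteq> z" using True np by auto
      ultimately have "D = s" using Dn by simp
      thus ?thesis using s p by (simp add: b zero_mult_def D_def[symmetric])
    next
      case False
      hence s: "s \<ge> 0" using ip by (simp add: s_def)
      have "g analytic_on {q * z + c}" using nicely_meromorphic_on_imp_analytic_at[OF g(1)] False by auto
      hence "(g \<circ> (\<lambda>z. q * z + c)) analytic_on {z}"
        by (intro analytic_on_compose) (auto intro: analytic_intros)
      hence an2: "(\<lambda>z. g (q * z + c) - g z) analytic_on {z}"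
        using an by (intro analytic_intros) (auto simp: o_def)
      have "D \<ge> 0"
      proof (cases "q * z + c = z")
        case True
        \<comment> \<open>At the fixed point the numerator vanishes, which makes up for the simple
          zero of the denominator.\<close>
        hence "n > 0"
          using zorder_pos_iff'[OF an2 mero_nzD(5)[OF num]] by (simp add: n_def)
        thus ?thesis using Dn True by simp
      next
        case False
        thus ?thesis using zorder_ge_0[OF an2 mero_nzD(5)[OF num]] Dn by (simp add: n_def)
      qed
      thus ?thesis using s p by (simp add: b zero_mult_def D_def[symmetric])
    qed
  qed
  moreover have "b \<ge> 0 \<and> real (min (pole_mult g z) (zero_mult (hahn_diff q c (\<lambda>w. 1 / g w)) z)) \<le> b" 
    if pole: "is_pole g z"
  proof -
    have p: "p < 0" using pole ip by (simp add: p_def)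
    have zi: "zorder (hahn_diff q c (\<lambda>w. 1 / g w)) z = D - s - p"
      unfolding D_def s_def p_def by (rule zorder_hahn_diff_inverse[OF g q])
    show ?thesis
    proof (cases "s < 0")
      case False
      have "n = p"
        unfolding n_def p_def
        by (rule zorder_diff2) (use False p in \<open>auto intro: mero_nzD[OF gs] mero_nzD[OF g0] simp: zs s_def p_def\<close>)
      moreover have "q * z + c \<noteq> z" using False p by (auto simp: s_def p_def)
      ultimately have "D = p" using Dn by simp
      thus ?thesis using False p by (simp add: b zero_mult_def zi)
    next
      case True
      have "n \<ge> min s p"
        unfolding n_def
      proof (rule zorder_diff_ge)
        show "\<exists>\<^sub>F z in at z. g (q * z + c) \<noteq> g z" using mero_nzD(5)[OF num, of z] by simp
      qed (auto intro: mero_nzD[OF gs] mero_nzD[OF g0] simp: zs s_def p_def)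
      \<comment> \<open>At the fixed point the denominator costs one order. This is affordable,
        since \<open>s\<close> and \<open>p\<close> are both at most -1 and so
        \<open>min s p - 1 \<ge> s + p\<close>.\<close>
      hence "D \<ge> s + p" using Dn True p by (auto split: if_splits)
      thus ?thesis using True p by (simp add: b zero_mult_def zi)
    qed
  qed
  ultimately show "b \<ge> 0" "\<not> is_pole g z \<Longrightarrow> real (zero_mult (hahn_diff q c g) z) \<le> b"
    "is_pole g z \<Longrightarrow> real (min (pole_mult g z) (zero_mult (hahn_diff q c (\<lambda>w. 1 / g w)) z)) \<le> b"
    by blast+
qed

subsection \<open>Proximity estimates for the Hahn difference\<close>

lemma log_plus_mono: "x \<le> y \<Longrightarrow> log_plus x \<le> log_plus y"
  by (auto simp: log_plus_def max_def)

lemma log_plus_mult_le: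
  assumes "x \<ge> 0" "y \<ge> 0"
  shows "log_plus (x * y) \<le> log_plus x + log_plus y"
proof -
  have "max 1 x * max 1 y \<ge> x * y" using assms by (intro mult_mono) auto
  moreover have "1 * 1 \<le> max 1 x * max 1 y" by (intro mult_mono) auto
  ultimately have "max 1 (x * y) \<le> max 1 x * max 1 y" by simp
  hence "ln (max 1 (x * y)) \<le> ln (max 1 x * max 1 y)" by (subst ln_le_cancel_iff) auto
  also have "\<dots> = ln (max 1 x) + ln (max 1 y)" by (intro ln_mult_pos) auto
  finally show ?thesis by (simp add: log_plus_def)
qed

lemma log_plus_add_le:
  assumes "x \<ge> 0" "y \<ge> 0"
  shows "log_plus (x + y) \<le> log_plus x + log_plus y + ln 2"
proof -
  have "x \<le> max 1 x * max 1 y" "y \<le> max 1 x * max 1 y"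
    using mult_mono[of x "max 1 x" 1 "max 1 y"] mult_mono[of 1 "max 1 x" y "max 1 y"] assms by auto
  moreover have "1 * 1 \<le> max 1 x * max 1 y" by (intro mult_mono) auto
  ultimately have "max 1 (x + y) \<le> (max 1 x * max 1 y) * 2" by simp
  hence "ln (max 1 (x + y)) \<le> ln ((max 1 x * max 1 y) * 2)" by (subst ln_le_cancel_iff) auto
  also have "\<dots> = ln (max 1 x) + ln (max 1 y) + ln 2"
    by (subst ln_mult_pos, simp, simp, subst ln_mult_pos) auto
  finally show ?thesis by (simp add: log_plus_def)
qed

lemma log_plus_le_abs_ln:
  assumes "x > 0"
  shows "log_plus x \<le> \<bar>ln x\<bar>"
  using log_plus_add[OF assms] log_plus_nonneg[of "1 / x"] by linarith

lemma log_plus_diff_const_le: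
  fixes w a :: complex
  shows "log_plus (norm (w - a)) \<le> log_plus (norm w) + (log_plus (norm a) + ln 2)"
    "log_plus (norm w) \<le> log_plus (norm (w - a)) + (log_plus (norm a) + ln 2)"
proof -
  have "log_plus (norm (w - a)) \<le> log_plus (norm w + norm a)"
    by (intro log_plus_mono norm_triangle_ineq4)
  also have "\<dots> \<le> log_plus (norm w) + log_plus (norm a) + ln 2" by (intro log_plus_add_le) auto
  finally show "log_plus (norm (w - a)) \<le> log_plus (norm w) + (log_plus (norm a) + ln 2)" by simp
  have "log_plus (norm w) \<le> log_plus (norm (w - a) + norm a)"
    using norm_triangle_ineq[of "w - a" a] by (intro log_plus_mono) simp
  also have "\<dots> \<le> log_plus (norm (w - a)) + log_plus (norm a) + ln 2" by (intro log_plus_add_le) auto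
  finally show "log_plus (norm w) \<le> log_plus (norm (w - a)) + (log_plus (norm a) + ln 2)" by simp
qed

text \<open>The terms of all points but the nearest are bounded. Only that one term is written as
  the product of \<open>d / (w - b)\<close> and \<open>1 / d\<close>, so \<open>1 / d\<close> is
  paid once and not once for each point; this is what allows the sum over all targets to be bounded
  with a single proximity function of \<open>1 / D\<close>.\<close>

lemma sum_log_plus_inverse_dist_le:
  fixes A :: "complex set"
  assumes A: "finite A"
  obtains C where "C \<ge> 0"
    "\<And>w d. w \<notin> A \<Longrightarrow> d \<noteq> 0 \<Longrightarrow> (\<Sum>a\<in>A. log_plus (norm (1 / (w - a)))) \<le>
       C + ((\<Sum>a\<in>A. log_plus (norm (d / (w - a)))) + log_plus (norm (1 / d)))"
proof -
  \<comment> \<open>The inserted 1 keeps the minimum defined and positive when \<open>A\<close> has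
    fewer than two points.\<close>
  define S where "S = insert 1 ((\<lambda>(a,b). dist a b) ` {(a,b). a \<in> A \<and> b \<in> A \<and> a \<noteq> b})"
  have "finite {(a,b). a \<in> A \<and> b \<in> A \<and> a \<noteq> b}" by (rule finite_subset[of _ "A \<times> A"]) (use A in auto)
  hence S: "finite S" "S \<noteq> {}" by (auto simp: S_def)
  define e where "e = Min S / 2"
  have e: "e > 0" using S by (auto simp: e_def Min_gr_iff S_def)
  have sep: "2 * e \<le> dist a b" if "a \<in> A" "b \<in> A" "a \<noteq> b" for a b
    using S that unfolding e_def by (auto intro!: Min_le simp: S_def)
  have far: "log_plus (norm (1 / (w - a))) \<le> log_plus (1 / e)" if "norm (w - a) \<ge> e" for w a :: complex
    using that e by (intro log_plus_mono) (auto simp: norm_divide intro!: divide_left_mono mult_pos_pos)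
  define C where "C = real (card A) * log_plus (1 / e)"
  show ?thesis
  proof (rule that[of C])
    show "C \<ge> 0" by (simp add: C_def)
    fix w d :: complex assume w: "w \<notin> A" and d: "d \<noteq> 0"
    have nn: "(\<Sum>a\<in>B. log_plus (norm (d / (w - a)))) \<ge> 0" for B by (intro sum_nonneg) auto
    show "(\<Sum>a\<in>A. log_plus (norm (1 / (w - a)))) \<le>
       C + ((\<Sum>a\<in>A. log_plus (norm (d / (w - a)))) + log_plus (norm (1 / d)))"
    proof (cases "\<exists>a\<in>A. norm (w - a) < e")
      case False
      hence "(\<Sum>a\<in>A. log_plus (norm (1 / (w - a)))) \<le> (\<Sum>a\<in>A. log_plus (1 / e))"
        by (intro sum_mono far) (auto simp: not_less)
      also have "\<dots> = C" by (simp add: C_def)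
      finally show ?thesis using nn[of A] log_plus_nonneg[of "norm (1 / d)"] by linarith
    next
      case True
      then obtain b where b: "b \<in> A" "norm (w - b) < e" by blast
      have fb: "e \<le> norm (w - a)" if "a \<in> A - {b}" for a
      proof -
        have "2 * e \<le> norm (a - b)" using sep[of a b] that b by (simp add: dist_norm)
        also have "\<dots> \<le> norm (w - b) + norm (w - a)"
          using norm_triangle_ineq4[of "w - b" "w - a"] by (simp add: algebra_simps)
        finally show ?thesis using b by linarith
      qed
      have "(\<Sum>a\<in>A. log_plus (norm (1 / (w - a)))) =
            log_plus (norm (1 / (w - b))) + (\<Sum>a\<in>A-{b}. log_plus (norm (1 / (w - a))))"
        using A b by (simp add: sum.remove)
      also have "(\<Sum>a\<in>A-{b}. log_plus (norm (1 / (w - a)))) \<le> (\<Sum>a\<in>A-{b}. log_plus (1 / e))"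
        by (intro sum_mono far fb)
      also have "\<dots> \<le> (\<Sum>a\<in>A. log_plus (1 / e))" using A by (intro sum_mono2) auto
      also have "\<dots> = C" by (simp add: C_def)
      also have "log_plus (norm (1 / (w - b))) \<le> log_plus (norm (d / (w - b))) + log_plus (norm (1 / d))"
        using log_plus_mult_le[of "norm (d / (w - b))" "norm (1 / d)"] d by (simp add: norm_divide)
      also have "log_plus (norm (d / (w - b))) \<le> (\<Sum>a\<in>A. log_plus (norm (d / (w - a))))"
        using A b by (intro member_le_sum) auto
      finally show ?thesis by simp
    qed
  qed
qed

lemma nevanlinna_m_diff_const_le:
  assumes "continuous_on (sphere 0 r) g" "r \<ge> 0"
  shows "nevanlinna_m r (\<lambda>z. g z - a) \<le> nevanlinna_m r g + (log_plus (norm a) + ln 2)"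
    "nevanlinna_m r g \<le> nevanlinna_m r (\<lambda>z. g z - a) + (log_plus (norm a) + ln 2)"
proof -
  have c: "continuous_on (sphere 0 r) (\<lambda>z. log_plus (norm (g z)))"
    "continuous_on (sphere 0 r) (\<lambda>z. log_plus (norm (g z - a)))"
    by (intro continuous_intros assms)+
  have "nevanlinna_m r (\<lambda>z. g z - a) \<le> circle_mean r (\<lambda>z. log_plus (norm (g z)) + (log_plus (norm a) + ln 2))"
    unfolding nevanlinna_m_eq_circle_mean
    using c assms log_plus_diff_const_le(1) by (intro circle_mean_mono continuous_intros) auto
  thus "nevanlinna_m r (\<lambda>z. g z - a) \<le> nevanlinna_m r g + (log_plus (norm a) + ln 2)"
    using circle_mean_add[OF c(1) continuous_on_const[of _ "log_plus (norm a) + ln 2"] assms(2)]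
    by (simp add: nevanlinna_m_eq_circle_mean)
  have "nevanlinna_m r g \<le> circle_mean r (\<lambda>z. log_plus (norm (g z - a)) + (log_plus (norm a) + ln 2))"
    unfolding nevanlinna_m_eq_circle_mean
    using c assms log_plus_diff_const_le(2) by (intro circle_mean_mono continuous_intros) auto
  thus "nevanlinna_m r g \<le> nevanlinna_m r (\<lambda>z. g z - a) + (log_plus (norm a) + ln 2)"
    using circle_mean_add[OF c(2) continuous_on_const[of _ "log_plus (norm a) + ln 2"] assms(2)]
    by (simp add: nevanlinna_m_eq_circle_mean)
qed

text \<open>At a pole the constant cannot change the order; applied to \<open>a\<close> and to
  \<open>- a\<close>, this excludes that only one of the two functions has a pole.\<close>

lemma pole_weight_diff_const:
  assumes "mero_nz g" "mero_nz (\<lambda>z. g z - a)"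
  shows "pole_weight (\<lambda>z. g z - a) = pole_weight g"
proof -
  have *: "zorder (\<lambda>z. f z - b) z = zorder f z"
    if f: "mero_nz f" "mero_nz (\<lambda>z. f z - b)" "zorder f z < 0" for f b z
  proof (cases "b = 0")
    case False
    hence c: "mero_nz (\<lambda>_. b)" by (auto simp: mero_nz_def)
    show ?thesis
      by (rule zorder_diff1) (use f False in \<open>auto intro: mero_nzD[OF f(1)] mero_nzD[OF c]\<close>)
  qed simp
  show ?thesis
  proof
    fix z
    have "zorder (\<lambda>z. g z - a) z = zorder g z" if "zorder g z < 0" using *[OF assms that] .
    moreover have "zorder g z = zorder (\<lambda>z. g z - a) z" if "zorder (\<lambda>z. g z - a) z < 0"
      using *[of "\<lambda>z. g z - a" "- a" z] assms that by simp
    ultimately have "zorder (\<lambda>z. g z - a) z = zorder g z \<or> zorder (\<lambda>z. g z - a) z \<ge> 0 \<and> zorder g z \<ge> 0"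
      by linarith
    thus "pole_weight (\<lambda>z. g z - a) z = pole_weight g z"
      unfolding pole_weight_zorder by (elim disjE conjE) simp_all
  qed
qed

lemma ex_not_in_countable:
  fixes a b :: real
  assumes "countable B" "a < b"
  obtains x where "a < x" "x < b" "x \<notin> B"
proof -
  have "\<not> {a<..<b} \<subseteq> B"
    using assms countable_subset uncountable_open_interval by blast
  then obtain x where "x \<in> {a<..<b}" "x \<notin> B" by blast
  thus ?thesis using that[of x] by simp
qed

lemma countable_not_regular_image:
  assumes f: "mero_nz f" and q: "q \<noteq> 0"
  shows "countable {r. \<exists>z. norm z = r \<and> \<not> regular_pt f (q * z + c)}"
proof -
  have "countable {z. \<not> regular_pt f z}"
    using sparse_imp_countable[OF _ sparse_not_regular[OF f]] by auto
  moreover have "{r. \<exists>z. norm z = r \<and> \<not> regular_pt f (q * z + c)} \<subseteq>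
      (\<lambda>w. norm ((w - c) / q)) ` {z. \<not> regular_pt f z}"
  proof safe
    fix z assume "\<not> regular_pt f (q * z + c)"
    thus "norm z \<in> (\<lambda>w. norm ((w - c) / q)) ` {z. \<not> regular_pt f z}"
      using q by (intro image_eqI[of _ _ "q * z + c"]) auto
  qed
  ultimately show ?thesis by (meson countable_image countable_subset)
qed

text \<open>\<open>A\<close> stands for the finite targets. In the main proof it also receives a
  value that \<open>g\<close> attains, so it may be larger than the set of targets.\<close>

locale zero_order_meromorphic =
  fixes q c :: complex and g :: "complex \<Rightarrow> complex" and A :: "complex set"
  assumes q: "0 < norm q" "norm q < 1"
    and nice: "g nicely_meromorphic_on UNIV" and nonconst: "\<not> g constant_on UNIV"
    and zero_order: "meromorphic_order g = 0"
    and A: "finite A" "A \<noteq> {}"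
begin

abbreviation "fn a \<equiv> (\<lambda>z. g z - a)"
abbreviation "T \<equiv> (\<lambda>r. nevanlinna_T r g)"
abbreviation "D \<equiv> hahn_diff q c g"

lemma mero_nz_fn: "mero_nz (fn a)"
  by (rule mero_nz_diff_const[OF nice nonconst])

lemma mero_nz_fn_inv: "mero_nz (\<lambda>z. 1 / fn a z)"
  using mero_nz_inverse[OF mero_nz_fn] by (simp add: divide_inverse)

lemma mero_nz_g: "mero_nz g"
  using mero_nz_fn[of 0] by simp

lemma mero_nz_D: "mero_nz D" "mero_nz (\<lambda>z. 1 / D z)"
  using mero_nz_hahn_diff(1)[OF nice nonconst q] mero_nz_inverse by (auto simp: divide_inverse)

text \<open>Zeros and poles of all \<open>g - a\<close> are counted in one weight, so a single
  \<open>Q\<close> dominates the shift estimate for every \<open>a\<close> in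
  \<open>A\<close>.\<close>

definition w :: "complex \<Rightarrow> real" where "w z = (\<Sum>a\<in>A. \<bar>of_int (zorder (fn a) z)\<bar>)"
definition N :: "real \<Rightarrow> real" where "N = weight_N w"

lemma w_lf: "locally_finite_weight w"
  unfolding w_def
  by (intro locally_finite_weight_sum locally_finite_weight_mono[OF locally_finite_zorder[OF mero_nz_fn]]) auto

lemma w_nonneg: "w z \<ge> 0"
  unfolding w_def by (intro sum_nonneg) auto

lemma zorder_le_w: "a \<in> A \<Longrightarrow> \<bar>of_int (zorder (fn a) z)\<bar> \<le> w z"
  unfolding w_def using A by (intro member_le_sum) auto

lemma zorder_support_subset:
  assumes "a \<in> A" "r \<le> R"
  shows "{j. norm j \<le> r \<and> zorder (fn a) j \<noteq> 0} \<subseteq> {j. norm j \<le> R \<and> w j \<noteq> 0}"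
proof safe
  fix j assume "zorder (fn a) j \<noteq> 0" "w j = 0"
  thus False using zorder_le_w[OF assms(1), of j] by simp
qed (use assms in auto)

lemma nevanlinna_N_fn: "r > 0 \<Longrightarrow> nevanlinna_N r (fn a) = nevanlinna_N r g"
  by (simp add: nevanlinna_N_eq_weight_N mero_nz_fn mero_nz_g pole_weight_diff_const)

lemma nevanlinna_N_nonneg: "mero_nz f \<Longrightarrow> r \<ge> 1 \<Longrightarrow> nevanlinna_N r f \<ge> 0"
  by (subst nevanlinna_N_eq_weight_N) (auto intro!: weight_N_nonneg simp: pole_weight_def)

lemma nevanlinna_m_nonneg: "r \<ge> 0 \<Longrightarrow> nevanlinna_m r f \<ge> 0"
  unfolding nevanlinna_m_eq_circle_mean by (intro circle_mean_nonneg) auto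

lemma N_eq:
  assumes r: "r > 0"
  shows "N r = (\<Sum>a\<in>A. nevanlinna_N r (\<lambda>z. 1 / fn a z) + nevanlinna_N r g)"
proof -
  have abs_eq: "w = (\<lambda>z. \<Sum>a\<in>A. pole_weight (\<lambda>z. 1 / fn a z) z + pole_weight (fn a) z)"
    unfolding w_def pole_weight_inverse[OF mero_nz_fn] pole_weight_zorder
    by (intro ext sum.cong) auto
  have "N r = (\<Sum>a\<in>A. weight_N (\<lambda>z. pole_weight (\<lambda>z. 1 / fn a z) z + pole_weight (fn a) z) r)"
    unfolding N_def abs_eq using A
    by (intro weight_N_sum locally_finite_weight_add locally_finite_pole_weight mero_nz_fn mero_nz_fn_inv)
  also have "\<dots> = (\<Sum>a\<in>A. weight_N (pole_weight (\<lambda>z. 1 / fn a z)) r + weight_N (pole_weight (fn a)) r)"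
    by (intro sum.cong refl weight_N_add locally_finite_pole_weight mero_nz_fn mero_nz_fn_inv)
  finally show ?thesis
    using r nevanlinna_N_fn[OF r] by (simp add: nevanlinna_N_eq_weight_N[OF mero_nz_fn_inv r] nevanlinna_N_eq_weight_N[OF mero_nz_fn r, symmetric])
qed

text \<open>The image circle is included because means of
  \<open>ln (norm (g (q * z + c) - a))\<close> are taken.\<close>

definition good :: "real \<Rightarrow> bool" where
  "good r \<longleftrightarrow> (\<forall>a\<in>A. regular_circle (fn a) r \<and> (\<forall>z. norm z = r \<longrightarrow> regular_pt (fn a) (q * z + c))) \<and> regular_circle D r"

lemma countable_not_good: "countable {r. \<not> good r}"
proof -
  have "{r. \<not> good r} \<subseteq> (\<Union>a\<in>A. {r. \<not> regular_circle (fn a) r} \<union> {r. \<exists>z. norm z = r \<and> \<not> regular_pt (fn a) (q * z + c)}) \<union> {r. \<not> regular_circle D r}"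
    by (auto simp: good_def)
  moreover have "countable \<dots>"
    using A q by (intro countable_Un countable_UN countable_finite countable_not_regular_circle countable_not_regular_image mero_nz_fn mero_nz_D) auto
  ultimately show ?thesis by (rule countable_subset)
qed

lemma good_continuous:
  assumes "good r"
  shows "continuous_on (sphere 0 r) g"
proof -
  obtain a where "a \<in> A" using A by blast
  hence "continuous_on (sphere 0 r) (fn a)" using assms by (auto simp: good_def intro: regular_circle_continuous)
  hence "continuous_on (sphere 0 r) (\<lambda>z. fn a z + a)" by (intro continuous_on_add continuous_on_const)
  thus ?thesis by simp
qed

lemma T_fn_le:
  assumes "good r" "r > 0"
  shows "nevanlinna_T r (fn a) \<le> T r + (log_plus (norm a) + ln 2)"
    "T r \<le> nevanlinna_T r (fn a) + (log_plus (norm a) + ln 2)"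
  using nevanlinna_m_diff_const_le[OF good_continuous[OF assms(1)], of a] assms(2)
  by (simp_all add: nevanlinna_T_def nevanlinna_N_fn)

lemma T_fn_inv:
  assumes "a \<in> A" "good r" "r > 0"
  shows "nevanlinna_T r (\<lambda>z. 1 / fn a z) = nevanlinna_T r (fn a) - ln (norm (zor_poly (fn a) 0 0))"
  using first_main_theorem[OF mero_nz_fn] assms by (auto simp: good_def)

definition K :: "real" where
  "K = (\<Sum>a\<in>A. log_plus (norm a) + ln 2 + \<bar>ln (norm (zor_poly (fn a) 0 0))\<bar>)"

lemma le_K: "a \<in> A \<Longrightarrow> log_plus (norm a) + ln 2 + \<bar>ln (norm (zor_poly (fn a) 0 0))\<bar> \<le> K"
  unfolding K_def using A by (intro member_le_sum) auto

lemma K_nonneg: "K \<ge> 0"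
  unfolding K_def by (intro sum_nonneg add_nonneg_nonneg) auto

lemma T_fn_inv_bounds:
  assumes "a \<in> A" "good r" "r > 0"
  shows "nevanlinna_T r (\<lambda>z. 1 / fn a z) \<le> T r + K" "T r \<le> nevanlinna_T r (\<lambda>z. 1 / fn a z) + K"
    "nevanlinna_T r (fn a) \<le> T r + K"
  using T_fn_inv[OF assms] T_fn_le[OF assms(2,3), of a] le_K[OF assms(1)] by linarith+

lemma N_le_T:
  assumes "good r" "r \<ge> 1"
  shows "N r \<le> real (card A) * (2 * T r + K)"
proof -
  have "N r = (\<Sum>a\<in>A. nevanlinna_N r (\<lambda>z. 1 / fn a z) + nevanlinna_N r g)" using assms by (intro N_eq) auto
  also have "\<dots> \<le> (\<Sum>a\<in>A. 2 * T r + K)"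
  proof (rule sum_mono)
    fix a assume a: "a \<in> A"
    have "nevanlinna_N r (\<lambda>z. 1 / fn a z) \<le> nevanlinna_T r (\<lambda>z. 1 / fn a z)" "nevanlinna_N r g \<le> T r"
      using nevanlinna_m_nonneg[of r] assms by (simp_all add: nevanlinna_T_def)
    thus "nevanlinna_N r (\<lambda>z. 1 / fn a z) + nevanlinna_N r g \<le> 2 * T r + K"
      using T_fn_inv_bounds(1)[OF a assms(1)] assms(2) by linarith
  qed
  finally show ?thesis by simp
qed

lemma T_small:
  assumes "e > 0"
  obtains R where "R \<ge> 1" "\<And>r. r \<ge> R \<Longrightarrow> T r \<le> r powr e"
proof -
  have "Limsup at_top (\<lambda>r::real. ereal (log_plus (nevanlinna_T r g) / ln r)) < ereal e"
    using zero_order assms by (simp add: meromorphic_order_def)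
  hence "\<forall>\<^sub>F r in at_top. ereal (log_plus (nevanlinna_T r g) / ln r) < ereal e"
    by (rule Limsup_lessD)
  hence "\<forall>\<^sub>F r in at_top. T r \<le> r powr e"
    using eventually_gt_at_top[of 1]
  proof eventually_elim
    case (elim r)
    hence "log_plus (T r) < e * ln r" by (simp add: divide_less_eq)
    hence "ln (max 1 (T r)) < ln (r powr e)" using elim by (simp add: log_plus_def ln_powr)
    hence "max 1 (T r) < r powr e" using elim by (subst (asm) ln_less_cancel_iff) auto
    thus ?case by simp
  qed
  then obtain R where "\<And>r. r \<ge> R \<Longrightarrow> T r \<le> r powr e" by (auto simp: eventually_at_top_linorder)
  thus ?thesis using that[of "max R 1"] by auto
qed

lemma N_mono: "1 \<le> s \<Longrightarrow> s \<le> t \<Longrightarrow> N s \<le> N t"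
  unfolding N_def using w_lf w_nonneg by (intro weight_N_mono_radius) auto

lemma N_nonneg: "r \<ge> 1 \<Longrightarrow> N r \<ge> 0"
  unfolding N_def using w_nonneg by (intro weight_N_nonneg) auto

lemma N_small:
  assumes e: "e > 0"
  obtains C where "C \<ge> 0" "\<And>t. t \<ge> 1 \<Longrightarrow> N t \<le> C * t powr e"
proof -
  obtain R where R: "R \<ge> 1" "\<And>r. r \<ge> R \<Longrightarrow> T r \<le> r powr e" using T_small[OF e] by blast
  define C where "C = real (card A) * (2 * (2 * R) powr e + K)"
  show ?thesis
  proof (rule that[of C])
    show "C \<ge> 0" using K_nonneg by (simp add: C_def)
    fix t :: real assume t: "t \<ge> 1"
    have "R * t \<ge> 1 * 1" using t R by (intro mult_mono) auto
    \<comment> \<open>The bound of \<open>N\<close> by \<open>T\<close> is available at good radii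
      only. As \<open>N\<close> is monotone, a good radius between \<open>R * t\<close> and
      \<open>2 * R * t\<close> suffices; the factor \<open>R\<close> puts it in the range of the
      growth bound, while it stays proportional to \<open>t\<close>.\<close>
    then obtain r where r: "R * t < r" "r < 2 * (R * t)" "r \<notin> {r. \<not> good r}"
      using ex_not_in_countable[OF countable_not_good, of "R * t" "2 * (R * t)"] by auto
    have "1 * t \<le> R * t" "R * 1 \<le> R * t" using t R by (auto intro!: mult_mono)
    hence rt: "t \<le> r" "R \<le> r" using r by linarith+
    have "N t \<le> N r" using t rt by (intro N_mono) auto
    also have "\<dots> \<le> real (card A) * (2 * T r + K)" using r rt t by (intro N_le_T) auto
    also have "\<dots> \<le> real (card A) * (2 * ((2 * R) powr e * t powr e) + K * t powr e)"
    proof (intro mult_left_mono add_mono)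
      have "T r \<le> r powr e" using rt by (intro R)
      also have "\<dots> \<le> (2 * R * t) powr e" using r rt t e by (intro powr_mono2) auto
      also have "\<dots> = (2 * R) powr e * t powr e" using R t by (simp add: powr_mult)
      finally show "T r \<le> (2 * R) powr e * t powr e" .
      have "1 \<le> t powr e" using t e by (intro ge_one_powr_ge_zero) auto
      thus "K \<le> K * t powr e" using mult_left_mono[OF _ K_nonneg] by fastforce
    qed auto
    also have "\<dots> = C * t powr e" by (simp add: C_def algebra_simps)
    finally show "N t \<le> C * t powr e" .
  qed
qed

text \<open>The usual passage from a counting function to its integral: for
  \<open>norm j \<le> R\<close> the logarithmic weight at radius \<open>2 * R\<close> is at least
  \<open>ln 2\<close>.\<close>

lemma divisor_sum_le:
  assumes a: "a \<in> A" and R: "R \<ge> 1"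
  shows "divisor_sum (fn a) R (\<lambda>_. 2 * ln 2) \<le> 2 * N (2 * R)"
proof -
  note wa = zorder_le_w[OF a]
  have "divisor_sum (fn a) R (\<lambda>_. 2 * ln 2) \<le>
        (\<Sum>j | norm j \<le> R \<and> zorder (fn a) j \<noteq> 0. 2 * (w j * ln (2 * R / norm1 j)))"
    unfolding divisor_sum_def
  proof (rule sum_mono)
    fix j assume "j \<in> {j. norm j \<le> R \<and> zorder (fn a) j \<noteq> 0}"
    hence "norm1 j \<le> R" using R by (auto simp: norm1_def)
    hence "2 \<le> 2 * R / norm1 j" by (simp add: pos_le_divide_eq)
    hence "ln 2 \<le> ln (2 * R / norm1 j)" by (subst ln_le_cancel_iff) auto
    hence "\<bar>of_int (zorder (fn a) j)\<bar> * ln 2 \<le> w j * ln (2 * R / norm1 j)"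
      using wa w_nonneg by (intro mult_mono) auto
    thus "\<bar>of_int (zorder (fn a) j)\<bar> * (2 * ln 2) \<le> 2 * (w j * ln (2 * R / norm1 j))" by simp
  qed
  also have "\<dots> \<le> (\<Sum>j | norm j \<le> 2 * R \<and> w j \<noteq> 0. 2 * (w j * ln (2 * R / norm1 j)))"
  proof (rule sum_mono2)
    show "finite {j. norm j \<le> 2 * R \<and> w j \<noteq> 0}" by (rule locally_finite_weightD[OF w_lf])
    show "{j. norm j \<le> R \<and> zorder (fn a) j \<noteq> 0} \<subseteq> {j. norm j \<le> 2 * R \<and> w j \<noteq> 0}"
      using R by (intro zorder_support_subset a) auto
    fix j assume "j \<in> {j. norm j \<le> 2 * R \<and> w j \<noteq> 0} - {j. norm j \<le> R \<and> zorder (fn a) j \<noteq> 0}"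
    thus "0 \<le> 2 * (w j * ln (2 * R / norm1 j))"
      using weight_N_kernel_nonneg[of j "2 * R"] R w_nonneg[of j] by simp
  qed
  also have "\<dots> = 2 * N (2 * R)"
    by (simp add: N_def weight_N_def sum_distrib_left)
  finally show ?thesis .
qed

definition remainder :: "complex \<Rightarrow> real \<Rightarrow> real" where
  "remainder a R = nevanlinna_m R (fn a) + nevanlinna_m R (\<lambda>z. 1 / fn a z) + divisor_sum (fn a) R (\<lambda>_. 2 * ln 2)"

text \<open>The exponent 1/2 stands for any exponent in \<open>(0, 1)\<close>: the remainder is
  going to be multiplied by \<open>r / R\<close>. The constants are uniform in
  \<open>a\<close>.\<close>

lemma remainder_small:
  obtains M R1 where "M \<ge> 0" "R1 \<ge> 1"
    "\<And>a R. a \<in> A \<Longrightarrow> good R \<Longrightarrow> R \<ge> R1 \<Longrightarrow>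
      remainder a R \<le> M * R powr (1/2)"
proof -
  obtain R1 where R1: "R1 \<ge> 1" "\<And>r. r \<ge> R1 \<Longrightarrow> T r \<le> r powr (1/2)" using T_small[of "1/2"] by auto
  obtain C where C: "C \<ge> 0" "\<And>t. t \<ge> 1 \<Longrightarrow> N t \<le> C * t powr (1/2)" using N_small[of "1/2"] by auto
  show ?thesis
  proof (rule that[of "2 + 2 * K + 2 * (C * 2 powr (1/2))" R1])
    show "2 + 2 * K + 2 * (C * 2 powr (1/2)) \<ge> 0" using K_nonneg C by simp
    fix a R assume a: "a \<in> A" and good: "good R" and R: "R \<ge> R1"
    have R0: "R \<ge> 1" using R R1 by simp
    have one: "1 \<le> R powr (1/2)" using R0 by (intro ge_one_powr_ge_zero) auto
    have "nevanlinna_m R (fn a) \<le> nevanlinna_T R (fn a)" "nevanlinna_m R (\<lambda>z. 1 / fn a z) \<le> nevanlinna_T R (\<lambda>z. 1 / fn a z)"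
      using nevanlinna_N_nonneg[OF mero_nz_fn R0] nevanlinna_N_nonneg[OF mero_nz_fn_inv R0] by (simp_all add: nevanlinna_T_def)
    hence "nevanlinna_m R (fn a) + nevanlinna_m R (\<lambda>z. 1 / fn a z) \<le> 2 * T R + 2 * K"
      using T_fn_inv_bounds[OF a good] R0 by fastforce
    also have "\<dots> \<le> 2 * R powr (1/2) + 2 * (K * R powr (1/2))"
      using R1(2)[OF R] mult_left_mono[OF one K_nonneg] by simp
    finally have 1: "nevanlinna_m R (fn a) + nevanlinna_m R (\<lambda>z. 1 / fn a z) \<le> 2 * R powr (1/2) + 2 * (K * R powr (1/2))" .
    have "divisor_sum (fn a) R (\<lambda>_. 2 * ln 2) \<le> 2 * (C * (2 * R) powr (1/2))"
      using divisor_sum_le[OF a R0] C(2)[of "2 * R"] R0 by simp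
    also have "(2 * R) powr (1/2) = 2 powr (1/2) * R powr (1/2)" using R0 by (simp add: powr_mult)
    finally show "remainder a R
       \<le> (2 + 2 * K + 2 * (C * 2 powr (1/2))) * R powr (1/2)"
      using 1 by (simp add: remainder_def algebra_simps)
  qed fact
qed

abbreviation "Kq \<equiv> shift_bound q"

lemma Kq_nonneg: "Kq \<ge> 0"
  using shift_bound_ge_4[of q] by simp

text \<open>The third condition maps the circle into the disc it bounds; the last one makes the
  denominator of the Hahn quotient at least 1 in modulus on the circle.\<close>

definition admissible :: "real \<Rightarrow> bool" where
  "admissible r \<longleftrightarrow> good r \<and> r \<ge> 1 \<and> norm q * r + norm c \<le> r \<and> norm (q - 1) * r \<ge> norm c + 1"

lemma mean_log_shift_le:
  assumes a: "a \<in> A" and good: "good r" and r: "r \<ge> 1" "norm q * r + norm c \<le> r"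
    and Q: "excess_le N r Q"
  shows "circle_mean r (\<lambda>z. \<bar>ln (norm (fn a (q * z + c) / fn a z))\<bar>) \<le> Kq * Q"
proof -
  obtain M R1 where M: "M \<ge> 0" "R1 \<ge> 1" "\<And>R. good R \<Longrightarrow> R \<ge> R1 \<Longrightarrow>
      remainder a R \<le> M * R powr (1/2)"
    using remainder_small a by metis
  note wa = zorder_le_w[OF a]
  have rk: "root_kernel r j \<ge> 0" for j using r by (simp add: root_kernel_def)
  have ds: "divisor_sum (fn a) R (root_kernel r) \<le> Q" for R
  proof -
    have "divisor_sum (fn a) R (root_kernel r) \<le> (\<Sum>j | norm j \<le> R \<and> zorder (fn a) j \<noteq> 0. w j * root_kernel r j)"
      unfolding divisor_sum_def using wa rk by (intro sum_mono mult_right_mono) auto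
    also have "\<dots> \<le> (\<Sum>j | norm j \<le> R \<and> w j \<noteq> 0. w j * root_kernel r j)"
    proof (rule sum_mono2)
      show "finite {j. norm j \<le> R \<and> w j \<noteq> 0}" by (rule locally_finite_weightD[OF w_lf])
      show "{j. norm j \<le> R \<and> zorder (fn a) j \<noteq> 0} \<subseteq> {j. norm j \<le> R \<and> w j \<noteq> 0}"
        by (intro zorder_support_subset a order.refl)
    qed (use rk w_nonneg in auto)
    also have "\<dots> \<le> Q"
      using Q unfolding N_def by (intro sum_root_kernel_le w_lf w_nonneg r)
    finally show ?thesis .
  qed
  show ?thesis
  proof (rule field_le_epsilon)
    fix e :: real assume e: "e > 0"
    \<comment> \<open>\<open>R\<close> runs to infinity through good radii with \<open>r\<close>
      fixed; the divisor part is bounded by \<open>Kq * Q\<close> uniformly in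
      \<open>R\<close>.\<close>
    have "((\<lambda>R. 16 * r * M * R powr (-(1/2))) \<longlongrightarrow> 16 * r * M * 0) at_top"
      by (intro tendsto_intros tendsto_neg_powr filterlim_ident) auto
    hence "\<forall>\<^sub>F R in at_top. 16 * r * M * R powr (-(1/2)) < e"
      by (rule order_tendstoD) (use e in auto)
    then obtain R2 where R2: "\<And>R. R \<ge> R2 \<Longrightarrow> 16 * r * M * R powr (-(1/2)) < e"
      by (auto simp: eventually_at_top_linorder)
    define R3 where "R3 = Max {R1, R2, 2 * r}"
    have R3: "R3 \<ge> R1" "R3 \<ge> R2" "R3 \<ge> 2 * r" by (auto simp: R3_def)
    obtain R where R: "R3 < R" "good R"
      using ex_not_in_countable[OF countable_not_good, of R3 "R3 + 1"] by auto
    have R0: "R > 0" using R R3 r by linarith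
    have "circle_mean r (\<lambda>z. \<bar>ln (norm (fn a (q * z + c) / fn a z))\<bar>) \<le>
       16 * r / R * (remainder a R) +
       Kq * divisor_sum (fn a) R (root_kernel r)"
      unfolding remainder_def using good R a q r R3
      by (intro mean_log_shift_le_remainder mero_nz_fn) (auto simp: good_def)
    also have "\<dots> \<le> 16 * r / R * (M * R powr (1/2)) + Kq * Q"
      using R R3 R0 r by (intro add_mono mult_left_mono M ds Kq_nonneg) auto
    also have "16 * r / R * (M * R powr (1/2)) = 16 * r * M * R powr (-(1/2))"
    proof -
      have "R powr (1/2) / R = R powr (1/2) / R powr 1" using R0 by simp
      also have "\<dots> = R powr (-(1/2))" by (subst powr_diff[symmetric]) simp
      finally have "R powr (1/2) / R = R powr (-(1/2))" .
      moreover have "16 * r / R * (M * R powr (1/2)) = 16 * r * M * (R powr (1/2) / R)" by simp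
      ultimately show ?thesis by (simp only:)
    qed
    also have "\<dots> < e" using R R3 by (intro R2) auto
    finally show "circle_mean r (\<lambda>z. \<bar>ln (norm (fn a (q * z + c) / fn a z))\<bar>) \<le> Kq * Q + e" by simp
  qed
qed

text \<open>Subtracting \<open>a\<close> from \<open>g\<close> does not change \<open>D\<close>.
  Hence \<open>D / (g - a)\<close> is \<open>X - 1\<close> over the Hahn denominator, where
  \<open>X\<close> is the quotient of the shifted and the unshifted \<open>g - a\<close>;
  \<open>ln 2\<close> pays for the summand 1.\<close>

lemma nevanlinna_m_hahn_quotient_le:
  assumes a: "a \<in> A" and adm: "admissible r" and Q: "excess_le N r Q"
  shows "circle_mean r (\<lambda>z. log_plus (norm (D z / fn a z))) \<le> Kq * Q + ln 2"
    "continuous_on (sphere 0 r) (\<lambda>z. log_plus (norm (D z / fn a z)))"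
proof -
  have good: "good r" and r: "r \<ge> 1" "norm q * r + norm c \<le> r" "norm (q - 1) * r \<ge> norm c + 1"
    using adm by (auto simp: admissible_def)
  have reg: "regular_circle (fn a) r" "regular_circle D r" "\<And>z. norm z = r \<Longrightarrow> regular_pt (fn a) (q * z + c)"
    using good a by (auto simp: good_def)
  have nz: "fn a z \<noteq> 0" if "norm z = r" for z using regular_circle_nonzero[OF reg(1) that] .
  have nzs: "fn a (q * z + c) \<noteq> 0" if "norm z = r" for z using reg(3)[OF that] by (simp add: regular_pt_def)
  show cont: "continuous_on (sphere 0 r) (\<lambda>z. log_plus (norm (D z / fn a z)))"
    using nz by (intro continuous_intros regular_circle_continuous reg) auto
  note contf = continuous_on_regular_image[OF reg(3)]
  have contl: "continuous_on (sphere 0 r) (\<lambda>z. \<bar>ln (norm (fn a (q * z + c) / fn a z))\<bar>)"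
    using nz nzs by (intro continuous_on_rabs continuous_on_ln continuous_on_norm continuous_on_divide contf
      regular_circle_continuous[OF reg(1)]) auto
  have "circle_mean r (\<lambda>z. log_plus (norm (D z / fn a z))) \<le>
        circle_mean r (\<lambda>z. \<bar>ln (norm (fn a (q * z + c) / fn a z))\<bar> + ln 2)"
  proof (intro circle_mean_mono cont continuous_on_add contl continuous_on_const)
    fix z :: complex assume z: "norm z = r"
    define X where "X = fn a (q * z + c) / fn a z"
    have den: "norm ((q - 1) * z + c) \<ge> 1"
      using norm_triangle_ineq4[of "(q - 1) * z + c" c] r z by (simp add: norm_mult)
    have "D z / fn a z = (X - 1) / ((q - 1) * z + c)"
      using nz[OF z] by (simp add: hahn_diff_def X_def diff_divide_distrib[symmetric] divide_simps)
    hence "norm (D z / fn a z) = norm (X - 1) / norm ((q - 1) * z + c)" by (simp add: norm_divide)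
    also have "\<dots> \<le> norm (X - 1) / 1" using den by (intro divide_left_mono) auto
    also have "\<dots> \<le> norm X + 1" using norm_triangle_ineq4[of X 1] by simp
    finally have "log_plus (norm (D z / fn a z)) \<le> log_plus (norm X + 1)" by (rule log_plus_mono)
    also have "\<dots> \<le> log_plus (norm X) + log_plus 1 + ln 2" by (intro log_plus_add_le) auto
    also have "log_plus 1 = 0" by (simp add: log_plus_def)
    also have "log_plus (norm X) \<le> \<bar>ln (norm X)\<bar>"
      using nz[OF z] nzs[OF z] by (intro log_plus_le_abs_ln) (auto simp: X_def)
    finally show "log_plus (norm (D z / fn a z)) \<le> \<bar>ln (norm (fn a (q * z + c) / fn a z))\<bar> + ln 2"
      by (simp add: X_def)
  qed (use r in auto)
  also have "\<dots> = circle_mean r (\<lambda>z. \<bar>ln (norm (fn a (q * z + c) / fn a z))\<bar>) + ln 2"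
    using r contl by (subst circle_mean_add) auto
  also have "\<dots> \<le> Kq * Q + ln 2"
    using mean_log_shift_le[OF a good r(1,2) Q] by simp
  finally show "circle_mean r (\<lambda>z. log_plus (norm (D z / fn a z))) \<le> Kq * Q + ln 2" .
qed

text \<open>The targets are first transferred from \<open>T\<close> to the proximity functions of
  \<open>1 / (g - a)\<close>, these to that of \<open>1 / D\<close>, and this one to
  \<open>D\<close> by the first main theorem. The right-hand side keeps
  \<open>nevanlinna_m r g\<close> instead of \<open>T r\<close>, because its pole part is needed
  when infinity is among the targets.\<close>

lemma second_main_inequality:
  assumes A': "A' \<subseteq> A" "A' \<noteq> {}"
  obtains C1 C2 where "C1 \<ge> 0" "C2 \<ge> 0"
    "\<And>r Q. admissible r \<Longrightarrow> excess_le N r Q \<Longrightarrow> Q \<ge> 0 \<Longrightarrow>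
      real (card A') * T r \<le> (\<Sum>a\<in>A'. nevanlinna_N r (\<lambda>z. 1 / fn a z)) + nevanlinna_m r g
        + nevanlinna_N r D - nevanlinna_N r (\<lambda>z. 1 / D z) + (C1 * Q + C2)"
proof -
  have finA': "finite A'" using A A' finite_subset by auto
  obtain b where b: "b \<in> A'" using A' by blast
  obtain C where C: "C \<ge> 0" "\<And>w d. w \<notin> A' \<Longrightarrow> d \<noteq> 0 \<Longrightarrow> (\<Sum>a\<in>A'. log_plus (norm (1 / (w - a)))) \<le>
       C + ((\<Sum>a\<in>A'. log_plus (norm (d / (w - a)))) + log_plus (norm (1 / d)))"
    using sum_log_plus_inverse_dist_le[OF finA'] by blast
  define n where "n = real (card A')"
  define E where "E = \<bar>ln (norm (zor_poly D 0 0))\<bar>"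
  show ?thesis
  proof (rule that[of "(n + 1) * Kq" "C + (n + 1) * ln 2 + E + K + n * K"])
    show "0 \<le> (n + 1) * Kq" using Kq_nonneg by (simp add: n_def)
    show "0 \<le> C + (n + 1) * ln 2 + E + K + n * K" using C K_nonneg by (simp add: n_def E_def)
    fix r Q assume adm: "admissible r" and Q: "excess_le N r Q" and Q0: "Q \<ge> 0"
    have good: "good r" and r: "r \<ge> 1" using adm by (auto simp: admissible_def)
    have reg: "regular_circle (fn a) r" if "a \<in> A'" for a using good that A' by (auto simp: good_def)
    have regD: "regular_circle D r" using good by (auto simp: good_def)
    have quot: "circle_mean r (\<lambda>z. log_plus (norm (D z / fn a z))) \<le> Kq * Q + ln 2"
      "continuous_on (sphere 0 r) (\<lambda>z. log_plus (norm (D z / fn a z)))" if "a \<in> A'" for a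
      using nevanlinna_m_hahn_quotient_le[OF _ adm Q] that A' by auto
    note cD = continuous_log_plus_norm[OF regD]
    have cq: "continuous_on (sphere 0 r) (\<lambda>z. \<Sum>a\<in>A'. log_plus (norm (D z / fn a z)))"
      by (intro continuous_on_sum quot)
    have "(\<Sum>a\<in>A'. nevanlinna_m r (\<lambda>z. 1 / fn a z)) = circle_mean r (\<lambda>z. \<Sum>a\<in>A'. log_plus (norm (1 / fn a z)))"
      unfolding nevanlinna_m_eq_circle_mean using r finA' continuous_log_plus_norm[OF reg]
      by (intro circle_mean_sum[symmetric]) auto
    also have "\<dots> \<le> circle_mean r (\<lambda>z. C + ((\<Sum>a\<in>A'. log_plus (norm (D z / fn a z))) + log_plus (norm (1 / D z))))"
    proof (intro circle_mean_mono continuous_on_add continuous_on_const cq cD)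
      show "continuous_on (sphere 0 r) (\<lambda>z. \<Sum>a\<in>A'. log_plus (norm (1 / fn a z)))"
        by (intro continuous_on_sum continuous_log_plus_norm(2)[OF reg])
      fix z :: complex assume z: "norm z = r"
      show "(\<Sum>a\<in>A'. log_plus (norm (1 / fn a z))) \<le> C + ((\<Sum>a\<in>A'. log_plus (norm (D z / fn a z))) + log_plus (norm (1 / D z)))"
        using regular_circle_nonzero[OF reg z] regular_circle_nonzero[OF regD z] by (intro C(2)) auto
    qed (use r in auto)
    also have "\<dots> = C + ((\<Sum>a\<in>A'. circle_mean r (\<lambda>z. log_plus (norm (D z / fn a z)))) + nevanlinna_m r (\<lambda>z. 1 / D z))"
    proof -
      have r0: "r \<ge> 0" using r by simp
      have "circle_mean r (\<lambda>z. C + ((\<Sum>a\<in>A'. log_plus (norm (D z / fn a z))) + log_plus (norm (1 / D z)))) =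
        circle_mean r (\<lambda>z. C) + circle_mean r (\<lambda>z. (\<Sum>a\<in>A'. log_plus (norm (D z / fn a z))) + log_plus (norm (1 / D z)))"
        by (intro circle_mean_add continuous_on_const continuous_on_add cq cD r0)
      also have "circle_mean r (\<lambda>z. (\<Sum>a\<in>A'. log_plus (norm (D z / fn a z))) + log_plus (norm (1 / D z))) =
        circle_mean r (\<lambda>z. \<Sum>a\<in>A'. log_plus (norm (D z / fn a z))) + circle_mean r (\<lambda>z. log_plus (norm (1 / D z)))"
        by (intro circle_mean_add cq cD r0)
      also have "circle_mean r (\<lambda>z. \<Sum>a\<in>A'. log_plus (norm (D z / fn a z))) = (\<Sum>a\<in>A'. circle_mean r (\<lambda>z. log_plus (norm (D z / fn a z))))"
        by (intro circle_mean_sum quot r0 finA')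
      finally show ?thesis by (simp add: nevanlinna_m_eq_circle_mean)
    qed
    also have "\<dots> \<le> C + (n * (Kq * Q + ln 2) + nevanlinna_m r (\<lambda>z. 1 / D z))"
      using sum_mono[OF quot(1), of A' "\<lambda>a. a"] by (simp add: n_def)
    finally have 1: "(\<Sum>a\<in>A'. nevanlinna_m r (\<lambda>z. 1 / fn a z)) \<le> C + (n * (Kq * Q + ln 2) + nevanlinna_m r (\<lambda>z. 1 / D z))" .
    have 2: "nevanlinna_m r (\<lambda>z. 1 / D z) \<le> nevanlinna_m r D + nevanlinna_N r D - nevanlinna_N r (\<lambda>z. 1 / D z) + E"
      using first_main_theorem[OF mero_nz_D(1) regD] r by (simp add: nevanlinna_T_def E_def)
    \<comment> \<open>\<open>D\<close> is the product of \<open>D / (g - b)\<close> and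
      \<open>g - b\<close>; any target \<open>b\<close> serves, and the proximity function of
      \<open>g\<close> is paid only once.\<close>
    have 3: "nevanlinna_m r D \<le> Kq * Q + ln 2 + nevanlinna_m r (fn b)"
    proof -
      have "nevanlinna_m r D \<le> circle_mean r (\<lambda>z. log_plus (norm (D z / fn b z)) + log_plus (norm (fn b z)))"
        unfolding nevanlinna_m_eq_circle_mean
      proof (intro circle_mean_mono cD continuous_on_add quot b continuous_log_plus_norm[OF reg])
        fix z :: complex assume z: "norm z = r"
        show "log_plus (norm (D z)) \<le> log_plus (norm (D z / fn b z)) + log_plus (norm (fn b z))"
          using log_plus_mult_le[of "norm (D z / fn b z)" "norm (fn b z)"] regular_circle_nonzero[OF reg[OF b] z]
          by (simp add: norm_divide)
      qed (use r in auto)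
      also have "\<dots> = circle_mean r (\<lambda>z. log_plus (norm (D z / fn b z))) + nevanlinna_m r (fn b)"
        unfolding nevanlinna_m_eq_circle_mean using r
        by (intro circle_mean_add quot b continuous_log_plus_norm[OF reg]) auto
      finally show ?thesis using quot(1)[OF b] by simp
    qed
    have 4: "nevanlinna_m r (fn b) \<le> nevanlinna_m r g + K"
      using nevanlinna_m_diff_const_le(1)[OF good_continuous[OF good], of b] le_K[of b] b A' r by auto
    have "n * T r = (\<Sum>a\<in>A'. T r)" by (simp add: n_def)
    also have "\<dots> \<le> (\<Sum>a\<in>A'. nevanlinna_m r (\<lambda>z. 1 / fn a z) + nevanlinna_N r (\<lambda>z. 1 / fn a z) + K)"
      using T_fn_inv_bounds(2)[OF _ good] A' r unfolding nevanlinna_T_def by (intro sum_mono) auto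
    also have "\<dots> = (\<Sum>a\<in>A'. nevanlinna_m r (\<lambda>z. 1 / fn a z)) + (\<Sum>a\<in>A'. nevanlinna_N r (\<lambda>z. 1 / fn a z)) + n * K"
      by (simp add: sum.distrib n_def)
    finally have "n * T r \<le> (\<Sum>a\<in>A'. nevanlinna_m r (\<lambda>z. 1 / fn a z)) + (\<Sum>a\<in>A'. nevanlinna_N r (\<lambda>z. 1 / fn a z)) + n * K" .
    with 1 2 3 4 show "real (card A') * T r \<le> (\<Sum>a\<in>A'. nevanlinna_N r (\<lambda>z. 1 / fn a z)) + nevanlinna_m r g
        + nevanlinna_N r D - nevanlinna_N r (\<lambda>z. 1 / D z) + ((n + 1) * Kq * Q + (C + (n + 1) * ln 2 + E + K + n * K))"
      unfolding n_def[symmetric] by (simp add: algebra_simps)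
  qed
qed

text \<open>A single point where the value \<open>g z0\<close> is attained already contributes
  \<open>ln r\<close> to a counting function. This is what turns bounded errors into
  \<open>o(T)\<close>.\<close>

lemma T_lower:
  assumes z0: "\<not> is_pole g z0" "g z0 \<in> A"
  obtains C where "\<And>r. good r \<Longrightarrow> r \<ge> 1 \<Longrightarrow> r \<ge> norm z0 \<Longrightarrow> T r \<ge> ln r - C"
proof (rule that[of "\<bar>ln (norm1 z0)\<bar> + K"])
  fix r :: real assume r: "good r" "r \<ge> 1" "r \<ge> norm z0"
  define f where "f = fn (g z0)"
  have "g analytic_on {z0}" using nicely_meromorphic_on_imp_analytic_at[OF nice] z0 by auto
  hence an: "f analytic_on {z0}" unfolding f_def by (intro analytic_intros)
  have pos: "zorder f z0 > 0"
    using zorder_pos_iff'[OF an] mero_nzD(5)[OF mero_nz_fn] by (simp add: f_def)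
  define v where "v = pole_weight (\<lambda>z. 1 / fn (g z0) z)"
  have v: "v z0 \<ge> 1" "\<And>z. v z \<ge> 0" using pos by (auto simp: v_def pole_weight_inverse[OF mero_nz_fn] f_def)
  define k where "k = (\<lambda>z::complex. ln (r / norm1 z))"
  have k: "k z \<ge> 0" if "norm z \<le> r" for z
    unfolding k_def using weight_N_kernel_nonneg[OF that r(2)] .
  have "ln r - \<bar>ln (norm1 z0)\<bar> \<le> 1 * k z0"
    using r by (simp add: k_def ln_div)
  also have "\<dots> \<le> v z0 * k z0" using v k[of z0] r by (intro mult_right_mono) auto
  also have "\<dots> \<le> (\<Sum>z | norm z \<le> r \<and> v z \<noteq> 0. v z * k z)"
    using r v k by (intro member_le_sum[of z0 _ "\<lambda>z. v z * k z"] locally_finite_weightD)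
      (auto simp: v_def intro: locally_finite_pole_weight mero_nz_fn_inv)
  also have "\<dots> = nevanlinna_N r (\<lambda>z. 1 / fn (g z0) z)"
    using r by (simp add: nevanlinna_N_eq_weight_N[OF mero_nz_fn_inv] weight_N_def v_def k_def)
  also have "\<dots> \<le> nevanlinna_T r (\<lambda>z. 1 / fn (g z0) z)"
    using nevanlinna_m_nonneg[of r] r by (simp add: nevanlinna_T_def)
  also have "\<dots> \<le> T r + K" using r z0 by (intro T_fn_inv_bounds) auto
  finally show "T r \<ge> ln r - (\<bar>ln (norm1 z0)\<bar> + K)" by simp
qed

end

subsection \<open>Comparison of multiplicities\<close>

definition a_point_weight :: "(complex \<Rightarrow> complex) \<Rightarrow> ecomplex \<Rightarrow> complex \<Rightarrow> real" where
  "a_point_weight g a = (case a of Some b \<Rightarrow> pole_weight (\<lambda>z. 1 / (g z - b)) | None \<Rightarrow> pole_weight g)"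

definition hat_weight :: "complex \<Rightarrow> complex \<Rightarrow> (complex \<Rightarrow> complex) \<Rightarrow> ecomplex \<Rightarrow> complex \<Rightarrow> nat" where
  "hat_weight q c g a z = (case a of
     Some b \<Rightarrow> if \<not> is_pole g z \<and> g z = b then
       zero_mult (\<lambda>w. g w - b) z - min (zero_mult (\<lambda>w. g w - b) z) (zero_mult (hahn_diff q c g) z) else 0
   | None \<Rightarrow> if is_pole g z then
       pole_mult g z - min (pole_mult g z) (zero_mult (hahn_diff q c (\<lambda>w. 1 / g w)) z) else 0)"

context
  fixes g :: "complex \<Rightarrow> complex"
  assumes nice: "g nicely_meromorphic_on UNIV" and nonconst: "\<not> g constant_on UNIV"
begin

lemma mero_nz_a_points: "mero_nz (\<lambda>z. g z - b)" "mero_nz g" "mero_nz (\<lambda>z. 1 / (g z - b))"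
  using mero_nz_diff_const[OF nice nonconst] mero_nz_diff_const[OF nice nonconst, of 0]
    mero_nz_inverse[OF mero_nz_diff_const[OF nice nonconst]]
  by (simp_all add: divide_inverse)

lemma locally_finite_a_point_weight: "locally_finite_weight (a_point_weight g a)"
  by (cases a) (auto simp: a_point_weight_def intro: locally_finite_pole_weight mero_nz_a_points)

lemma nevanlinna_N_at_eq:
  assumes "r > 0"
  shows "nevanlinna_N_at r g a = weight_N (a_point_weight g a) r"
  using assms by (cases a) (auto simp: nevanlinna_N_at_def a_point_weight_def
      nevanlinna_N_eq_weight_N[OF mero_nz_a_points(2)] nevanlinna_N_eq_weight_N[OF mero_nz_a_points(3)])

lemma finite_hat_support:
  "finite {z. norm z \<le> r \<and> \<not> is_pole g z \<and> g z = b}" "finite {z. norm z \<le> r \<and> is_pole g z}"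
proof -
  show "finite {z. norm z \<le> r \<and> \<not> is_pole g z \<and> g z = b}"
    by (rule finite_subset[OF _ finite_not_regular[OF mero_nz_a_points(1)[of b], of r]]) (auto simp: regular_pt_def)
  show "finite {z. norm z \<le> r \<and> is_pole g z}"
    by (rule finite_subset[OF _ finite_zorder_nonzero[OF mero_nz_a_points(2), of r]])
       (auto simp: is_pole_iff_zorder[OF mero_nz_a_points(2)])
qed

lemma finite_hat_weight: "finite {z. norm z \<le> r \<and> hat_weight q c g a z \<noteq> 0}"
proof (cases a)
  case None
  show ?thesis
    by (rule finite_subset[OF _ finite_hat_support(2)[of r]]) (auto simp: None hat_weight_def split: if_splits)
next
  case (Some b)
  show ?thesis
    by (rule finite_subset[OF _ finite_hat_support(1)[of r b]]) (auto simp: Some hat_weight_def split: if_splits)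
qed

lemma hat_N_eq:
  assumes r: "r > 0"
  shows "hat_N q c r g a = weight_N (\<lambda>z. real (hat_weight q c g a z)) r"
  unfolding hat_N_def
proof (rule integrated_count_eq_weight_N[OF finite_hat_weight r])
  fix t
  show "hat_count q c g a t = (\<Sum>z | norm z \<le> t \<and> hat_weight q c g a z \<noteq> 0. hat_weight q c g a z)"
  proof (cases a)
    case None
    have "hat_count q c g a t = (\<Sum>z | norm z \<le> t \<and> is_pole g z. hat_weight q c g a z)"
      unfolding hat_count_def None by (auto simp: hat_weight_def Let_def intro!: sum.cong)
    also have "\<dots> = (\<Sum>z | norm z \<le> t \<and> hat_weight q c g a z \<noteq> 0. hat_weight q c g a z)"
      by (intro sum.mono_neutral_right finite_hat_support) (auto simp: None hat_weight_def split: if_splits)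
    finally show ?thesis .
  next
    case (Some b)
    have "hat_count q c g a t = (\<Sum>z | norm z \<le> t \<and> \<not> is_pole g z \<and> g z = b. hat_weight q c g a z)"
      unfolding hat_count_def Some by (auto simp: hat_weight_def Let_def intro!: sum.cong)
    also have "\<dots> = (\<Sum>z | norm z \<le> t \<and> hat_weight q c g a z \<noteq> 0. hat_weight q c g a z)"
      by (intro sum.mono_neutral_right finite_hat_support) (auto simp: Some hat_weight_def split: if_splits)
    finally show ?thesis .
  qed
qed

lemma locally_finite_hat_weight: "locally_finite_weight (\<lambda>z. real (hat_weight q c g a z))"
  unfolding locally_finite_weight_def using finite_hat_weight by simp

text \<open>At the target that \<open>g\<close> takes at \<open>z\<close>, the two weights differ by
  \<open>min n m'\<close>, which the balance dominates. At every other target both weights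
  vanish.\<close>

lemma a_point_weight_diff_le:
  fixes q c z :: complex
  assumes q: "0 < norm q" "norm q < 1"
  defines "b \<equiv> order_balance q c g z"
  shows "a_point_weight g a z - real (hat_weight q c g a z) \<le>
           (if a = (if is_pole g z then None else Some (g z)) then b else 0)"
proof -
  note bal = multiplicity_balance[OF nice nonconst q, of z c, folded b_def]
  note pole_iff = is_pole_iff_zorder[OF mero_nz_a_points(2)]
  show ?thesis
  proof (cases a)
    case None
    show ?thesis
    proof (cases "is_pole g z")
      case True
      thus ?thesis using bal(3)[OF True]
        by (simp add: None a_point_weight_def hat_weight_def pole_weight_def of_nat_diff)
    next
      case False
      thus ?thesis using pole_iff[of z] by (simp add: None a_point_weight_def hat_weight_def pole_weight_zorder)
    qed
  next
    case (Some d)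
    have aw: "a_point_weight g a z = real (zero_mult (\<lambda>w. g w - d) z)"
      by (auto simp: Some a_point_weight_def pole_weight_inverse[OF mero_nz_a_points(1)] zero_mult_def)
    show ?thesis
    proof (cases "is_pole g z")
      case True
      have "pole_weight (\<lambda>w. g w - d) z = pole_weight g z"
        using pole_weight_diff_const[OF mero_nz_a_points(2,1)] by simp
      hence "zorder (\<lambda>w. g w - d) z < 0"
        using True pole_iff[of z] by (simp add: pole_weight_zorder max_def split: if_splits)
      thus ?thesis using True aw by (simp add: Some hat_weight_def zero_mult_def)
    next
      case np: False
      have "g analytic_on {z}" using nicely_meromorphic_on_imp_analytic_at[OF nice] np by auto
      hence an: "(\<lambda>w. g w - d) analytic_on {z}" by (intro analytic_intros)
      show ?thesis
      proof (cases "g z = d")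
        case True
        thus ?thesis using np bal(2)[OF np] aw by (simp add: Some hat_weight_def of_nat_diff)
      next
        case False
        hence "zorder (\<lambda>w. g w - d) z = 0" using an by (intro zorder_eq_0I) auto
        thus ?thesis using False np aw by (simp add: Some hat_weight_def zero_mult_def)
      qed
    qed
  qed
qed

text \<open>The targets are distinct, so at most one of them is the value at \<open>z\<close> and
  the balance is charged at most once.\<close>

lemma sum_a_point_weight_le:
  fixes q c z :: complex and a :: "'i \<Rightarrow> ecomplex"
  assumes q: "0 < norm q" "norm q < 1" and I: "finite I" "inj_on a I"
  shows "(\<Sum>i\<in>I. a_point_weight g (a i) z) \<le> (\<Sum>i\<in>I. real (hat_weight q c g (a i) z)) +
     order_balance q c g z"
proof -
  define b where "b = order_balance q c g z"
  have b0: "b \<ge> 0" unfolding b_def by (rule multiplicity_balance(1)[OF nice nonconst q])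
  define y where "y = (if is_pole g z then None else Some (g z))"
  have "(\<Sum>i\<in>I. a_point_weight g (a i) z) - (\<Sum>i\<in>I. real (hat_weight q c g (a i) z)) \<le> (\<Sum>i\<in>I. if a i = y then b else 0)"
    unfolding sum_subtractf[symmetric] y_def b_def by (intro sum_mono a_point_weight_diff_le q)
  also have "\<dots> = (\<Sum>x\<in>a ` I. if x = y then b else 0)"
    by (subst sum.reindex[OF I(2)]) simp
  also have "\<dots> \<le> b" using b0 I by simp
  finally show ?thesis by (simp add: b_def)
qed

text \<open>Summing the balance yields \<open>N(r, g) + N(r, 1/D) - N(r, D)\<close> plus the
  counting function of the poles of the shifted \<open>g\<close>. The last term is at most
  \<open>N(r, g) + C\<close>, which completes \<open>ramification_N\<close> up to a
  constant.\<close>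

lemma sum_nevanlinna_N_at_le:
  fixes q c :: complex and a :: "'i \<Rightarrow> ecomplex"
  assumes q: "0 < norm q" "norm q < 1" and I: "finite I" "inj_on a I"
  obtains C r0 where "\<And>r. r \<ge> r0 \<Longrightarrow>
    (\<Sum>i\<in>I. nevanlinna_N_at r g (a i)) - ramification_N q c g r \<le> (\<Sum>i\<in>I. hat_N q c r g (a i)) + C"
proof -
  note D = mero_nz_hahn_diff(1)[OF nice nonconst q, of c]
  have q0: "q \<noteq> 0" using q by auto
  have lf_p: "locally_finite_weight (pole_weight g)" by (intro locally_finite_pole_weight mero_nz_a_points)
  have lf_D: "locally_finite_weight (\<lambda>z. of_int (zorder (hahn_diff q c g) z))" by (rule locally_finite_zorder[OF D])
  have lf_s: "locally_finite_weight (\<lambda>z. pole_weight g (q * z + c))"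
  proof -
    have "pole_weight (\<lambda>z. g (q * z + c)) = (\<lambda>z. pole_weight g (q * z + c))"
      by (simp add: fun_eq_iff pole_weight_zorder zorder_compose_affine[OF mero_nz_a_points(2) q0])
    thus ?thesis
      using locally_finite_pole_weight[OF mero_nz_compose_affine[OF mero_nz_a_points(2) q0, of c]] by simp
  qed
  have pw_nonneg: "pole_weight g z \<ge> 0" for z by (simp add: pole_weight_def)
  obtain C r1 where C: "\<And>r. r \<ge> r1 \<Longrightarrow> weight_N (\<lambda>z. pole_weight g (q * z + c)) r \<le> weight_N (pole_weight g) r + C"
    by (rule weight_N_compose_affine_le[OF lf_p pw_nonneg q, of c]) blast
  show ?thesis
  proof (rule that[of "max r1 1" C])
    fix r :: real assume r: "r \<ge> max r1 1"
    hence r0: "r > 0" by simp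
    have "(\<Sum>i\<in>I. nevanlinna_N_at r g (a i)) = weight_N (\<lambda>z. \<Sum>i\<in>I. a_point_weight g (a i) z) r"
      using r0 I by (simp add: nevanlinna_N_at_eq weight_N_sum locally_finite_a_point_weight)
    also have "\<dots> \<le> weight_N (\<lambda>z. (\<Sum>i\<in>I. real (hat_weight q c g (a i) z)) +
        order_balance q c g z) r"
      unfolding order_balance_def using r by (intro weight_N_mono locally_finite_weight_add locally_finite_weight_sum
        locally_finite_a_point_weight locally_finite_hat_weight lf_p lf_D lf_s sum_a_point_weight_le[unfolded order_balance_def] q I) auto
    also have "\<dots> = weight_N (\<lambda>z. \<Sum>i\<in>I. real (hat_weight q c g (a i) z)) r +
        (weight_N (pole_weight g) r + weight_N (\<lambda>z. of_int (zorder (hahn_diff q c g) z)) r + weight_N (\<lambda>z. pole_weight g (q * z + c)) r)"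
      unfolding order_balance_def
      by (subst weight_N_add weight_N_add,
          (intro locally_finite_weight_add locally_finite_weight_sum locally_finite_hat_weight lf_p lf_D lf_s)+)+ simp
    also have "weight_N (\<lambda>z. \<Sum>i\<in>I. real (hat_weight q c g (a i) z)) r = (\<Sum>i\<in>I. hat_N q c r g (a i))"
      using r0 I by (simp add: hat_N_eq weight_N_sum locally_finite_hat_weight)
    also have "weight_N (\<lambda>z. of_int (zorder (hahn_diff q c g) z)) r =
        nevanlinna_N r (\<lambda>z. 1 / hahn_diff q c g z) - nevanlinna_N r (hahn_diff q c g)"
      by (rule weight_N_zorder[OF D r0])
    also have "weight_N (pole_weight g) r = nevanlinna_N r g"
      using nevanlinna_N_eq_weight_N[OF mero_nz_a_points(2) r0] by simp
    finally show "(\<Sum>i\<in>I. nevanlinna_N_at r g (a i)) - ramification_N q c g r \<le> (\<Sum>i\<in>I. hat_N q c r g (a i)) + C"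
      using C[of r] r nevanlinna_N_eq_weight_N[OF mero_nz_a_points(2) r0] by (simp add: ramification_N_def)
  qed
qed

end

lemma sum_over_finite_points:
  fixes a :: "nat \<Rightarrow> 'b option" and F :: "'b option \<Rightarrow> real"
  assumes "finite I" "inj_on a I"
  defines "A \<equiv> {b. Some b \<in> a ` I}"
  shows "(\<Sum>i\<in>I. F (a i)) = (\<Sum>b\<in>A. F (Some b)) + (if None \<in> a ` I then F None else 0)"
    "card I = card A + (if None \<in> a ` I then 1 else 0)" "finite A"
proof -
  have fin: "finite (Some ` A)" by (rule finite_subset[of _ "a ` I"]) (use assms in auto)
  thus finA: "finite A" by (rule finite_imageD) auto
  have split: "a ` I = Some ` A \<union> (if None \<in> a ` I then {None} else {})"
  proof (intro equalityI subsetI)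
    fix x assume "x \<in> a ` I"
    thus "x \<in> Some ` A \<union> (if None \<in> a ` I then {None} else {})" by (cases x) (auto simp: A_def)
  qed (auto simp: A_def split: if_splits)
  have *: "(\<Sum>i\<in>I. G (a i)) = (\<Sum>b\<in>A. G (Some b)) + (if None \<in> a ` I then G None else 0)" 
    for G :: "'b option \<Rightarrow> real"
  proof -
    have "(\<Sum>i\<in>I. G (a i)) = sum G (a ` I)" by (simp add: sum.reindex[OF assms(2)])
    also have "\<dots> = sum G (Some ` A \<union> (if None \<in> a ` I then {None} else {}))" using split by simp
    also have "\<dots> = sum G (Some ` A) + sum G (if None \<in> a ` I then {None} else {})"
      using fin by (intro sum.union_disjoint) auto
    also have "sum G (Some ` A) = (\<Sum>b\<in>A. G (Some b))" by (subst sum.reindex) auto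
    finally show ?thesis by simp
  qed
  show "(\<Sum>i\<in>I. F (a i)) = (\<Sum>b\<in>A. F (Some b)) + (if None \<in> a ` I then F None else 0)" by (rule *)
  have "real (card I) = real (card A + (if None \<in> a ` I then 1 else 0))" using *[of "\<lambda>_. 1"] by simp
  thus "card I = card A + (if None \<in> a ` I then 1 else 0)" by (simp only: of_nat_eq_iff)
qed

theorem theorem5:
  fixes q c :: complex and g :: "complex \<Rightarrow> complex" and l :: nat and a :: "nat \<Rightarrow> ecomplex"
  assumes q: "0 < norm q" "norm q < 1"
    and meromorphic: "g nicely_meromorphic_on UNIV"
    and nonconstant: "\<not> g constant_on UNIV"
    and zero_order: "meromorphic_order g = 0"
    and l: "l > 2"
    and distinct_points: "inj_on a {1..l}"
  shows "\<exists>E1. has_log_density_1 E1 \<and>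
    (\<exists>S1 S2 :: real \<Rightarrow> real.
       S1 \<in> o[inf at_top (principal E1)](\<lambda>r. nevanlinna_T r g) \<and>
       S2 \<in> o[inf at_top (principal E1)](\<lambda>r. nevanlinna_T r g) \<and>
       (\<forall>r\<in>E1.
          (real l - 2) * nevanlinna_T r g
            \<le> (\<Sum>i=1..l. nevanlinna_N_at r g (a i)) - ramification_N q c g r + S1 r \<and>
          (\<Sum>i=1..l. nevanlinna_N_at r g (a i)) - ramification_N q c g r + S1 r
            \<le> (\<Sum>i=1..l. hat_N q c r g (a i)) + S2 r))"
proof -
  define A' where "A' = {b. Some b \<in> a ` {1..l}}"
  note fin_pts = sum_over_finite_points[OF finite_atLeastAtMost distinct_points, folded A'_def]
  have "\<forall>\<^sub>F w in at 0. \<not> is_pole g w"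
  proof -
    have "\<forall>\<^sub>\<approx>z\<in>UNIV. \<not> is_pole g z"
      using meromorphic by (intro meromorphic_on_imp_not_pole_cosparse) (simp add: nicely_meromorphic_on_def)
    thus ?thesis by (rule eventually_cosparse_imp_eventually_at) auto
  qed
  then obtain z0 where z0: "\<not> is_pole g z0" using eventually_happens by (metis at_neq_bot)
  \<comment> \<open>The adjoined value \<open>g z0\<close> only serves the lower bound for
    \<open>T\<close>; the second main inequality is applied to \<open>A'\<close> alone.\<close>
  define A where "A = insert (g z0) A'"
  interpret zero_order_meromorphic q c g A
    using q meromorphic nonconstant zero_order fin_pts(3) by unfold_locales (auto simp: A_def)
  \<comment> \<open>At most one of the more than two targets is infinite.\<close>
  have A'_ne: "A' \<noteq> {}" using fin_pts(2) l by (auto split: if_splits)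
  obtain C1 C2 where C: "C1 \<ge> 0" "C2 \<ge> 0"
    "\<And>r Q. admissible r \<Longrightarrow> excess_le N r Q \<Longrightarrow> Q \<ge> 0 \<Longrightarrow>
      real (card A') * T r \<le> (\<Sum>a\<in>A'. nevanlinna_N r (\<lambda>z. 1 / fn a z)) + nevanlinna_m r g
        + nevanlinna_N r D - nevanlinna_N r (\<lambda>z. 1 / D z) + (C1 * Q + C2)"
    by (rule second_main_inequality[of A']) (use A'_ne in \<open>auto simp: A_def\<close>)
  obtain C3 r1 where C3: "\<And>r. r \<ge> r1 \<Longrightarrow>
    (\<Sum>i\<in>{1..l}. nevanlinna_N_at r g (a i)) - ramification_N q c g r \<le> (\<Sum>i\<in>{1..l}. hat_N q c r g (a i)) + C3"
    using sum_nevanlinna_N_at_le[OF nice nonconst q finite_atLeastAtMost distinct_points, of c] by blast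
  obtain C4 where C4: "\<And>r. good r \<Longrightarrow> r \<ge> 1 \<Longrightarrow> r \<ge> norm z0 \<Longrightarrow> T r \<ge> ln r - C4"
    using T_lower[OF z0] by (auto simp: A_def)
  \<comment> \<open>The last two entries are the two inequalities in \<open>admissible\<close>,
    solved for \<open>r\<close>.\<close>
  define r0 where "r0 = Max {1, r1, norm z0, norm c / (1 - norm q), (norm c + 1) / norm (q - 1)}"
  have r0: "r0 \<ge> 1" "r0 \<ge> r1" "r0 \<ge> norm z0" "r0 \<ge> norm c / (1 - norm q)" "r0 \<ge> (norm c + 1) / norm (q - 1)"
    by (auto simp: r0_def)
  have N_growth: "\<exists>C. \<forall>t\<ge>1. N t \<le> C * t powr e" if e: "e > 0" for e
  proof -
    obtain C where "\<And>t. t \<ge> 1 \<Longrightarrow> N t \<le> C * t powr e" by (rule N_small[OF e]) blast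
    thus ?thesis by blast
  qed
  have contN: "continuous_on {1..} N"
    unfolding N_def by (rule continuous_on_weight_N[OF w_lf])
  obtain Q E where E: "has_log_density_1 E" "E \<subseteq> {r0..}" "E \<inter> {r. \<not> good r} = {}"
    and Q: "Q \<in> o[inf at_top (principal E)](\<lambda>r. 1 + N r)" "\<And>r. r \<ge> 1 \<Longrightarrow> Q r \<ge> 0"
    "\<And>r. r \<ge> 1 \<Longrightarrow> excess_le N r (Q r)"
    by (rule growth_lemma[OF contN N_mono N_nonneg N_growth countable_not_good, of r0]) blast+
  have rE: "good r" "r \<ge> 1" "r \<ge> r1" "r \<ge> norm z0" "norm q * r + norm c \<le> r" "norm (q - 1) * r \<ge> norm c + 1"
    if "r \<in> E" for r
  proof -
    have r: "r \<ge> r0" using that E by auto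
    show "good r" using that E by auto
    show "r \<ge> 1" "r \<ge> r1" "r \<ge> norm z0" using r r0 by linarith+
    have "norm c / (1 - norm q) \<le> r" using r r0 by linarith
    thus "norm q * r + norm c \<le> r" using q by (simp add: divide_le_eq algebra_simps)
    have "norm (q - 1) > 0" using q by auto
    moreover have "(norm c + 1) / norm (q - 1) \<le> r" using r r0 by linarith
    ultimately show "norm (q - 1) * r \<ge> norm c + 1" by (simp add: divide_le_eq mult.commute)
  qed
  define F where "F = inf at_top (principal E)"
  have evE: "eventually (\<lambda>r. r \<in> E) F" by (auto simp: F_def eventually_inf_principal)
  have T_large: "eventually (\<lambda>r. T r \<ge> X) F" for X
  proof -
    have "eventually (\<lambda>r. ln r \<ge> X + C4) at_top"
      using ln_at_top by (simp add: filterlim_at_top)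
    hence "eventually (\<lambda>r. ln r \<ge> X + C4) F" unfolding F_def by (rule filter_leD[rotated]) simp
    thus ?thesis using evE
    proof eventually_elim
      case (elim r)
      thus ?case using C4[of r] rE[of r] by simp
    qed
  qed
  have const_small: "(\<lambda>_. X) \<in> o[F](T)" for X :: real
  proof (rule landau_o.smallI)
    fix e :: real assume e: "e > 0"
    have "\<forall>\<^sub>F r in F. T r \<ge> \<bar>X\<bar> / e" by (rule T_large)
    thus "\<forall>\<^sub>F r in F. norm X \<le> e * norm (T r)"
    proof eventually_elim
      case (elim r)
      hence "\<bar>X\<bar> \<le> e * T r" using e by (simp add: divide_le_eq mult.commute)
      also have "\<dots> \<le> e * norm (T r)" using e by (intro mult_left_mono) auto
      finally show ?case by simp
    qed
  qed
  \<comment> \<open>Eventually \<open>T r \<ge> 1\<close> on \<open>E\<close>, so the additive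
    constants in the bound of \<open>N\<close> by \<open>T\<close> become multiples of
    \<open>T\<close>.\<close>
  have "(\<lambda>r. 1 + N r) \<in> O[F](T)"
  proof (rule bigoI)
    show "\<forall>\<^sub>F r in F. norm (1 + N r) \<le> (1 + real (card A) * (2 + K)) * norm (T r)"
      using T_large[of 1] evE
    proof eventually_elim
      case (elim r)
      note r = rE[OF elim(2)]
      have "K * 1 \<le> K * T r" using elim K_nonneg by (intro mult_left_mono)
      hence "N r \<le> real (card A) * (2 * T r + K * T r)"
        using N_le_T[OF r(1,2)] by (smt (verit) mult_left_mono of_nat_0_le_iff)
      hence "1 + N r \<le> (1 + real (card A) * (2 + K)) * T r" using elim by (simp add: algebra_simps)
      thus ?case using N_nonneg[OF r(2)] elim by simp
    qed
  qed
  hence Q_small: "Q \<in> o[F](T)" using Q(1) unfolding F_def[symmetric] by (rule landau_o.small_big_trans[rotated])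
  define S1 where "S1 = (\<lambda>r. C1 * Q r + C2)"
  \<comment> \<open>The middle expression of the claim contains \<open>S1\<close>, so the right-hand
    error has to carry it as well.\<close>
  define S2 where "S2 = (\<lambda>r. S1 r + C3)"
  have S1: "S1 \<in> o[F](T)"
    unfolding S1_def by (intro sum_in_smallo const_small) (use Q_small in \<open>cases "C1 = 0"; simp\<close>)
  have S2: "S2 \<in> o[F](T)"
    unfolding S2_def by (intro sum_in_smallo const_small S1)
  have first: "(real l - 2) * T r \<le> (\<Sum>i=1..l. nevanlinna_N_at r g (a i)) - ramification_N q c g r + S1 r"
    if "r \<in> E" for r
  proof -
    note r = rE[OF that]
    have main: "real (card A') * T r \<le> (\<Sum>a\<in>A'. nevanlinna_N r (\<lambda>z. 1 / fn a z)) + nevanlinna_m r g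
        + nevanlinna_N r D - nevanlinna_N r (\<lambda>z. 1 / D z) + S1 r"
      unfolding S1_def using r Q by (intro C(3)) (auto simp: admissible_def)
    have Nsum: "(\<Sum>i=1..l. nevanlinna_N_at r g (a i)) = (\<Sum>b\<in>A'. nevanlinna_N r (\<lambda>z. 1 / fn b z)) +
       (if None \<in> a ` {1..l} then nevanlinna_N r g else 0)"
      using fin_pts(1)[of "nevanlinna_N_at r g"] by (simp add: nevanlinna_N_at_def)
    have card: "real l = real (card A') + (if None \<in> a ` {1..l} then 1 else 0)"
      using fin_pts(2) by auto
    have m: "nevanlinna_m r g \<ge> 0" using r by (intro nevanlinna_m_nonneg) auto
    \<comment> \<open>With infinity among the targets, one \<open>T r = m + N\<close> is subtracted
      and the two sides agree exactly. Without it, \<open>2 * T r\<close> is subtracted and a spare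
      \<open>- nevanlinna_m r g\<close> is dropped.\<close>
    show ?thesis
      using main m unfolding Nsum card ramification_N_def nevanlinna_T_def
      by (cases "None \<in> a ` {1..l}") (simp_all add: algebra_simps)
  qed
  have second: "(\<Sum>i=1..l. nevanlinna_N_at r g (a i)) - ramification_N q c g r + S1 r \<le> (\<Sum>i=1..l. hat_N q c r g (a i)) + S2 r"
    if "r \<in> E" for r
    using C3[OF rE(3)[OF that]] by (simp add: S2_def)
  show ?thesis
    using E(1) S1 S2 first second unfolding F_def by blast
qed

end
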